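(* Let $(\tilde H,\Gamma_{\tilde Q})$ be the monster model of $\mathcal{K}_{(H,\Gamma_Q)}$ and let $G\subseteq\tilde H$ be small. Then $acl(G)$ is the closed Hilbert subspace of $\tilde H$ generated by the union of $dcl(G)$ with $acl(\emptyset)$.
   Context: All Hilbert spaces are complex. For a self-adjoint (densely defined, possibly unbounded) operator $Q$ on $H$, $\sigma(Q)$ is its spectrum and $\sigma_e(Q)$ is the set of $\lambda\in\mathbb{C}$ such that $(Q-\lambda I)S\neq I+K$ for every bounded $S$ and compact $K$ on $H$. $Q_1\sim_\sigma Q_2$ means: $\sigma(Q_1)=\sigma(Q_2)$, $\sigma_e(Q_1)=\sigma_e(Q_2)$, and the $\lambda$-eigenspaces of $Q_1$ and $Q_2$ have equal dimension for all $\lambda\in\sigma(Q_1)\setminus\sigma_e(Q_1)$. $(H,\Gamma_Q)$ denotes the metric structure consisting of the Hilbert space $H$ (with $0$, $+$, multiplication by $i$ and by rationals, the norm) and the predicate $\Gamma_Q(v,w)=$ distance from $(v,w)\in H\times H$ to the graph of the closed self-adjoint operator $Q$. Fix $(H,\Gamma_Q)$ with $Q$ closed unbounded self-adjoint. $\mathcal{K}_{(H,\Gamma_Q)}$ is the class of all such structures $(H',\Gamma_{Q'})$ with $Q'\sim_\sigma Q$; $(H_1,\Gamma_{Q_1})\prec(H_2,\Gamma_{Q_2})$ iff $H_1\subseteq H_2$ and $Q_1\subseteq Q_2$. A $\mathcal{K}$-embedding $f:M\to N$ is an embedding of metric structures with $f(M)\prec N$. Galois types: for $M_1,M_2\in\mathcal{K}$,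 $A\subseteq M_1\cap M_2$, one writes $gatp_{M_1}((a_i)_{i<\alpha}/A)=gatp_{M_2}((b_i)_{i<\alpha}/A)$ if there are $N\in\mathcal{K}$ and $\mathcal{K}$-embeddings $f:M_1\to N$, $g:M_2\to N$ with $f(a_i)=g(b_i)$ for all $i<\alpha$ and $f\upharpoonright A=g\upharpoonright A=\mathrm{Id}_A$. Monster model: for a fixed sufficiently large cardinal $\kappa$ (larger than the density of every structure to be studied), $(\tilde H,\Gamma_{\tilde Q})\in\mathcal{K}_{(H,\Gamma_Q)}$ is $\kappa$-universal (every $M\in\mathcal{K}$ with $|M|<\kappa$ has a $\mathcal{K}$-embedding into it) and $\kappa$-homogeneous (if two sequences of length $\alpha<\kappa$ in it have the property that all corresponding finite subtuples have the same Galois type over $\emptyset$, then some automorphism maps one sequence to the other). Small means of size $<\kappa$. Automorphisms of $(\tilde H,\Gamma_{\tilde Q})$ are the unitary operators $U$ on $\tilde H$ with $UD(\tilde Q)=D(\tilde Q)$ and $U\tilde Qv=\tilde QUv$ for $v\in D(\tilde Q)$. For small $A$: $dcl(A)$ is the set of $m\in\tilde H$ fixed by every automorphism of the monster model that fixes $A$ pointwise; $acl(A)$ is the set of $m\in\tilde H$ whose orbit under the automorphisms of the monster model fixing $A$ pointwise is compact. *)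

theory Defs
  imports "HOL-Algebra.Module" "HOL-Analysis.Abstract_Metric_Spaces"
begin

unbundle cardinal_syntax

section \<open>Complex Hilbert spaces on carrier sets\<close>

text \<open>
  The classes of structures considered below range over Hilbert spaces with varying underlying
  sets, so Hilbert spaces are records with an explicit carrier.  The fields \<open>mult\<close> and \<open>one\<close>,
  inherited from the HOL-Algebra module record, play no role.
\<close>

definition complex_field :: "complex ring" where
  "complex_field = \<lparr>carrier = UNIV, mult = (*), one = 1, zero = 0, add = (+)\<rparr>"

record 'a hilbert = "(complex, 'a) module" +
  cinner :: "'a \<Rightarrow> 'a \<Rightarrow> complex"

definition hnorm :: "('a, 'm) hilbert_scheme \<Rightarrow> 'a \<Rightarrow> real" where
  "hnorm H x = sqrt (Re (cinner H x x))"

text \<open>The value outside the carrier is fixed because \<^locale>\<open>Metric_space\<close> demands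
  nonnegativity and symmetry for all elements of the type.\<close>

definition hdist :: "('a, 'm) hilbert_scheme \<Rightarrow> 'a \<Rightarrow> 'a \<Rightarrow> real" where
  "hdist H x y = (if x \<in> carrier H \<and> y \<in> carrier H then hnorm H (x \<ominus>\<^bsub>H\<^esub> y) else 0)"

abbreviation htopology :: "('a, 'm) hilbert_scheme \<Rightarrow> 'a topology" where
  "htopology H \<equiv> Metric_space.mtopology (carrier H) (hdist H)"

locale complex_hilbert_space = Module.module complex_field H
  for H :: "('a, 'm) hilbert_scheme" (structure) +
  assumes cinner_commute:
      "\<lbrakk>x \<in> carrier H; y \<in> carrier H\<rbrakk> \<Longrightarrow> cinner H x y = cnj (cinner H y x)"
    and cinner_add_left:
      "\<lbrakk>x \<in> carrier H; y \<in> carrier H; z \<in> carrier H\<rbrakk>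
        \<Longrightarrow> cinner H (x \<oplus> y) z = cinner H x z + cinner H y z"
    and cinner_smult_left:
      "\<lbrakk>x \<in> carrier H; y \<in> carrier H\<rbrakk> \<Longrightarrow> cinner H (c \<odot> x) y = c * cinner H x y"
    and cinner_ge_zero: "x \<in> carrier H \<Longrightarrow> 0 \<le> Re (cinner H x x)"
    and cinner_eq_zero_iff: "x \<in> carrier H \<Longrightarrow> cinner H x x = 0 \<longleftrightarrow> x = \<zero>"
    and complete: "Metric_space.mcomplete (carrier H) (hdist H)"

definition closed_subspace :: "('a, 'm) hilbert_scheme \<Rightarrow> 'a set \<Rightarrow> bool" where
  "closed_subspace H S \<longleftrightarrow> submodule S complex_field H \<and> closedin (htopology H) S"

definition closed_span :: "('a, 'm) hilbert_scheme \<Rightarrow> 'a set \<Rightarrow> 'a set" where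
  "closed_span H X = \<Inter> {S. closed_subspace H S \<and> X \<subseteq> S}"

definition orthonormal_basis :: "('a, 'm) hilbert_scheme \<Rightarrow> 'a set \<Rightarrow> 'a set \<Rightarrow> bool" where
  "orthonormal_basis H E B \<longleftrightarrow>
    B \<subseteq> E \<and> (\<forall>x\<in>B. \<forall>y\<in>B. cinner H x y = (if x = y then 1 else 0)) \<and> closed_span H B = E"

text \<open>Equality of the Hilbert space dimensions of closed subspaces of two Hilbert spaces.\<close>

definition same_dim ::
  "('a, 'm) hilbert_scheme \<Rightarrow> 'a set \<Rightarrow> ('b, 'n) hilbert_scheme \<Rightarrow> 'b set \<Rightarrow> bool" where
  "same_dim H1 E1 H2 E2 \<longleftrightarrow>
    (\<exists>B1 B2. orthonormal_basis H1 E1 B1 \<and> orthonormal_basis H2 E2 B2 \<and> |B1| =o |B2| )"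

definition linear_map_on :: "('a, 'm) hilbert_scheme \<Rightarrow> ('a \<Rightarrow> 'a) \<Rightarrow> bool" where
  "linear_map_on H S \<longleftrightarrow>
    S ` carrier H \<subseteq> carrier H \<and>
    (\<forall>x\<in>carrier H. \<forall>y\<in>carrier H. S (x \<oplus>\<^bsub>H\<^esub> y) = S x \<oplus>\<^bsub>H\<^esub> S y) \<and>
    (\<forall>c. \<forall>x\<in>carrier H. S (c \<odot>\<^bsub>H\<^esub> x) = c \<odot>\<^bsub>H\<^esub> S x)"

definition bounded_op :: "('a, 'm) hilbert_scheme \<Rightarrow> ('a \<Rightarrow> 'a) \<Rightarrow> bool" where
  "bounded_op H S \<longleftrightarrow>
    linear_map_on H S \<and> (\<exists>C. \<forall>x\<in>carrier H. hnorm H (S x) \<le> C * hnorm H x)"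

definition compact_op :: "('a, 'm) hilbert_scheme \<Rightarrow> ('a \<Rightarrow> 'a) \<Rightarrow> bool" where
  "compact_op H K \<longleftrightarrow>
    bounded_op H K \<and>
    compactin (htopology H)
      (htopology H closure_of (K ` {x \<in> carrier H. hnorm H x \<le> 1}))"


section \<open>Unbounded operators, given by their graphs\<close>

definition linear_operator :: "('a, 'm) hilbert_scheme \<Rightarrow> ('a \<times> 'a) set \<Rightarrow> bool" where
  "linear_operator H Q \<longleftrightarrow>
    Q \<subseteq> carrier H \<times> carrier H \<and> single_valued Q \<and> (\<zero>\<^bsub>H\<^esub>, \<zero>\<^bsub>H\<^esub>) \<in> Q \<and>
    (\<forall>(x, y)\<in>Q. \<forall>(x', y')\<in>Q. (x \<oplus>\<^bsub>H\<^esub> x', y \<oplus>\<^bsub>H\<^esub> y') \<in> Q) \<and>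
    (\<forall>c. \<forall>(x, y)\<in>Q. (c \<odot>\<^bsub>H\<^esub> x, c \<odot>\<^bsub>H\<^esub> y) \<in> Q)"

definition densely_defined :: "('a, 'm) hilbert_scheme \<Rightarrow> ('a \<times> 'a) set \<Rightarrow> bool" where
  "densely_defined H Q \<longleftrightarrow> htopology H closure_of (Domain Q) = carrier H"

definition closed_operator :: "('a, 'm) hilbert_scheme \<Rightarrow> ('a \<times> 'a) set \<Rightarrow> bool" where
  "closed_operator H Q \<longleftrightarrow>
    closedin (Metric_space.mtopology (carrier H \<times> carrier H) (prod_dist (hdist H) (hdist H))) Q"

definition unbounded_operator :: "('a, 'm) hilbert_scheme \<Rightarrow> ('a \<times> 'a) set \<Rightarrow> bool" where
  "unbounded_operator H Q \<longleftrightarrow> \<not> (\<exists>C. \<forall>(x, y)\<in>Q. hnorm H y \<le> C * hnorm H x)"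

definition adjoint_graph :: "('a, 'm) hilbert_scheme \<Rightarrow> ('a \<times> 'a) set \<Rightarrow> ('a \<times> 'a) set" where
  "adjoint_graph H Q =
    {(y, z). y \<in> carrier H \<and> z \<in> carrier H \<and> (\<forall>(x, w)\<in>Q. cinner H w y = cinner H x z)}"

definition selfadjoint_operator :: "('a, 'm) hilbert_scheme \<Rightarrow> ('a \<times> 'a) set \<Rightarrow> bool" where
  "selfadjoint_operator H Q \<longleftrightarrow>
    linear_operator H Q \<and> densely_defined H Q \<and> adjoint_graph H Q = Q"

text \<open>The graph of $Q - \lambda I$.\<close>

definition shift_graph ::
  "('a, 'm) hilbert_scheme \<Rightarrow> ('a \<times> 'a) set \<Rightarrow> complex \<Rightarrow> ('a \<times> 'a) set" where
  "shift_graph H Q l = (\<lambda>(x, y). (x, y \<ominus>\<^bsub>H\<^esub> (l \<odot>\<^bsub>H\<^esub> x))) ` Q"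

text \<open>
  An equation $(Q - \lambda I) S = T$ with $S$, $T$ defined everywhere includes the statement that
  $S$ maps into the domain of $Q$; on graphs it reads $(Sv, Tv) \in Q - \lambda I$ for all $v$.
\<close>

definition spectrum :: "('a, 'm) hilbert_scheme \<Rightarrow> ('a \<times> 'a) set \<Rightarrow> complex set" where
  "spectrum H Q =
    {l. \<not> (\<exists>S. bounded_op H S \<and>
             (\<forall>v\<in>carrier H. (S v, v) \<in> shift_graph H Q l) \<and>
             (\<forall>(x, y)\<in>shift_graph H Q l. S y = x))}"

definition ess_spectrum :: "('a, 'm) hilbert_scheme \<Rightarrow> ('a \<times> 'a) set \<Rightarrow> complex set" where
  "ess_spectrum H Q =
    {l. \<not> (\<exists>S K. bounded_op H S \<and> compact_op H K \<and>
             (\<forall>v\<in>carrier H. (S v, v \<oplus>\<^bsub>H\<^esub> K v) \<in> shift_graph H Q l))}"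

definition eigenspace ::
  "('a, 'm) hilbert_scheme \<Rightarrow> ('a \<times> 'a) set \<Rightarrow> complex \<Rightarrow> 'a set" where
  "eigenspace H Q l = {v \<in> carrier H. (v, l \<odot>\<^bsub>H\<^esub> v) \<in> Q}"


section \<open>The class of structures\<close>

text \<open>The graph of the operator is stored in place of the predicate $\Gamma_Q$, which is
  determined by it.\<close>

record 'a op_structure = "'a hilbert" +
  opgraph :: "('a \<times> 'a) set"

definition Gam :: "'a op_structure \<Rightarrow> 'a \<Rightarrow> 'a \<Rightarrow> real" where
  "Gam M v w = (INF p\<in>opgraph M. prod_dist (hdist M) (hdist M) (v, w) p)"

definition unbounded_sa_structure :: "'a op_structure \<Rightarrow> bool" where
  "unbounded_sa_structure M \<longleftrightarrow>
    complex_hilbert_space M \<and> selfadjoint_operator M (opgraph M) \<and>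
    closed_operator M (opgraph M) \<and> unbounded_operator M (opgraph M)"

definition sim_sigma :: "'a op_structure \<Rightarrow> 'b op_structure \<Rightarrow> bool" where
  "sim_sigma M N \<longleftrightarrow>
    spectrum M (opgraph M) = spectrum N (opgraph N) \<and>
    ess_spectrum M (opgraph M) = ess_spectrum N (opgraph N) \<and>
    (\<forall>l \<in> spectrum M (opgraph M) - ess_spectrum M (opgraph M).
       same_dim M (eigenspace M (opgraph M) l) N (eigenspace N (opgraph N) l))"

text \<open>
  The members of the class of \<open>M0\<close> whose carrier is a subset of the type \<^typ>\<open>'a\<close>, which plays
  the role of the universe of sets: every member of cardinality at most that of \<^typ>\<open>'a\<close> has an
  isomorphic copy here.
\<close>

definition K_class :: "'h op_structure \<Rightarrow> 'a op_structure set" where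
  "K_class M0 = {M. unbounded_sa_structure M \<and> sim_sigma M M0}"

definition prec :: "'a op_structure \<Rightarrow> 'a op_structure \<Rightarrow> bool" where
  "prec M N \<longleftrightarrow>
    carrier M \<subseteq> carrier N \<and> \<zero>\<^bsub>M\<^esub> = \<zero>\<^bsub>N\<^esub> \<and>
    (\<forall>x\<in>carrier M. \<forall>y\<in>carrier M. x \<oplus>\<^bsub>M\<^esub> y = x \<oplus>\<^bsub>N\<^esub> y) \<and>
    (\<forall>c. \<forall>x\<in>carrier M. c \<odot>\<^bsub>M\<^esub> x = c \<odot>\<^bsub>N\<^esub> x) \<and>
    (\<forall>x\<in>carrier M. \<forall>y\<in>carrier M. cinner M x y = cinner N x y) \<and>
    opgraph M \<subseteq> opgraph N"

definition metric_embedding :: "'a op_structure \<Rightarrow> 'a op_structure \<Rightarrow> ('a \<Rightarrow> 'a) \<Rightarrow> bool" where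
  "metric_embedding M N f \<longleftrightarrow>
    f ` carrier M \<subseteq> carrier N \<and> f \<zero>\<^bsub>M\<^esub> = \<zero>\<^bsub>N\<^esub> \<and>
    (\<forall>x\<in>carrier M. \<forall>y\<in>carrier M. f (x \<oplus>\<^bsub>M\<^esub> y) = f x \<oplus>\<^bsub>N\<^esub> f y) \<and>
    (\<forall>x\<in>carrier M. f (\<i> \<odot>\<^bsub>M\<^esub> x) = \<i> \<odot>\<^bsub>N\<^esub> f x) \<and>
    (\<forall>q\<in>\<rat>. \<forall>x\<in>carrier M. f (q \<odot>\<^bsub>M\<^esub> x) = q \<odot>\<^bsub>N\<^esub> f x) \<and>
    (\<forall>x\<in>carrier M. hnorm N (f x) = hnorm M x) \<and>
    (\<forall>x\<in>carrier M. \<forall>y\<in>carrier M. Gam N (f x) (f y) = Gam M x y)"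

text \<open>The image $f(M)$ of an embedding, with the operations inherited from \<open>N\<close> and the
  transported operator $f Q f^{-1}$.\<close>

definition image_structure ::
  "('a \<Rightarrow> 'a) \<Rightarrow> 'a op_structure \<Rightarrow> 'a op_structure \<Rightarrow> 'a op_structure" where
  "image_structure f M N =
    N\<lparr>carrier := f ` carrier M, opgraph := map_prod f f ` opgraph M\<rparr>"

definition K_embedding :: "'a op_structure \<Rightarrow> 'a op_structure \<Rightarrow> ('a \<Rightarrow> 'a) \<Rightarrow> bool" where
  "K_embedding M N f \<longleftrightarrow> metric_embedding M N f \<and> prec (image_structure f M N) N"

text \<open>
  Equality of the Galois types over \<open>A\<close> of $(a_i)_{i \in I}$ in \<open>M1\<close> and $(b_i)_{i \in I}$ in
  \<open>M2\<close>.  An amalgam \<open>N\<close> may always be shrunk to one generated by the two images, which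
  fits into the type \<^typ>\<open>'a\<close>.
\<close>

definition same_gatp ::
  "'h op_structure \<Rightarrow> 'a op_structure \<Rightarrow> ('i \<Rightarrow> 'a) \<Rightarrow> 'a op_structure \<Rightarrow> ('i \<Rightarrow> 'a)
    \<Rightarrow> 'i set \<Rightarrow> 'a set \<Rightarrow> bool" where
  "same_gatp M0 M1 a M2 b I A \<longleftrightarrow>
    (\<exists>N \<in> K_class M0. \<exists>f g. K_embedding M1 N f \<and> K_embedding M2 N g \<and>
       (\<forall>i\<in>I. f (a i) = g (b i)) \<and> (\<forall>x\<in>A. f x = x \<and> g x = x))"

definition automorphism :: "'a op_structure \<Rightarrow> ('a \<Rightarrow> 'a) \<Rightarrow> bool" where
  "automorphism M U \<longleftrightarrow>
    bij_betw U (carrier M) (carrier M) \<and> linear_map_on M U \<and>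
    (\<forall>x\<in>carrier M. \<forall>y\<in>carrier M. cinner M (U x) (U y) = cinner M x y) \<and>
    U ` Domain (opgraph M) = Domain (opgraph M) \<and>
    (\<forall>(v, w)\<in>opgraph M. (U v, U w) \<in> opgraph M)"


section \<open>The monster model\<close>

definition K_universal :: "'h op_structure \<Rightarrow> 'k rel \<Rightarrow> 'a op_structure \<Rightarrow> bool" where
  "K_universal M0 \<kappa> M \<longleftrightarrow>
    (\<forall>N :: 'a op_structure. N \<in> K_class M0 \<and> |carrier N| <o \<kappa> \<longrightarrow> (\<exists>f. K_embedding N M f))"

text \<open>The ordinals $\alpha < \kappa$ are represented by the proper initial segments
  \<^term>\<open>underS \<kappa> i\<close> of the well-order \<open>\<kappa>\<close>.\<close>

definition K_homogeneous :: "'h op_structure \<Rightarrow> 'k rel \<Rightarrow> 'a op_structure \<Rightarrow> bool" where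
  "K_homogeneous M0 \<kappa> M \<longleftrightarrow>
    (\<forall>i \<in> Field \<kappa>. \<forall>a b.
       a ` underS \<kappa> i \<subseteq> carrier M \<and> b ` underS \<kappa> i \<subseteq> carrier M \<and>
       (\<forall>F. finite F \<and> F \<subseteq> underS \<kappa> i \<longrightarrow> same_gatp M0 M a M b F {})
       \<longrightarrow> (\<exists>U. automorphism M U \<and> (\<forall>j \<in> underS \<kappa> i. U (a j) = b j)))"

definition monster_model :: "'h op_structure \<Rightarrow> 'k rel \<Rightarrow> 'a op_structure \<Rightarrow> bool" where
  "monster_model M0 \<kappa> M \<longleftrightarrow>
    M \<in> K_class M0 \<and> K_universal M0 \<kappa> M \<and> K_homogeneous M0 \<kappa> M"

definition Aut_over :: "'a op_structure \<Rightarrow> 'a set \<Rightarrow> ('a \<Rightarrow> 'a) set" where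
  "Aut_over M A = {U. automorphism M U \<and> (\<forall>x\<in>A. U x = x)}"

definition dcl :: "'a op_structure \<Rightarrow> 'a set \<Rightarrow> 'a set" where
  "dcl M A = {m \<in> carrier M. \<forall>U \<in> Aut_over M A. U m = m}"

definition acl :: "'a op_structure \<Rightarrow> 'a set \<Rightarrow> 'a set" where
  "acl M A = {m \<in> carrier M. compactin (htopology M) ((\<lambda>U. U m) ` Aut_over M A)}"

end

theory Submission
  imports Defs "HOL-Library.Diagonal_Subsequence"
begin

text \<open>
  A unitary map is an automorphism iff it commutes with the resolvent of the operator, so a closed
  subspace invariant under the resolvents at $\pm i$ can be treated independently of its orthogonal
  complement, and no spectral theorem is needed.

  The vectors with totally bounded orbit over \<open>G\<close> form a closed subspace, and their orbits are in
  fact compact: on the reducing subspace generated by the orbit, automorphisms have strongly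
  convergent subsequences whose limits extend by the identity.  Hence \<open>acl G\<close> is a closed subspace
  containing \<open>dcl G\<close> and \<open>acl {}\<close>.

  Conversely, let \<open>m \<noteq> 0\<close> in \<open>acl G\<close> be orthogonal to both, and let \<open>X\<close> be the (separable) reducing
  subspace generated by \<open>m\<close>.  Eigenvectors for values outside the essential spectrum lie in
  \<open>acl {}\<close>, so the operator has its spectrum on \<open>X\<close> inside the essential spectrum, and the sum of
  \<open>M0\<close> with countably many copies of \<open>X\<close> is again in the class.  By universality \<open>M\<close> contains
  infinitely many orthogonal copies of \<open>X\<close>, by homogeneity even \<open>\<kappa>\<close> many.  All but fewer than \<open>\<kappa>\<close>
  of them are orthogonal to \<open>G\<close> and \<open>X\<close>; exchanging \<open>X\<close> with such a copy is an automorphism over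
  \<open>G\<close>, so the orbit of \<open>m\<close> contains an infinite orthogonal set of vectors of equal norm, which is
  not totally bounded.
\<close>

section \<open>Hilbert spaces\<close>

text \<open>The orthogonal copies have to outnumber \<open>G\<close>. One vector may fail to be
  orthogonal to countably many members of an orthogonal family, so an uncountable \<open>G\<close>
  can exhaust a countable one. Universality alone does not supply enough: a square-summable sum over
  an index set of size \<mu> can have as many elements as the countable power of \<mu>, and
  \<open>\<kappa>\<close> is not assumed closed under such powers. A sum with countably many copies
  of a space of at most continuum size stays within \<open>|carrier M0|\<close>; homogeneity does
  the rest. It asks for Galois types of finite subtuples only, so automorphisms that permute
  finitely many copies suffice.

  The spectral data limit what can be added: outside the essential spectrum eigenspaces have a
  prescribed, in fact finite, dimension, so adding copies of such an eigenvector would leave the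
  class. Orthogonality to \<open>acl {}\<close> removes exactly this obstruction.

  Compactness of orbits is not visibly stable under sums and limits, while total boundedness is;
  hence \<open>precompact\<close> is the working notion and closedness of the orbit is treated
  separately.\<close>

lemma complex_field_simps [simp]:
  "carrier complex_field = UNIV" "mult complex_field = (*)" "one complex_field = 1"
  "zero complex_field = 0" "add complex_field = (+)"
  by (simp_all add: complex_field_def)

lemma cring_complex_field: "cring complex_field"
proof (rule cringI)
  show "abelian_group complex_field"
    by (rule abelian_groupI) (auto simp: algebra_simps intro: exI[of _ "- _"] add.left_inverse)
  show "comm_monoid complex_field"
    by (rule comm_monoidI) (auto simp: algebra_simps)
qed (auto simp: algebra_simps)

text \<open>The discriminant argument on scalars: with \<open>p\<close> the squared modulus of an
  inner product and \<open>a\<close>, \<open>b\<close> squared norms, the quadratic is the squared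
  norm of \<open>x\<close> minus \<open>t\<close> times that inner product times \<open>y\<close>.
  It serves Cauchy-Schwarz and, with \<open>a = 0\<close>, the orthogonality at a nearest
  point.\<close>

lemma cauchy_schwarz_arith:
  fixes a b p :: real
  assumes "0 \<le> a" "0 \<le> b" "\<And>t. 0 \<le> a - 2 * t * p + t\<^sup>2 * p * b" "0 \<le> p"
  shows "p \<le> a * b"
proof (cases "b = 0")
  case True
  \<comment> \<open>Without a quadratic term the expression is linear in \<open>t\<close>; this
    value of \<open>t\<close> makes it \<open>- a - 2\<close>, so \<open>p\<close> must
    vanish.\<close>
  have "0 \<le> a - 2 * (a + 1) / p * p" if "p \<noteq> 0"
    using assms(3)[of "(a + 1) / p"] True by simp
  then show ?thesis
    using True assms(1,4) by (cases "p = 0") auto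
next
  case False
  then have b: "b > 0" using assms(2) by simp
  \<comment> \<open>\<open>1 / b\<close> is the minimiser of the quadratic.\<close>
  have "0 \<le> a - 2 * (1 / b) * p + (1 / b)\<^sup>2 * p * b" by (rule assms(3))
  also have "\<dots> = a - p / b"
    using b by (simp add: field_simps power2_eq_square)
  finally show ?thesis
    using b by (simp add: field_simps)
qed

text \<open>Completeness is left out so that the calculus of norms and limits is available while
  completeness is still to be proved, for closed subspaces and for direct sums.\<close>

locale inner_module = Module.module complex_field H
  for H :: "('a, 'm) hilbert_scheme" (structure) +
  assumes cinner_commute:
      "\<lbrakk>x \<in> carrier H; y \<in> carrier H\<rbrakk> \<Longrightarrow> cinner H x y = cnj (cinner H y x)"
    and cinner_add_left [simp]:
      "\<lbrakk>x \<in> carrier H; y \<in> carrier H; z \<in> carrier H\<rbrakk>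
        \<Longrightarrow> cinner H (x \<oplus> y) z = cinner H x z + cinner H y z"
    and cinner_smult_left [simp]:
      "\<lbrakk>x \<in> carrier H; y \<in> carrier H\<rbrakk> \<Longrightarrow> cinner H (c \<odot> x) y = c * cinner H x y"
    and cinner_ge_zero: "x \<in> carrier H \<Longrightarrow> 0 \<le> Re (cinner H x x)"
    and cinner_eq_zero_iff: "x \<in> carrier H \<Longrightarrow> cinner H x x = 0 \<longleftrightarrow> x = \<zero>"
begin

lemma add_in [simp, intro]: "x \<in> carrier H \<Longrightarrow> y \<in> carrier H \<Longrightarrow> x \<oplus> y \<in> carrier H"
  by (rule M.a_closed)
lemma diff_in [simp, intro]: "x \<in> carrier H \<Longrightarrow> y \<in> carrier H \<Longrightarrow> x \<ominus> y \<in> carrier H"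
  by (rule M.minus_closed)
lemma neg_in [simp, intro]: "x \<in> carrier H \<Longrightarrow> \<ominus> x \<in> carrier H"
  by (rule M.a_inv_closed)
lemma zero_in [simp, intro]: "\<zero> \<in> carrier H"
  by (rule M.zero_closed)
lemma smult_in [simp, intro]: "x \<in> carrier H \<Longrightarrow> c \<odot> x \<in> carrier H"
  by (rule smult_closed) simp_all

lemma cinner_zero_left [simp]: "x \<in> carrier H \<Longrightarrow> cinner H \<zero> x = 0"
  using cinner_add_left[of \<zero> \<zero> x] by simp

lemma cinner_neg_left [simp]:
  assumes "x \<in> carrier H" "y \<in> carrier H"
  shows "cinner H (\<ominus> x) y = - cinner H x y"
proof -
  have "cinner H (\<ominus> x \<oplus> x) y = cinner H (\<ominus> x) y + cinner H x y"
    using assms by (intro cinner_add_left) auto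
  then show ?thesis
    using assms by (simp add: M.l_neg add_eq_0_iff2)
qed

lemma cinner_diff_left [simp]:
  "\<lbrakk>x \<in> carrier H; y \<in> carrier H; z \<in> carrier H\<rbrakk>
    \<Longrightarrow> cinner H (x \<ominus> y) z = cinner H x z - cinner H y z"
  by (simp add: a_minus_def cinner_add_left)

lemma cinner_add_right [simp]:
  "\<lbrakk>x \<in> carrier H; y \<in> carrier H; z \<in> carrier H\<rbrakk>
    \<Longrightarrow> cinner H z (x \<oplus> y) = cinner H z x + cinner H z y"
  by (subst (1 2 3) cinner_commute) auto

lemma cinner_diff_right [simp]:
  "\<lbrakk>x \<in> carrier H; y \<in> carrier H; z \<in> carrier H\<rbrakk>
    \<Longrightarrow> cinner H z (x \<ominus> y) = cinner H z x - cinner H z y"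
  by (subst (1 2 3) cinner_commute) auto

lemma cinner_neg_right [simp]:
  "\<lbrakk>x \<in> carrier H; z \<in> carrier H\<rbrakk> \<Longrightarrow> cinner H z (\<ominus> x) = - cinner H z x"
  by (subst (1 2) cinner_commute) auto

lemma cinner_smult_right [simp]:
  "\<lbrakk>x \<in> carrier H; z \<in> carrier H\<rbrakk> \<Longrightarrow> cinner H z (c \<odot> x) = cnj c * cinner H z x"
  by (subst (1 2) cinner_commute) auto

lemma cinner_zero_right [simp]: "x \<in> carrier H \<Longrightarrow> cinner H x \<zero> = 0"
  by (subst cinner_commute) auto

lemma cinner_self_real: "x \<in> carrier H \<Longrightarrow> cinner H x x = of_real (Re (cinner H x x))"
  using cinner_commute[of x x] by (auto simp: complex_eq_iff)

lemma cinner_self: "x \<in> carrier H \<Longrightarrow> cinner H x x = of_real ((hnorm H x)\<^sup>2)"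
  using cinner_self_real[of x] cinner_ge_zero[of x] by (simp add: hnorm_def)

lemma hnorm_sq: "x \<in> carrier H \<Longrightarrow> (hnorm H x)\<^sup>2 = Re (cinner H x x)"
  by (simp add: hnorm_def cinner_ge_zero)

lemma hnorm_ge_0 [simp]: "x \<in> carrier H \<Longrightarrow> 0 \<le> hnorm H x"
  by (simp add: hnorm_def cinner_ge_zero)

lemma hnorm_eq_0_iff: "x \<in> carrier H \<Longrightarrow> hnorm H x = 0 \<longleftrightarrow> x = \<zero>"
  using cinner_eq_zero_iff[of x] cinner_self[of x] by auto

lemma hnorm_zero [simp]: "hnorm H \<zero> = 0"
  by (simp add: hnorm_eq_0_iff)

lemma diff_eq_zero_iff: "x \<in> carrier H \<Longrightarrow> y \<in> carrier H \<Longrightarrow> x \<ominus> y = \<zero> \<longleftrightarrow> x = y"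
  by (metis M.add.inv_closed M.minus_eq M.minus_equality M.minus_minus M.r_neg)

text \<open>Vector identities are proved by testing against all vectors, which turns them into
  identities between complex numbers.\<close>

lemma vec_eqI:
  assumes "x \<in> carrier H" "y \<in> carrier H"
    and "\<And>z. z \<in> carrier H \<Longrightarrow> cinner H x z = cinner H y z"
  shows "x = y"
proof -
  have "cinner H (x \<ominus> y) (x \<ominus> y) = 0"
    using assms(1,2) assms(3)[of "x \<ominus> y"] by (simp only: cinner_diff_left diff_in right_minus_eq)
  then show ?thesis
    using assms by (simp add: cinner_eq_zero_iff diff_eq_zero_iff del: cinner_diff_left cinner_diff_right)
qed

lemma smult_minus_one: "x \<in> carrier H \<Longrightarrow> (-1) \<odot> x = \<ominus> x"
  by (rule vec_eqI) simp_all

lemma diff_eq: "x \<in> carrier H \<Longrightarrow> y \<in> carrier H \<Longrightarrow> x \<ominus> y = x \<oplus> (-1) \<odot> y"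
  by (rule vec_eqI) simp_all

lemma smult_zero_right [simp]: "c \<odot> \<zero> = \<zero>"
  by (rule vec_eqI) simp_all

lemma smult_zero_left [simp]: "x \<in> carrier H \<Longrightarrow> 0 \<odot> x = \<zero>"
  by (rule vec_eqI) simp_all

lemma smult_smult [simp]: "x \<in> carrier H \<Longrightarrow> c \<odot> (d \<odot> x) = (c * d) \<odot> x"
  by (rule vec_eqI) simp_all

lemma smult_1 [simp]: "x \<in> carrier H \<Longrightarrow> 1 \<odot> x = x"
  by (rule vec_eqI) simp_all

lemma diff_self [simp]: "x \<in> carrier H \<Longrightarrow> x \<ominus> x = \<zero>"
  by (rule vec_eqI) simp_all

lemma diff_zero [simp]: "x \<in> carrier H \<Longrightarrow> x \<ominus> \<zero> = x"
  by (rule vec_eqI) simp_all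

lemma hnorm_smult [simp]: "x \<in> carrier H \<Longrightarrow> hnorm H (c \<odot> x) = cmod c * hnorm H x"
proof -
  assume x: "x \<in> carrier H"
  have "cinner H (c \<odot> x) (c \<odot> x) = of_real ((cmod c * hnorm H x)\<^sup>2)"
    using x complex_norm_square[of c]
    by (simp add: cinner_self[OF x] power_mult_distrib flip: mult.assoc)
  then have "(hnorm H (c \<odot> x))\<^sup>2 = (cmod c * hnorm H x)\<^sup>2"
    using x by (simp add: hnorm_sq del: cinner_smult_left cinner_smult_right)
  then show ?thesis
    using x by (simp add: power2_eq_iff_nonneg)
qed

lemma hnorm_neg [simp]: "x \<in> carrier H \<Longrightarrow> hnorm H (\<ominus> x) = hnorm H x"
  by (simp flip: smult_minus_one)

lemma hnorm_diff_sq: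
  assumes "x \<in> carrier H" "y \<in> carrier H"
  shows "(hnorm H (x \<ominus> y))\<^sup>2 = (hnorm H x)\<^sup>2 - 2 * Re (cinner H x y) + (hnorm H y)\<^sup>2"
  using assms cinner_commute[of y x] by (simp add: hnorm_sq)

lemma hnorm_add_sq:
  assumes "x \<in> carrier H" "y \<in> carrier H"
  shows "(hnorm H (x \<oplus> y))\<^sup>2 = (hnorm H x)\<^sup>2 + 2 * Re (cinner H x y) + (hnorm H y)\<^sup>2"
  using assms cinner_commute[of y x] by (simp add: hnorm_sq)

lemma Cauchy_Schwarz:
  assumes x: "x \<in> carrier H" and y: "y \<in> carrier H"
  shows "cmod (cinner H x y) \<le> hnorm H x * hnorm H y"
proof -
  let ?p = "cinner H x y"
  have "(cmod ?p)\<^sup>2 \<le> (hnorm H x)\<^sup>2 * (hnorm H y)\<^sup>2"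
  proof (rule cauchy_schwarz_arith)
    fix t :: real
    have "0 \<le> (hnorm H (x \<ominus> (of_real t * ?p) \<odot> y))\<^sup>2" by simp
    also have "\<dots> = (hnorm H x)\<^sup>2 - 2 * t * (cmod ?p)\<^sup>2 + t\<^sup>2 * (cmod ?p)\<^sup>2 * (hnorm H y)\<^sup>2"
    proof -
      have "Re (cinner H x ((of_real t * ?p) \<odot> y)) = t * (cmod ?p)\<^sup>2"
        using x y by (simp add: cmod_power2) (simp add: power2_eq_square algebra_simps)
      then show ?thesis
        using x y by (subst hnorm_diff_sq) (simp_all add: norm_mult power_mult_distrib)
    qed
    finally show "0 \<le> (hnorm H x)\<^sup>2 - 2 * t * (cmod ?p)\<^sup>2 + t\<^sup>2 * (cmod ?p)\<^sup>2 * (hnorm H y)\<^sup>2" .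
  qed simp_all
  then have "(cmod ?p)\<^sup>2 \<le> (hnorm H x * hnorm H y)\<^sup>2"
    by (simp add: power_mult_distrib)
  then show ?thesis
    using x y by (simp add: power2_le_iff_abs_le)
qed

lemma hnorm_triangle:
  assumes x: "x \<in> carrier H" and y: "y \<in> carrier H"
  shows "hnorm H (x \<oplus> y) \<le> hnorm H x + hnorm H y"
proof -
  have "Re (cinner H x y) \<le> hnorm H x * hnorm H y"
    using Cauchy_Schwarz[OF x y] complex_Re_le_cmod order_trans by blast
  then have "(hnorm H (x \<oplus> y))\<^sup>2 \<le> (hnorm H x + hnorm H y)\<^sup>2"
    using x y by (simp add: hnorm_add_sq power2_sum)
  then show ?thesis
    using x y by (simp add: power2_le_iff_abs_le)
qed

lemma hnorm_diff_commute:
  "\<lbrakk>x \<in> carrier H; y \<in> carrier H\<rbrakk> \<Longrightarrow> hnorm H (x \<ominus> y) = hnorm H (y \<ominus> x)"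
proof -
  assume "x \<in> carrier H" "y \<in> carrier H"
  then have "x \<ominus> y = \<ominus> (y \<ominus> x)" by (intro vec_eqI) simp_all
  then show ?thesis using \<open>x \<in> carrier H\<close> \<open>y \<in> carrier H\<close> by simp
qed

lemma hnorm_diff_triangle:
  assumes "x \<in> carrier H" "y \<in> carrier H" "z \<in> carrier H"
  shows "hnorm H (x \<ominus> z) \<le> hnorm H (x \<ominus> y) + hnorm H (y \<ominus> z)"
proof -
  have "x \<ominus> z = (x \<ominus> y) \<oplus> (y \<ominus> z)"
    using assms by (intro vec_eqI) simp_all
  then show ?thesis using assms by (simp add: hnorm_triangle)
qed

lemma hnorm_triangle_diff:
  assumes "x \<in> carrier H" "y \<in> carrier H"
  shows "hnorm H (x \<ominus> y) \<le> hnorm H x + hnorm H y"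
  using hnorm_triangle[of x "\<ominus> y"] assms by (simp add: a_minus_def)

lemma hnorm_reverse_triangle:
  assumes "x \<in> carrier H" "y \<in> carrier H"
  shows "\<bar>hnorm H x - hnorm H y\<bar> \<le> hnorm H (x \<ominus> y)"
  using hnorm_diff_triangle[of x y \<zero>] hnorm_diff_triangle[of y x \<zero>] assms
  by (simp add: hnorm_diff_commute)

end

sublocale inner_module \<subseteq> Met: Metric_space "carrier H" "hdist H"
proof
  fix x y z
  show "0 \<le> hdist H x y" by (simp add: hdist_def)
  show "hdist H x y = hdist H y x" by (simp add: hdist_def hnorm_diff_commute)
  assume "x \<in> carrier H" "y \<in> carrier H" "z \<in> carrier H"
  then show "hdist H x y = 0 \<longleftrightarrow> x = y" "hdist H x z \<le> hdist H x y + hdist H y z"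
    by (simp_all add: hdist_def hnorm_eq_0_iff diff_eq_zero_iff hnorm_diff_triangle)
qed

section \<open>Convergent and Cauchy sequences in terms of the norm\<close>

definition hlim :: "('a, 'm) hilbert_scheme \<Rightarrow> (nat \<Rightarrow> 'a) \<Rightarrow> 'a \<Rightarrow> bool" where
  "hlim H f l \<longleftrightarrow> (\<forall>n. f n \<in> carrier H) \<and> l \<in> carrier H \<and>
    (\<lambda>n. hnorm H (f n \<ominus>\<^bsub>H\<^esub> l)) \<longlonglongrightarrow> 0"

definition hcauchy :: "('a, 'm) hilbert_scheme \<Rightarrow> (nat \<Rightarrow> 'a) \<Rightarrow> bool" where
  "hcauchy H f \<longleftrightarrow> (\<forall>n. f n \<in> carrier H) \<and>
    (\<forall>e>0. \<exists>N. \<forall>m\<ge>N. \<forall>n\<ge>N. hnorm H (f m \<ominus>\<^bsub>H\<^esub> f n) < e)"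

context inner_module
begin

lemma limitin_iff_hlim:
  assumes "\<And>n. f n \<in> carrier H"
  shows "limitin (htopology H) f l sequentially \<longleftrightarrow> hlim H f l"
  using assms by (auto simp: Met.limitin_metric_dist_null hlim_def hdist_def)

lemma MCauchy_iff_hcauchy: "Met.MCauchy f \<longleftrightarrow> hcauchy H f"
proof (cases "\<forall>n. f n \<in> carrier H")
  case True
  then show ?thesis
    by (auto simp: Met.MCauchy_def hcauchy_def hdist_def)
next
  case False
  then show ?thesis by (auto simp: Met.MCauchy_def hcauchy_def)
qed

lemma hlimD:
  assumes "hlim H f l"
  shows "\<And>n. f n \<in> carrier H" "l \<in> carrier H" "(\<lambda>n. hnorm H (f n \<ominus> l)) \<longlonglongrightarrow> 0"
  using assms by (auto simp: hlim_def)

lemma hlimI_le: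
  assumes "\<And>n. f n \<in> carrier H" "l \<in> carrier H" "\<And>n. hnorm H (f n \<ominus> l) \<le> b n" "b \<longlonglongrightarrow> 0"
  shows "hlim H f l"
  unfolding hlim_def using assms
  by (auto intro: real_tendsto_sandwich[of "\<lambda>n. 0" _ _ b] eventuallyI)

lemma hlim_unique: "hlim H f l \<Longrightarrow> hlim H f l' \<Longrightarrow> l = l'"
  by (metis Met.limitin_metric_unique hlimD(1) limitin_iff_hlim trivial_limit_sequentially)

lemma hlim_const: "x \<in> carrier H \<Longrightarrow> hlim H (\<lambda>n. x) x"
  by (simp add: hlim_def)

lemma hlim_add:
  assumes f: "hlim H f l" and g: "hlim H g m"
  shows "hlim H (\<lambda>n. f n \<oplus> g n) (l \<oplus> m)"
proof (rule hlimI_le)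
  fix n
  have "(f n \<oplus> g n) \<ominus> (l \<oplus> m) = (f n \<ominus> l) \<oplus> (g n \<ominus> m)"
    using hlimD[OF f] hlimD[OF g] by (intro vec_eqI) simp_all
  then show "hnorm H ((f n \<oplus> g n) \<ominus> (l \<oplus> m)) \<le> hnorm H (f n \<ominus> l) + hnorm H (g n \<ominus> m)"
    using hlimD[OF f] hlimD[OF g] by (simp add: hnorm_triangle)
  show "(\<lambda>n. hnorm H (f n \<ominus> l) + hnorm H (g n \<ominus> m)) \<longlonglongrightarrow> 0"
    using tendsto_add[OF hlimD(3)[OF f] hlimD(3)[OF g]] by simp
qed (use hlimD[OF f] hlimD[OF g] in auto)

lemma hlim_smult:
  assumes f: "hlim H f l"
  shows "hlim H (\<lambda>n. c \<odot> f n) (c \<odot> l)"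
proof (rule hlimI_le)
  fix n
  have "(c \<odot> f n) \<ominus> (c \<odot> l) = c \<odot> (f n \<ominus> l)"
    using hlimD[OF f] by (intro vec_eqI) (simp_all add: algebra_simps)
  then show "hnorm H ((c \<odot> f n) \<ominus> (c \<odot> l)) \<le> cmod c * hnorm H (f n \<ominus> l)"
    using hlimD[OF f] by simp
  show "(\<lambda>n. cmod c * hnorm H (f n \<ominus> l)) \<longlonglongrightarrow> 0"
    using tendsto_mult_left[OF hlimD(3)[OF f]] by simp
qed (use hlimD[OF f] in auto)

lemma hlim_diff:
  assumes "hlim H f l" "hlim H g m"
  shows "hlim H (\<lambda>n. f n \<ominus> g n) (l \<ominus> m)"
proof -
  have "hlim H (\<lambda>n. f n \<oplus> (-1) \<odot> g n) (l \<oplus> (-1) \<odot> m)"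
    by (intro hlim_add hlim_smult assms)
  then show ?thesis using assms by (simp add: diff_eq hlimD)
qed

lemma hlim_cinner_left:
  assumes f: "hlim H f l" and y: "y \<in> carrier H"
  shows "(\<lambda>n. cinner H (f n) y) \<longlonglongrightarrow> cinner H l y"
proof (rule Lim_null_comparison[THEN LIM_zero_cancel])
  show "(\<lambda>n. hnorm H (f n \<ominus> l) * hnorm H y) \<longlonglongrightarrow> 0"
    using tendsto_mult_right[OF hlimD(3)[OF f]] by simp
  show "\<forall>\<^sub>F n in sequentially. norm (cinner H (f n) y - cinner H l y) \<le> hnorm H (f n \<ominus> l) * hnorm H y"
    using Cauchy_Schwarz[OF _ y] hlimD[OF f] y
    by (intro always_eventually allI) (simp flip: cinner_diff_left)
qed

lemma hlim_hnorm:
  assumes f: "hlim H f l"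
  shows "(\<lambda>n. hnorm H (f n)) \<longlonglongrightarrow> hnorm H l"
proof (rule Lim_null_comparison[THEN LIM_zero_cancel])
  show "\<forall>\<^sub>F n in sequentially. norm (hnorm H (f n) - hnorm H l) \<le> hnorm H (f n \<ominus> l)"
    using hlimD[OF f] by (intro always_eventually allI) (simp add: hnorm_reverse_triangle)
qed (rule hlimD(3)[OF f])

lemma hlim_cinner:
  assumes f: "hlim H f l" and g: "hlim H g m"
  shows "(\<lambda>n. cinner H (f n) (g n)) \<longlonglongrightarrow> cinner H l m"
proof -
  have 1: "(\<lambda>n. cinner H (f n \<ominus> l) (g n)) \<longlonglongrightarrow> 0"
  proof (rule Lim_null_comparison)
    show "(\<lambda>n. hnorm H (f n \<ominus> l) * hnorm H (g n)) \<longlonglongrightarrow> 0"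
      using tendsto_mult[OF hlimD(3)[OF f] hlim_hnorm[OF g]] by simp
    show "\<forall>\<^sub>F n in sequentially. norm (cinner H (f n \<ominus> l) (g n)) \<le> hnorm H (f n \<ominus> l) * hnorm H (g n)"
      using hlimD[OF f] hlimD[OF g] by (intro always_eventually allI Cauchy_Schwarz) auto
  qed
  have 2: "(\<lambda>n. cnj (cinner H (g n) l)) \<longlonglongrightarrow> cnj (cinner H m l)"
    by (intro tendsto_intros hlim_cinner_left g hlimD[OF f])
  have "(\<lambda>n. cinner H (f n \<ominus> l) (g n) + cnj (cinner H (g n) l)) \<longlonglongrightarrow> cinner H l m"
    using tendsto_add[OF 1 2] hlimD[OF f] hlimD[OF g] by (simp flip: cinner_commute)
  then show ?thesis
    using hlimD[OF f] hlimD[OF g] by (simp flip: cinner_commute)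
qed

lemma hlim_subseq:
  assumes "hlim H f l" "strict_mono r"
  shows "hlim H (\<lambda>n. f (r n)) l"
  using assms LIMSEQ_subseq_LIMSEQ[OF hlimD(3)[OF assms(1)] assms(2)]
  by (auto simp: hlim_def o_def)

lemma hcauchyD: "hcauchy H f \<Longrightarrow> f n \<in> carrier H"
  by (simp add: hcauchy_def)

text \<open>The controlling sequence may live in another space, so the lemma covers coordinate maps,
  adjoints of isometries and estimates through a compact operator alike.\<close>

lemma hcauchyI_le:
  assumes "hcauchy H' f" "\<And>n. g n \<in> carrier H"
    and le: "\<And>m n. hnorm H (g m \<ominus> g n) \<le> hnorm H' (f m \<ominus>\<^bsub>H'\<^esub> f n)"
  shows "hcauchy H g"
  unfolding hcauchy_def
proof (intro conjI allI impI assms(2))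
  fix e :: real assume "e > 0"
  then obtain N where N: "\<forall>m\<ge>N. \<forall>n\<ge>N. hnorm H' (f m \<ominus>\<^bsub>H'\<^esub> f n) < e"
    using assms(1) unfolding hcauchy_def by meson
  show "\<exists>N. \<forall>m\<ge>N. \<forall>n\<ge>N. hnorm H (g m \<ominus> g n) < e"
    by (intro exI[of _ N] allI impI le_less_trans[OF le]) (use N in simp)
qed

lemma hlim_imp_hcauchy:
  assumes "hlim H f l"
  shows "hcauchy H f"
proof -
  have "limitin (htopology H) f l sequentially"
    using assms by (simp add: limitin_iff_hlim hlimD)
  then have "Met.MCauchy f"
    by (rule Met.convergent_imp_MCauchy[rotated]) (use hlimD[OF assms] in auto)
  then show ?thesis by (simp add: MCauchy_iff_hcauchy)
qed

section \<open>Closed subspaces and closed spans\<close>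

lemma closed_subspaceI:
  assumes "S \<subseteq> carrier H" "\<zero> \<in> S"
    and "\<And>x y. x \<in> S \<Longrightarrow> y \<in> S \<Longrightarrow> x \<oplus> y \<in> S"
    and "\<And>c x. x \<in> S \<Longrightarrow> c \<odot> x \<in> S"
    and "\<And>f l. (\<And>n. f n \<in> S) \<Longrightarrow> hlim H f l \<Longrightarrow> l \<in> S"
  shows "closed_subspace H S"
proof -
  have "submodule S complex_field H"
    using assms by (intro submoduleI) (auto simp: smult_minus_one[symmetric] subset_iff)
  moreover have "closedin (htopology H) S"
    unfolding Met.metric_closedin_iff_sequentially_closed
  proof safe
    fix f l assume f: "range f \<subseteq> S" and l: "limitin (htopology H) f l sequentially"
    have "\<And>n. f n \<in> carrier H" using f assms(1) by auto
    then have "hlim H f l" using l by (simp add: limitin_iff_hlim)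
    then show "l \<in> S" using f assms(5) by blast
  qed (use assms in auto)
  ultimately show ?thesis by (simp add: closed_subspace_def)
qed

lemma closed_subspaceD:
  assumes "closed_subspace H S"
  shows "S \<subseteq> carrier H" "\<zero> \<in> S"
    and "\<And>x y. x \<in> S \<Longrightarrow> y \<in> S \<Longrightarrow> x \<oplus> y \<in> S"
    and "\<And>c x. x \<in> S \<Longrightarrow> c \<odot> x \<in> S"
    and "\<And>x y. x \<in> S \<Longrightarrow> y \<in> S \<Longrightarrow> x \<ominus> y \<in> S"
    and "\<And>f l. (\<And>n. f n \<in> S) \<Longrightarrow> hlim H f l \<Longrightarrow> l \<in> S"
proof -
  have sub: "submodule S complex_field H" and cl: "closedin (htopology H) S"
    using assms by (auto simp: closed_subspace_def)
  show S: "S \<subseteq> carrier H" using submoduleE(1)[OF sub] .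
  show add: "x \<oplus> y \<in> S" if "x \<in> S" "y \<in> S" for x y
    using submoduleE(5)[OF sub] that .
  show smult: "c \<odot> x \<in> S" if "x \<in> S" for c x
    using submoduleE(4)[OF sub, of c x] that by simp
  obtain x where "x \<in> S" using submoduleE(2)[OF sub] by auto
  then show "\<zero> \<in> S" using smult[of x 0] S by auto
  show "x \<ominus> y \<in> S" if "x \<in> S" "y \<in> S" for x y
    using add[OF that(1) smult[OF that(2), of "-1"]] S that by (simp add: diff_eq subset_iff)
  show "l \<in> S" if "\<And>n. f n \<in> S" "hlim H f l" for f l
    using cl[unfolded Met.metric_closedin_iff_sequentially_closed] that
    by (metis hlimD(1) image_subset_iff limitin_iff_hlim)
qed

lemma closed_subspace_carrier: "closed_subspace H (carrier H)"
  by (rule closed_subspaceI) (auto simp: hlimD)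

lemma closed_subspace_Inter:
  assumes "\<And>S. S \<in> \<S> \<Longrightarrow> closed_subspace H S" "\<S> \<noteq> {}"
  shows "closed_subspace H (\<Inter>\<S>)"
proof (rule closed_subspaceI)
  show "\<Inter>\<S> \<subseteq> carrier H" using assms closed_subspaceD(1) by blast
  show "l \<in> \<Inter>\<S>" if "\<And>n. f n \<in> \<Inter>\<S>" "hlim H f l" for f l
    using that assms(1) closed_subspaceD(6) by (meson Inter_iff)
qed (use assms closed_subspaceD in auto)

lemma closed_subspace_closed_span:
  assumes "X \<subseteq> carrier H"
  shows "closed_subspace H (closed_span H X)"
  unfolding closed_span_def
  by (rule closed_subspace_Inter) (use assms closed_subspace_carrier in auto)

lemma closed_span_superset: "X \<subseteq> closed_span H X"
  by (auto simp: closed_span_def)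

lemma closed_span_minimal: "closed_subspace H S \<Longrightarrow> X \<subseteq> S \<Longrightarrow> closed_span H X \<subseteq> S"
  by (auto simp: closed_span_def)

lemma complex_hilbert_spaceI:
  assumes "\<And>f. hcauchy H f \<Longrightarrow> \<exists>l. hlim H f l"
  shows "complex_hilbert_space H"
proof (intro complex_hilbert_space.intro complex_hilbert_space_axioms.intro)
  show "Module.module complex_field H" by (rule module_axioms)
  show "Met.mcomplete"
    unfolding Met.mcomplete_def MCauchy_iff_hcauchy
    using assms by (metis hcauchyD limitin_iff_hlim)
qed (auto simp: cinner_ge_zero cinner_eq_zero_iff intro: cinner_commute)

end

sublocale complex_hilbert_space \<subseteq> inner_module H
  by unfold_locales
    (auto simp: cinner_add_left cinner_smult_left cinner_ge_zero cinner_eq_zero_iff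
      intro: cinner_commute)

context complex_hilbert_space
begin

lemma hcauchy_convergent:
  assumes "hcauchy H f"
  obtains l where "hlim H f l"
proof -
  have "Met.MCauchy f" using assms by (simp add: MCauchy_iff_hcauchy)
  then obtain l where "limitin (htopology H) f l sequentially"
    using complete by (auto simp: Met.mcomplete_def)
  then show ?thesis
    using that assms by (auto simp: limitin_iff_hlim hcauchyD)
qed

end

section \<open>Orthogonal complements and projections\<close>

definition orth :: "('a, 'm) hilbert_scheme \<Rightarrow> 'a set \<Rightarrow> 'a set" where
  "orth H S = {x \<in> carrier H. \<forall>s\<in>S. cinner H x s = 0}"

text \<open>Characterised by inner products against \<open>S\<close>, not as the nearest point:
  linearity and commutation with other operators then follow from uniqueness.\<close>

definition proj :: "('a, 'm) hilbert_scheme \<Rightarrow> 'a set \<Rightarrow> 'a \<Rightarrow> 'a" where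
  "proj H S x = (THE p. p \<in> S \<and> (\<forall>s\<in>S. cinner H p s = cinner H x s))"

context inner_module
begin

lemma orthD: "x \<in> orth H S \<Longrightarrow> s \<in> S \<Longrightarrow> cinner H x s = 0"
  by (simp add: orth_def)

lemma orth_in: "x \<in> orth H S \<Longrightarrow> x \<in> carrier H"
  by (simp add: orth_def)

lemma closed_subspace_orth:
  assumes "S \<subseteq> carrier H"
  shows "closed_subspace H (orth H S)"
proof (rule closed_subspaceI)
  fix f l assume f: "\<And>n. f n \<in> orth H S" and l: "hlim H f l"
  have "cinner H l s = 0" if "s \<in> S" for s
  proof -
    have "(\<lambda>n. cinner H (f n) s) \<longlonglongrightarrow> cinner H l s"
      by (rule hlim_cinner_left[OF l]) (use assms that in auto)
    moreover have "(\<lambda>n. cinner H (f n) s) = (\<lambda>n. 0)"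
      using f that by (auto simp: orth_def)
    ultimately show ?thesis using LIMSEQ_unique tendsto_const by metis
  qed
  then show "l \<in> orth H S" using hlimD(2)[OF l] by (simp add: orth_def)
qed (use assms in \<open>auto simp: orth_def subset_iff\<close>)

text \<open>The parallelogram law for \<open>x - a\<close> and \<open>x - b\<close>, arranged around
  the midpoint of \<open>a\<close> and \<open>b\<close>, because a subspace containing both points
  contains the midpoint too.\<close>

lemma parallelogram:
  assumes "x \<in> carrier H" "a \<in> carrier H" "b \<in> carrier H"
  shows "(hnorm H (a \<ominus> b))\<^sup>2 =
    2 * (hnorm H (x \<ominus> a))\<^sup>2 + 2 * (hnorm H (x \<ominus> b))\<^sup>2 - 4 * (hnorm H (x \<ominus> (1/2) \<odot> (a \<oplus> b)))\<^sup>2"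
proof -
  have "cinner H a x = cnj (cinner H x a)" "cinner H b x = cnj (cinner H x b)"
      "cinner H b a = cnj (cinner H a b)"
    using assms by (auto intro: cinner_commute)
  then show ?thesis
    using assms by (simp add: hnorm_sq field_simps)
qed

end

context complex_hilbert_space
begin

text \<open>A sequence minimising the distance to \<open>x\<close> is Cauchy because midpoints stay
  in \<open>S\<close>; its limit is a nearest point, and moving it along \<open>s\<close> inside
  \<open>S\<close> cannot come closer, which forces the remainder to be orthogonal to
  \<open>s\<close>.\<close>

lemma projection_exists:
  assumes S: "closed_subspace H S" and x: "x \<in> carrier H"
  obtains p where "p \<in> S" "\<And>s. s \<in> S \<Longrightarrow> cinner H p s = cinner H x s"
proof -
  note SD = closed_subspaceD[OF S]
  define d where "d = (INF s\<in>S. hnorm H (x \<ominus> s))"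
  have bdd: "bdd_below ((\<lambda>s. hnorm H (x \<ominus> s)) ` S)"
    using SD(1) x by (intro bdd_belowI[of _ 0]) auto
  have inv0: "(\<lambda>n. 1 / (real n + 1)) \<longlonglongrightarrow> 0"
    using LIMSEQ_inverse_real_of_nat by (simp add: inverse_eq_divide add.commute)
  have d_le: "d \<le> hnorm H (x \<ominus> s)" if "s \<in> S" for s
    unfolding d_def by (rule cINF_lower[OF bdd that])
  have d0: "0 \<le> d"
    unfolding d_def by (rule cINF_greatest) (use SD(1,2) x in auto)
  have "\<exists>s\<in>S. hnorm H (x \<ominus> s) < d + 1 / (real n + 1)" for n
  proof -
    have "(INF s\<in>S. hnorm H (x \<ominus> s)) < d + 1 / (real n + 1)"
      unfolding d_def[symmetric] by simp
    then show ?thesis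
      using SD(2) by (subst (asm) cINF_less_iff[OF _ bdd]) auto
  qed
  then obtain s where sS: "\<And>n. s n \<in> S" and s: "\<And>n. hnorm H (x \<ominus> s n) < d + 1 / (real n + 1)"
    by metis
  have sH: "s n \<in> carrier H" for n using sS SD(1) by auto
  \<comment> \<open>\<open>b n\<close> bounds the excess of the squared distance of
    \<open>s n\<close> over the minimum \<open>d\<^sup>2\<close>.\<close>
  define b where "b n = (d + 1 / (real n + 1))\<^sup>2 - d\<^sup>2" for n :: nat
  have "(\<lambda>n. (d + 1 / (real n + 1))\<^sup>2 - d\<^sup>2) \<longlonglongrightarrow> (d + 0)\<^sup>2 - d\<^sup>2"
    by (intro tendsto_intros inv0)
  then have b0: "b \<longlonglongrightarrow> 0" by (simp add: b_def[abs_def])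
  have sq: "(hnorm H (s m \<ominus> s n))\<^sup>2 \<le> 2 * b m + 2 * b n" for m n
  proof -
    have "(1/2) \<odot> (s m \<oplus> s n) \<in> S" using SD(3,4) sS by auto
    then have "d\<^sup>2 \<le> (hnorm H (x \<ominus> (1/2) \<odot> (s m \<oplus> s n)))\<^sup>2"
      using d_le d0 by (intro power_mono) auto
    moreover have "(hnorm H (x \<ominus> s k))\<^sup>2 \<le> (d + 1 / (real k + 1))\<^sup>2" for k
      using s[of k] x sH by (intro power_mono) auto
    ultimately show ?thesis
      using parallelogram[OF x sH sH, of m n] unfolding b_def by smt
  qed
  have "hcauchy H s"
    unfolding hcauchy_def
  proof (intro conjI allI impI)
    fix e :: real assume e: "e > 0"
    then have "\<forall>\<^sub>F n in sequentially. b n < e\<^sup>2 / 4"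
      by (intro order_tendstoD(2)[OF b0]) simp
    then obtain N where N: "\<And>n. n \<ge> N \<Longrightarrow> b n < e\<^sup>2 / 4"
      by (auto simp: eventually_sequentially)
    show "\<exists>N. \<forall>m\<ge>N. \<forall>n\<ge>N. hnorm H (s m \<ominus> s n) < e"
    proof (intro exI[of _ N] allI impI)
      fix m n assume "m \<ge> N" "n \<ge> N"
      then have "(hnorm H (s m \<ominus> s n))\<^sup>2 < e\<^sup>2"
        using sq[of m n] N[of m] N[of n] by linarith
      then show "hnorm H (s m \<ominus> s n) < e"
        using e by (simp add: power_less_imp_less_base)
    qed
  qed (rule sH)
  then obtain p where p: "hlim H s p" by (rule hcauchy_convergent)
  have pS: "p \<in> S" using SD(6)[OF sS p] .
  have pH: "p \<in> carrier H" using pS SD(1) by auto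
  have "(\<lambda>n. hnorm H (x \<ominus> s n)) \<longlonglongrightarrow> hnorm H (x \<ominus> p)"
    by (intro hlim_hnorm hlim_diff hlim_const x p)
  moreover have "(\<lambda>n. d + 1 / (real n + 1)) \<longlonglongrightarrow> d + 0"
    by (intro tendsto_intros inv0)
  ultimately have pd: "hnorm H (x \<ominus> p) \<le> d"
    by (simp add: LIMSEQ_le[of "\<lambda>n. hnorm H (x \<ominus> s n)" _ "\<lambda>n. d + 1 / (real n + 1)"] s less_imp_le)
  show ?thesis
  proof (rule that[OF pS])
    fix s assume s: "s \<in> S"
    then have sH: "s \<in> carrier H" using SD(1) by auto
    let ?c = "cinner H (x \<ominus> p) s"
    \<comment> \<open>With first argument 0 the arithmetic lemma yields \<open>?c = 0\<close>; its
      hypothesis says that perturbing \<open>p\<close> by a multiple of \<open>s\<close> does not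
      get below distance \<open>d\<close>.\<close>
    have "(cmod ?c)\<^sup>2 \<le> 0 * (hnorm H s)\<^sup>2"
    proof (rule cauchy_schwarz_arith)
      fix t :: real
      let ?k = "of_real t * ?c"
      have "p \<oplus> ?k \<odot> s \<in> S" using SD pS s by auto
      then have "d \<le> hnorm H (x \<ominus> (p \<oplus> ?k \<odot> s))" by (rule d_le)
      also have "x \<ominus> (p \<oplus> ?k \<odot> s) = (x \<ominus> p) \<ominus> ?k \<odot> s"
        using x pH sH by (intro vec_eqI) (simp_all add: algebra_simps)
      finally have "d\<^sup>2 \<le> (hnorm H ((x \<ominus> p) \<ominus> ?k \<odot> s))\<^sup>2"
        using d0 by (intro power_mono)
      also have "\<dots> = (hnorm H (x \<ominus> p))\<^sup>2 - 2 * t * (cmod ?c)\<^sup>2 + t\<^sup>2 * (cmod ?c)\<^sup>2 * (hnorm H s)\<^sup>2"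
      proof -
        have "Re (cinner H (x \<ominus> p) (?k \<odot> s)) = t * (cmod ?c)\<^sup>2"
          using x pH sH by (simp add: cmod_power2 del: cinner_diff_left)
            (simp add: power2_eq_square algebra_simps del: cinner_diff_left)
        then show ?thesis
          using x pH sH by (subst hnorm_diff_sq) (simp_all add: norm_mult power_mult_distrib del: cinner_diff_left)
      qed
      finally show "0 \<le> 0 - 2 * t * (cmod ?c)\<^sup>2 + t\<^sup>2 * (cmod ?c)\<^sup>2 * (hnorm H s)\<^sup>2"
        using power_mono[OF pd, of 2] x pH by simp
    qed simp_all
    then show "cinner H p s = cinner H x s" using x pH sH by simp
  qed
qed

lemma proj_props:
  assumes S: "closed_subspace H S" and x: "x \<in> carrier H"
  shows "proj H S x \<in> S \<and> (\<forall>s\<in>S. cinner H (proj H S x) s = cinner H x s)"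
  unfolding proj_def
proof (rule theI')
  obtain p where p: "p \<in> S" "\<And>s. s \<in> S \<Longrightarrow> cinner H p s = cinner H x s"
    using projection_exists[OF S x] by blast
  show "\<exists>!p. p \<in> S \<and> (\<forall>s\<in>S. cinner H p s = cinner H x s)"
  proof (intro ex1I[of _ p] conjI ballI)
    fix q assume q: "q \<in> S \<and> (\<forall>s\<in>S. cinner H q s = cinner H x s)"
    then have "q \<ominus> p \<in> S" "q \<in> carrier H" "p \<in> carrier H"
      using closed_subspaceD[OF S] p by auto
    then have "cinner H (q \<ominus> p) (q \<ominus> p) = 0"
      using p q by (subst cinner_diff_left) auto
    then show "q = p"
      using \<open>q \<in> carrier H\<close> \<open>p \<in> carrier H\<close>
      by (simp add: cinner_eq_zero_iff diff_eq_zero_iff del: cinner_diff_left cinner_diff_right)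
  qed (use p in auto)
qed

lemma proj_mem: "closed_subspace H S \<Longrightarrow> x \<in> carrier H \<Longrightarrow> proj H S x \<in> S"
  using proj_props by blast

lemma proj_in: "closed_subspace H S \<Longrightarrow> x \<in> carrier H \<Longrightarrow> proj H S x \<in> carrier H"
  by (rule subsetD[OF closed_subspaceD(1) proj_mem])

lemma cinner_proj:
  "closed_subspace H S \<Longrightarrow> x \<in> carrier H \<Longrightarrow> s \<in> S \<Longrightarrow> cinner H (proj H S x) s = cinner H x s"
  using proj_props by blast

lemma proj_eqI:
  assumes S: "closed_subspace H S" and x: "x \<in> carrier H"
    and q: "q \<in> S" "\<And>s. s \<in> S \<Longrightarrow> cinner H q s = cinner H x s"
  shows "proj H S x = q"
proof -
  let ?p = "proj H S x"
  have pS: "?p \<in> S" by (rule proj_mem[OF S x])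
  have H: "q \<in> carrier H" "?p \<in> carrier H" using closed_subspaceD(1)[OF S] q pS by auto
  have "q \<ominus> ?p \<in> S" using closed_subspaceD[OF S] q pS by auto
  then have "cinner H (q \<ominus> ?p) (q \<ominus> ?p) = 0"
    using H q(2) cinner_proj[OF S x] by (simp only: cinner_diff_left diff_in right_minus_eq)
  then show ?thesis
    using H by (simp add: cinner_eq_zero_iff diff_eq_zero_iff del: cinner_diff_left cinner_diff_right)
qed

lemma proj_ident: "closed_subspace H S \<Longrightarrow> x \<in> S \<Longrightarrow> proj H S x = x"
  by (rule proj_eqI) (auto dest: closed_subspaceD(1))

lemma diff_proj_orth:
  assumes S: "closed_subspace H S" and x: "x \<in> carrier H"
  shows "x \<ominus> proj H S x \<in> orth H S"
  using closed_subspaceD(1)[OF S] cinner_proj[OF S x] x proj_in[OF S x]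
  by (auto simp: orth_def subset_iff)

lemma proj_add:
  assumes S: "closed_subspace H S" and "x \<in> carrier H" "y \<in> carrier H"
  shows "proj H S (x \<oplus> y) = proj H S x \<oplus> proj H S y"
  using assms closed_subspaceD(1)[OF S] 
  by (intro proj_eqI) (auto simp: proj_mem proj_in cinner_proj closed_subspaceD subset_iff)

lemma proj_smult:
  assumes S: "closed_subspace H S" and "x \<in> carrier H"
  shows "proj H S (c \<odot> x) = c \<odot> proj H S x"
  using assms closed_subspaceD(1)[OF S]
  by (intro proj_eqI) (auto simp: proj_mem proj_in cinner_proj closed_subspaceD subset_iff)

lemma closed_subspace_eq_carrierI:
  assumes S: "closed_subspace H S" and "\<And>z. z \<in> orth H S \<Longrightarrow> z = \<zero>"
  shows "S = carrier H"
proof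
  show "S \<subseteq> carrier H" using closed_subspaceD(1)[OF S] .
  show "carrier H \<subseteq> S"
  proof
    fix x assume x: "x \<in> carrier H"
    have "x \<ominus> proj H S x = \<zero>" using assms(2) diff_proj_orth[OF S x] .
    then have "x = proj H S x" using x proj_in[OF S x] by (simp add: diff_eq_zero_iff)
    then show "x \<in> S" using proj_mem[OF S x] by simp
  qed
qed

lemma closure_of_eq_seq:
  assumes "S \<subseteq> carrier H"
  shows "htopology H closure_of S = {l. \<exists>f. (\<forall>n. f n \<in> S) \<and> hlim H f l}"
proof -
  have "l \<in> htopology H closure_of S \<longleftrightarrow> (\<exists>f. (\<forall>n. f n \<in> S) \<and> hlim H f l)" for l
    unfolding Met.closure_of_sequentially
    using assms limitin_iff_hlim by (smt (verit, best) Int_absorb2 hlimD(2) image_subset_iff mem_Collect_eq range_subsetD subsetD)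
  then show ?thesis by auto
qed

lemma closed_subspace_closure_of:
  assumes S: "S \<subseteq> carrier H" and "\<zero> \<in> S"
    and "\<And>x y. x \<in> S \<Longrightarrow> y \<in> S \<Longrightarrow> x \<oplus> y \<in> S"
    and "\<And>c x. x \<in> S \<Longrightarrow> c \<odot> x \<in> S"
  shows "closed_subspace H (htopology H closure_of S)"
proof (rule closed_subspaceI)
  note eq = closure_of_eq_seq[OF S]
  show "htopology H closure_of S \<subseteq> carrier H"
    using closure_of_subset_topspace[of "htopology H" S] by simp
  show "\<zero> \<in> htopology H closure_of S"
    unfolding eq using assms(2) by (auto intro!: exI[of _ "\<lambda>n. \<zero>"] hlim_const)
  show "x \<oplus> y \<in> htopology H closure_of S"
    if xy: "x \<in> htopology H closure_of S" "y \<in> htopology H closure_of S" for x y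
  proof -
    obtain f where f: "\<forall>n. f n \<in> S" "hlim H f x"
      using xy(1) unfolding eq by blast
    obtain g where g: "\<forall>n. g n \<in> S" "hlim H g y"
      using xy(2) unfolding eq by blast
    show ?thesis using f g unfolding eq using assms(3) hlim_add
      by (intro CollectI exI[of _ "\<lambda>n. f n \<oplus> g n"]) auto
  qed
  show "c \<odot> x \<in> htopology H closure_of S" if x: "x \<in> htopology H closure_of S" for c x
  proof -
    obtain f where "\<forall>n. f n \<in> S" "hlim H f x"
      using x unfolding eq by blast
    then show ?thesis unfolding eq using assms(4) hlim_smult
      by (intro CollectI exI[of _ "\<lambda>n. c \<odot> f n"]) auto
  qed
  have "closedin (htopology H) (htopology H closure_of S)" by simp
  then show "l \<in> htopology H closure_of S"
    if "\<And>n. f n \<in> htopology H closure_of S" "hlim H f l" for f l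
    using that unfolding Met.metric_closedin_iff_sequentially_closed
    by (metis hlimD(1) image_subset_iff limitin_iff_hlim)
qed

end

section \<open>Self-adjoint operators\<close>

locale selfadjoint_space = complex_hilbert_space H
  for H :: "('a, 'm) hilbert_scheme" (structure) +
  fixes Q :: "('a \<times> 'a) set"
  assumes sa: "selfadjoint_operator H Q"
begin

lemma Q_in: "(x, y) \<in> Q \<Longrightarrow> x \<in> carrier H" "(x, y) \<in> Q \<Longrightarrow> y \<in> carrier H"
  using sa by (auto simp: selfadjoint_operator_def linear_operator_def)

lemma Q_add: "(x, y) \<in> Q \<Longrightarrow> (x', y') \<in> Q \<Longrightarrow> (x \<oplus> x', y \<oplus> y') \<in> Q"
  using sa unfolding selfadjoint_operator_def linear_operator_def by fast

lemma Q_smult: "(x, y) \<in> Q \<Longrightarrow> (c \<odot> x, c \<odot> y) \<in> Q"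
  using sa unfolding selfadjoint_operator_def linear_operator_def by fast

lemma Q_zero: "(\<zero>, \<zero>) \<in> Q"
  using sa by (auto simp: selfadjoint_operator_def linear_operator_def)

lemma Q_diff: "(x, y) \<in> Q \<Longrightarrow> (x', y') \<in> Q \<Longrightarrow> (x \<ominus> x', y \<ominus> y') \<in> Q"
  using Q_add[of x y "(-1) \<odot> x'" "(-1) \<odot> y'"] Q_smult[of x' y' "-1"] by (simp add: diff_eq Q_in)

lemma Q_unique: "(x, y) \<in> Q \<Longrightarrow> (x, y') \<in> Q \<Longrightarrow> y = y'"
  using sa by (auto simp: selfadjoint_operator_def linear_operator_def single_valued_def)

lemma Q_sym: "(x, y) \<in> Q \<Longrightarrow> (x', y') \<in> Q \<Longrightarrow> cinner H y x' = cinner H x y'"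
  using sa unfolding selfadjoint_operator_def adjoint_graph_def by blast

lemma QI:
  assumes "y \<in> carrier H" "z \<in> carrier H" "\<And>x w. (x, w) \<in> Q \<Longrightarrow> cinner H w y = cinner H x z"
  shows "(y, z) \<in> Q"
  using sa assms unfolding selfadjoint_operator_def adjoint_graph_def by blast

lemma Q_lim:
  assumes f: "\<And>n. (f n, g n) \<in> Q" and l: "hlim H f l" and m: "hlim H g m"
  shows "(l, m) \<in> Q"
proof (rule QI)
  fix x w assume xw: "(x, w) \<in> Q"
  have "(\<lambda>n. cinner H w (f n)) \<longlonglongrightarrow> cinner H w l"
    by (rule hlim_cinner[OF hlim_const l]) (rule Q_in[OF xw])
  moreover have "(\<lambda>n. cinner H x (g n)) \<longlonglongrightarrow> cinner H x m"
    by (rule hlim_cinner[OF hlim_const m]) (rule Q_in[OF xw])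
  moreover have "cinner H w (f n) = cinner H x (g n)" for n
    by (rule Q_sym[OF xw f])
  ultimately show "cinner H w l = cinner H x m"
    using LIMSEQ_unique by auto
qed (use hlimD l m in auto)

text \<open>The lower bound and closedness of \<open>Q\<close> make the range of
  \<open>Q - l\<close> closed. A vector orthogonal to the range is an eigenvector of the adjoint,
  that is of \<open>Q\<close>, for \<open>cnj l\<close>, and so it is zero.\<close>

lemma bounded_below_imp_onto:
  assumes c: "c > 0" and bb: "\<And>x y. (x, y) \<in> Q \<Longrightarrow> c * hnorm H x \<le> hnorm H (y \<ominus> l \<odot> x)"
    and inj: "\<And>x. (x, cnj l \<odot> x) \<in> Q \<Longrightarrow> x = \<zero>"
    and v: "v \<in> carrier H"
  shows "\<exists>u. (u, v \<oplus> l \<odot> u) \<in> Q"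
proof -
  let ?R = "(\<lambda>(x, y). y \<ominus> l \<odot> x) ` Q"
  have R: "closed_subspace H ?R"
  proof (rule closed_subspaceI)
    show "?R \<subseteq> carrier H" using Q_in by auto
    show "\<zero> \<in> ?R" using Q_zero by (intro image_eqI[of _ _ "(\<zero>, \<zero>)"]) auto
    show "a \<oplus> b \<in> ?R" if ab: "a \<in> ?R" "b \<in> ?R" for a b
    proof -
      obtain x y where 1: "(x, y) \<in> Q" "a = y \<ominus> l \<odot> x" using ab(1) by auto
      obtain x' y' where 2: "(x', y') \<in> Q" "b = y' \<ominus> l \<odot> x'" using ab(2) by auto
      note * = 1 2
      moreover have "a \<oplus> b = (y \<oplus> y') \<ominus> l \<odot> (x \<oplus> x')"
        using * Q_in by (intro vec_eqI) (auto simp: algebra_simps)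
      ultimately show ?thesis using Q_add by (intro image_eqI[of _ _ "(x \<oplus> x', y \<oplus> y')"]) auto
    qed
    show "k \<odot> a \<in> ?R" if a: "a \<in> ?R" for k a
    proof -
      obtain x y where *: "(x, y) \<in> Q" "a = y \<ominus> l \<odot> x" using a by auto
      moreover have "k \<odot> a = (k \<odot> y) \<ominus> l \<odot> (k \<odot> x)"
        using * Q_in by (intro vec_eqI) (auto simp: algebra_simps)
      ultimately show ?thesis using Q_smult by (intro image_eqI[of _ _ "(k \<odot> x, k \<odot> y)"]) auto
    qed
    fix f m assume f: "\<And>n. f n \<in> ?R" and m: "hlim H f m"
    have "\<exists>x y. (x, y) \<in> Q \<and> f n = y \<ominus> l \<odot> x" for n
      using f[of n] by auto
    then obtain x y where xy: "\<And>n. (x n, y n) \<in> Q" and fn: "\<And>n. f n = y n \<ominus> l \<odot> x n"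
      by metis
    have H: "x n \<in> carrier H" "y n \<in> carrier H" for n using Q_in[OF xy] by auto
    \<comment> \<open>The lower bound turns convergence of the images into the Cauchy property of
      the arguments.\<close>
    have "hcauchy H x"
      unfolding hcauchy_def
    proof (intro conjI allI impI)
      fix e :: real assume "e > 0"
      then obtain N where N: "\<And>p q. p \<ge> N \<Longrightarrow> q \<ge> N \<Longrightarrow> hnorm H (f p \<ominus> f q) < c * e"
        using hlim_imp_hcauchy[OF m] c unfolding hcauchy_def by (metis mult_pos_pos)
      have "hnorm H (x p \<ominus> x q) < e" if "p \<ge> N" "q \<ge> N" for p q
      proof -
        have "c * hnorm H (x p \<ominus> x q) \<le> hnorm H ((y p \<ominus> y q) \<ominus> l \<odot> (x p \<ominus> x q))"
          by (rule bb[OF Q_diff[OF xy xy]])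
        also have "(y p \<ominus> y q) \<ominus> l \<odot> (x p \<ominus> x q) = f p \<ominus> f q"
          using H by (intro vec_eqI) (auto simp: fn algebra_simps)
        also have "hnorm H (f p \<ominus> f q) < c * e" using N that by blast
        finally show ?thesis using c by simp
      qed
      then show "\<exists>N. \<forall>m\<ge>N. \<forall>n\<ge>N. hnorm H (x m \<ominus> x n) < e" by blast
    qed (rule H)
    then obtain u where u: "hlim H x u" by (rule hcauchy_convergent)
    have "hlim H (\<lambda>n. f n \<oplus> l \<odot> x n) (m \<oplus> l \<odot> u)"
      by (intro hlim_add hlim_smult m u)
    moreover have "f n \<oplus> l \<odot> x n = y n" for n
      using H by (intro vec_eqI) (auto simp: fn)
    ultimately have "(u, m \<oplus> l \<odot> u) \<in> Q"
      using Q_lim[OF xy u] by simp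
    moreover have "m = (m \<oplus> l \<odot> u) \<ominus> l \<odot> u"
      using hlimD(2)[OF m] hlimD(2)[OF u] by (intro vec_eqI) auto
    ultimately show "m \<in> ?R" by (intro image_eqI[of _ _ "(u, m \<oplus> l \<odot> u)"]) auto
  qed
  have "?R = carrier H"
  proof (rule closed_subspace_eq_carrierI[OF R])
    fix z assume z: "z \<in> orth H ?R"
    then have zH: "z \<in> carrier H" by (simp add: orth_def)
    \<comment> \<open>Orthogonality to the range says that \<open>z\<close> lies in the domain of
      the adjoint, which is \<open>Q\<close> itself, with value \<open>cnj l\<close> times
      \<open>z\<close>.\<close>
    have "(z, cnj l \<odot> z) \<in> Q"
    proof (rule QI)
      fix x w assume xw: "(x, w) \<in> Q"
      then have "w \<ominus> l \<odot> x \<in> ?R" by (intro image_eqI[of _ _ "(x, w)"]) auto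
      then have "cinner H z (w \<ominus> l \<odot> x) = 0" by (rule orthD[OF z])
      then have "cinner H (w \<ominus> l \<odot> x) z = 0"
        using cinner_commute[of "w \<ominus> l \<odot> x" z] zH Q_in[OF xw] by simp
      then show "cinner H w z = cinner H x (cnj l \<odot> z)"
        using zH Q_in[OF xw] by simp
    qed (use zH in auto)
    then show "z = \<zero>" by (rule inj)
  qed
  then obtain x y where xy: "(x, y) \<in> Q" "v = y \<ominus> l \<odot> x" using v by (force simp: image_iff)
  then have "v \<oplus> l \<odot> x = y" using Q_in[OF xy(1)] by (intro vec_eqI) auto
  then show ?thesis using xy(1) by metis
qed

text \<open>By symmetry the inner product of \<open>y\<close> with \<open>x\<close> is real, so that
  of \<open>y - l x\<close> with \<open>x\<close> has imaginary part of modulus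
  \<open>|Im l|\<close> times the squared norm of \<open>x\<close>; Cauchy-Schwarz gives the
  bound.\<close>

lemma Im_bound:
  assumes xy: "(x, y) \<in> Q"
  shows "\<bar>Im l\<bar> * hnorm H x \<le> hnorm H (y \<ominus> l \<odot> x)"
proof -
  note H = Q_in[OF xy]
  have "Im (cinner H y x) = 0"
    using Q_sym[OF xy xy] cinner_commute[OF H(2,1)] by (simp add: complex_eq_iff)
  then have "Im (cinner H (y \<ominus> l \<odot> x) x) = - (Im l * (hnorm H x)\<^sup>2)"
    using H by (simp add: cinner_self flip: of_real_power)
  then have "\<bar>Im l\<bar> * (hnorm H x)\<^sup>2 \<le> cmod (cinner H (y \<ominus> l \<odot> x) x)"
    using abs_Im_le_cmod[of "cinner H (y \<ominus> l \<odot> x) x"] by (simp add: abs_mult)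
  also have "\<dots> \<le> hnorm H (y \<ominus> l \<odot> x) * hnorm H x"
    using H by (intro Cauchy_Schwarz) auto
  finally have "\<bar>Im l\<bar> * hnorm H x * hnorm H x \<le> hnorm H (y \<ominus> l \<odot> x) * hnorm H x"
    by (simp add: power2_eq_square mult.assoc)
  moreover have "0 \<le> hnorm H x" "0 \<le> hnorm H (y \<ominus> l \<odot> x)"
    using H by auto
  ultimately show ?thesis
    by (cases "hnorm H x = 0") (auto simp: mult_le_cancel_right)
qed

lemma nonreal_eigen_zero:
  assumes "(x, l \<odot> x) \<in> Q" "Im l \<noteq> 0"
  shows "x = \<zero>"
proof -
  have x: "x \<in> carrier H" using Q_in(1)[OF assms(1)] .
  then have "hnorm H x \<le> 0"
    using Im_bound[OF assms(1), of l] assms(2) by (simp add: mult_le_0_iff)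
  then show ?thesis
    using x hnorm_ge_0[OF x] hnorm_eq_0_iff by (metis antisym)
qed

end

text \<open>The resolvent $(Q - l)^{-1}$; the description is meaningful for nonreal \<open>l\<close> only.\<close>

definition res :: "('a, 'm) hilbert_scheme \<Rightarrow> ('a \<times> 'a) set \<Rightarrow> complex \<Rightarrow> 'a \<Rightarrow> 'a" where
  "res H Q l v = (THE u. (u, v \<oplus>\<^bsub>H\<^esub> l \<odot>\<^bsub>H\<^esub> u) \<in> Q)"

section \<open>Resolvents at nonreal points\<close>

context selfadjoint_space
begin

lemma res_unique:
  assumes "(u, v \<oplus> l \<odot> u) \<in> Q" "(u', v \<oplus> l \<odot> u') \<in> Q" "Im l \<noteq> 0" "v \<in> carrier H"
  shows "u = u'"
proof -
  have H: "u \<in> carrier H" "u' \<in> carrier H" using assms Q_in by auto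
  have "(v \<oplus> l \<odot> u) \<ominus> (v \<oplus> l \<odot> u') = l \<odot> (u \<ominus> u')"
    using H assms by (intro vec_eqI) (auto simp: algebra_simps)
  then have "(u \<ominus> u', l \<odot> (u \<ominus> u')) \<in> Q" using Q_diff[OF assms(1,2)] by simp
  then have "u \<ominus> u' = \<zero>" using assms(3) by (rule nonreal_eigen_zero)
  then show ?thesis using H by (simp add: diff_eq_zero_iff)
qed

lemma res_Q:
  assumes "Im l \<noteq> 0" "v \<in> carrier H"
  shows "(res H Q l v, v \<oplus> l \<odot> res H Q l v) \<in> Q"
  unfolding res_def
proof (rule theI')
  have "\<exists>u. (u, v \<oplus> l \<odot> u) \<in> Q"
  proof (rule bounded_below_imp_onto)
    show "\<bar>Im l\<bar> > 0" using assms by simp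
    show "x = \<zero>" if "(x, cnj l \<odot> x) \<in> Q" for x
      using nonreal_eigen_zero[OF that] assms by simp
  qed (use Im_bound assms in auto)
  then show "\<exists>!u. (u, v \<oplus> l \<odot> u) \<in> Q" using res_unique assms by blast
qed

lemma res_eqI:
  assumes "Im l \<noteq> 0" "v \<in> carrier H" "(u, v \<oplus> l \<odot> u) \<in> Q"
  shows "res H Q l v = u"
  using res_unique[OF res_Q[OF assms(1,2)] assms(3)] assms by simp

lemma res_in [simp]: "Im l \<noteq> 0 \<Longrightarrow> v \<in> carrier H \<Longrightarrow> res H Q l v \<in> carrier H"
  using res_Q Q_in by blast

lemma Q_res:
  assumes "(x, y) \<in> Q" "Im l \<noteq> 0"
  shows "x = res H Q l (y \<ominus> l \<odot> x)"
proof -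
  note H = Q_in[OF assms(1)]
  have "(y \<ominus> l \<odot> x) \<oplus> l \<odot> x = y" using H by (intro vec_eqI) auto
  then show ?thesis using assms H by (intro res_eqI[symmetric]) auto
qed

lemma res_add:
  assumes "Im l \<noteq> 0" "v \<in> carrier H" "w \<in> carrier H"
  shows "res H Q l (v \<oplus> w) = res H Q l v \<oplus> res H Q l w"
proof (rule res_eqI)
  have "(v \<oplus> w) \<oplus> l \<odot> (res H Q l v \<oplus> res H Q l w)
      = (v \<oplus> l \<odot> res H Q l v) \<oplus> (w \<oplus> l \<odot> res H Q l w)"
    using assms by (intro vec_eqI) (auto simp: algebra_simps)
  then show "(res H Q l v \<oplus> res H Q l w, (v \<oplus> w) \<oplus> l \<odot> (res H Q l v \<oplus> res H Q l w)) \<in> Q"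
    using assms by (simp add: Q_add res_Q)
qed (use assms in auto)

lemma res_smult:
  assumes "Im l \<noteq> 0" "v \<in> carrier H"
  shows "res H Q l (c \<odot> v) = c \<odot> res H Q l v"
proof (rule res_eqI)
  have "(c \<odot> v) \<oplus> l \<odot> (c \<odot> res H Q l v) = c \<odot> (v \<oplus> l \<odot> res H Q l v)"
    using assms by (intro vec_eqI) (auto simp: algebra_simps)
  then show "(c \<odot> res H Q l v, (c \<odot> v) \<oplus> l \<odot> (c \<odot> res H Q l v)) \<in> Q"
    using assms by (simp add: Q_smult res_Q)
qed (use assms in auto)

lemma res_diff:
  assumes "Im l \<noteq> 0" "v \<in> carrier H" "w \<in> carrier H"
  shows "res H Q l (v \<ominus> w) = res H Q l v \<ominus> res H Q l w"
  using assms by (simp add: diff_eq res_add res_smult)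

lemma res_bound:
  assumes "Im l \<noteq> 0" "v \<in> carrier H"
  shows "\<bar>Im l\<bar> * hnorm H (res H Q l v) \<le> hnorm H v"
proof -
  have "(v \<oplus> l \<odot> res H Q l v) \<ominus> l \<odot> res H Q l v = v"
    using assms by (intro vec_eqI) auto
  then show ?thesis using Im_bound[OF res_Q[OF assms], of l] by simp
qed

text \<open>Symmetry of \<open>Q\<close> applied to the two resolvent values; the terms with
  \<open>l\<close> cancel because the inner product is conjugate linear on the right.\<close>

lemma res_adjoint:
  assumes l: "Im l \<noteq> 0" and H: "v \<in> carrier H" "w \<in> carrier H"
  shows "cinner H (res H Q l v) w = cinner H v (res H Q (cnj l) w)"
proof -
  have l': "Im (cnj l) \<noteq> 0" using l by simp
  show ?thesis
    using Q_sym[OF res_Q[OF l H(1)] res_Q[OF l' H(2)]] l l' H by (simp add: algebra_simps)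
qed

lemma res_lim:
  assumes l: "Im l \<noteq> 0" and f: "hlim H f v"
  shows "hlim H (\<lambda>n. res H Q l (f n)) (res H Q l v)"
proof (rule hlimI_le)
  note H = hlimD[OF f]
  show "hnorm H (res H Q l (f n) \<ominus> res H Q l v) \<le> hnorm H (f n \<ominus> v) / \<bar>Im l\<bar>" for n
    using res_bound[OF l, of "f n \<ominus> v"] H l by (simp add: res_diff field_simps)
  show "(\<lambda>n. hnorm H (f n \<ominus> v) / \<bar>Im l\<bar>) \<longlonglongrightarrow> 0"
    using tendsto_divide[OF H(3) tendsto_const[of "\<bar>Im l\<bar>"]] l by simp
qed (use hlimD[OF f] l in auto)

end

section \<open>A criterion for self-adjointness; closed subspaces as Hilbert spaces\<close>

context complex_hilbert_space
begin

text \<open>Density of the domain comes for free: if \<open>z\<close> is orthogonal to the domain,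
  the pair of zero and \<open>z\<close> lies in the adjoint graph, hence in \<open>Q\<close>, and
  single-valuedness makes \<open>z\<close> vanish.\<close>

lemma selfadjoint_operatorI:
  assumes lin: "linear_operator H Q" and adj: "adjoint_graph H Q \<subseteq> Q" "Q \<subseteq> adjoint_graph H Q"
  shows "selfadjoint_operator H Q"
proof -
  have Q: "Q \<subseteq> carrier H \<times> carrier H" "single_valued Q" "(\<zero>, \<zero>) \<in> Q"
    "\<And>x y x' y'. (x, y) \<in> Q \<Longrightarrow> (x', y') \<in> Q \<Longrightarrow> (x \<oplus> x', y \<oplus> y') \<in> Q"
    "\<And>c x y. (x, y) \<in> Q \<Longrightarrow> (c \<odot> x, c \<odot> y) \<in> Q"
    using lin unfolding linear_operator_def by fast+
  have D: "Domain Q \<subseteq> carrier H" using Q(1) by auto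
  have "htopology H closure_of Domain Q = carrier H"
  proof (rule closed_subspace_eq_carrierI)
    show "closed_subspace H (htopology H closure_of Domain Q)"
      by (rule closed_subspace_closure_of[OF D]) (use Q in blast)+
    fix z assume z: "z \<in> orth H (htopology H closure_of Domain Q)"
    have "Domain Q \<subseteq> htopology H closure_of Domain Q"
      using D by (intro closure_of_subset) simp
    then have "cinner H z x = 0" if "x \<in> Domain Q" for x
      using orthD[OF z] that by blast
    then have "cinner H x z = 0" if "(x, y) \<in> Q" for x y
      using that cinner_commute[of x z] orth_in[OF z] D by force
    then have "(\<zero>, z) \<in> adjoint_graph H Q"
      unfolding adjoint_graph_def using orth_in[OF z] Q(1) by (auto simp: DomainI)
    then show "z = \<zero>" using adj Q(2,3) unfolding single_valued_def by blast
  qed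
  then show ?thesis
    using lin adj by (auto simp: selfadjoint_operator_def densely_defined_def)
qed

lemma inner_module_subspace:
  assumes X: "closed_subspace H X"
  shows "inner_module (H\<lparr>carrier := X\<rparr>)"
proof (intro inner_module.intro inner_module_axioms.intro)
  show "Module.module complex_field (H\<lparr>carrier := X\<rparr>)"
    using X by (intro submodule.submodule_is_module module_axioms) (auto simp: closed_subspace_def)
qed (use closed_subspaceD(1)[OF X] in
    \<open>auto simp: cinner_ge_zero cinner_eq_zero_iff subset_iff intro: cinner_commute\<close>)

text \<open>Subtraction goes through the additive inverse, a description over the carrier that does
  not simply unfold when the carrier changes; multiplication by -1 does.\<close>

lemma diff_subspace:
  assumes X: "closed_subspace H X" and x: "x \<in> X" "y \<in> X"
  shows "x \<ominus>\<^bsub>H\<lparr>carrier := X\<rparr>\<^esub> y = x \<ominus> y"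
proof -
  interpret S: inner_module "H\<lparr>carrier := X\<rparr>" by (rule inner_module_subspace[OF X])
  have "x \<ominus>\<^bsub>H\<lparr>carrier := X\<rparr>\<^esub> y = x \<oplus> (-1) \<odot> y" using S.diff_eq[of x y] x by simp
  then show ?thesis using x closed_subspaceD(1)[OF X] by (simp add: diff_eq subset_iff)
qed

lemma hilbert_subspace:
  assumes X: "closed_subspace H X"
  shows "complex_hilbert_space (H\<lparr>carrier := X\<rparr>)"
proof -
  interpret S: inner_module "H\<lparr>carrier := X\<rparr>" by (rule inner_module_subspace[OF X])
  have hn: "hnorm (H\<lparr>carrier := X\<rparr>) x = hnorm H x" for x by (simp add: hnorm_def)
  show ?thesis
  proof (rule S.complex_hilbert_spaceI)
    fix f assume "hcauchy (H\<lparr>carrier := X\<rparr>) f"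
    then have f: "\<And>n. f n \<in> X" "hcauchy H f"
      using closed_subspaceD(1)[OF X]
      by (auto simp: hcauchy_def hn diff_subspace[OF X] subset_iff)
    obtain l where l: "hlim H f l" using hcauchy_convergent[OF f(2)] .
    moreover have "l \<in> X" using closed_subspaceD(6)[OF X f(1) l] .
    ultimately have "hlim (H\<lparr>carrier := X\<rparr>) f l"
      using f by (auto simp: hlim_def hn diff_subspace[OF X])
    then show "\<exists>l. hlim (H\<lparr>carrier := X\<rparr>) f l" ..
  qed
qed

end

section \<open>Reducing subspaces\<close>

context selfadjoint_space
begin

lemma closed_operator: "closed_operator H Q"
proof -
  interpret P: Metric_space12 "carrier H" "hdist H" "carrier H" "hdist H" ..
  let ?T = "Metric_space.mtopology (carrier H \<times> carrier H) (prod_dist (hdist H) (hdist H))"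
  show ?thesis
    unfolding closed_operator_def Metric_space.metric_closedin_iff_sequentially_closed[OF P.prod_metric]
  proof safe
    fix f x y assume f: "range f \<subseteq> Q" and l: "limitin ?T f (x, y) sequentially"
    define g where "g n = fst (f n)" for n
    define h where "h n = snd (f n)" for n
    have gh: "(g n, h n) \<in> Q" for n using f by (auto simp: g_def h_def)
    note H = Q_in[OF gh]
    have xy: "x \<in> carrier H" "y \<in> carrier H"
      and lim: "(\<lambda>n. prod_dist (hdist H) (hdist H) (f n) (x, y)) \<longlonglongrightarrow> 0"
      using l by (auto simp: Metric_space.limitin_metric_dist_null[OF P.prod_metric])
    have pd: "prod_dist (hdist H) (hdist H) (f n) (x, y) =
        sqrt ((hnorm H (g n \<ominus> x))\<^sup>2 + (hnorm H (h n \<ominus> y))\<^sup>2)" for n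
      using H xy by (simp add: prod_dist_def g_def h_def hdist_def split_beta)
    have "hlim H g x"
      by (rule hlimI_le[OF H(1) xy(1) _ lim]) (simp add: pd)
    moreover have "hlim H h y"
      by (rule hlimI_le[OF H(2) xy(2) _ lim]) (simp add: pd)
    ultimately show "(x, y) \<in> Q" using Q_lim gh by blast
  qed (use Q_in in auto)
qed

text \<open>Invariance under both resolvents is invariance under \<open>res H Q \<i>\<close> and its
  adjoint, so projections commute with the resolvent and orthogonal complements are again reducing.
  No condition on the domain of \<open>Q\<close> has to be carried along.\<close>

definition reducing :: "'a set \<Rightarrow> bool" where
  "reducing X \<longleftrightarrow> closed_subspace H X \<and> (\<forall>v\<in>X. res H Q \<i> v \<in> X \<and> res H Q (-\<i>) v \<in> X)"

definition red_span :: "'a set \<Rightarrow> 'a set" where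
  "red_span Z = \<Inter> {X. reducing X \<and> Z \<subseteq> X}"

lemma reducing_closed_subspace: "reducing X \<Longrightarrow> closed_subspace H X"
  by (simp add: reducing_def)

lemma reducing_sub: "reducing X \<Longrightarrow> X \<subseteq> carrier H"
  by (simp add: reducing_def closed_subspaceD(1))

lemma reducing_res: "reducing X \<Longrightarrow> v \<in> X \<Longrightarrow> l = \<i> \<or> l = -\<i> \<Longrightarrow> res H Q l v \<in> X"
  by (auto simp: reducing_def)

lemma reducing_carrier: "reducing (carrier H)"
  by (simp add: reducing_def closed_subspace_carrier)

lemma reducing_red_span: "Z \<subseteq> carrier H \<Longrightarrow> reducing (red_span Z)"
  unfolding red_span_def reducing_def[of "\<Inter> _"]
  using reducing_carrier
  by (intro conjI ballI closed_subspace_Inter) (auto simp: reducing_res reducing_closed_subspace)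

lemma red_span_superset: "Z \<subseteq> red_span Z"
  by (auto simp: red_span_def)

lemma red_span_minimal: "reducing X \<Longrightarrow> Z \<subseteq> X \<Longrightarrow> red_span Z \<subseteq> X"
  by (auto simp: red_span_def)

text \<open>The resolvents at \<open>\<i>\<close> and \<open>-\<i>\<close> are adjoint to each
  other, so invariance passes to the complement. Stated for invariant sets so that it applies
  directly to \<open>dcl M G\<close>.\<close>

lemma reducing_orth:
  assumes "X \<subseteq> carrier H" "\<And>v. v \<in> X \<Longrightarrow> res H Q \<i> v \<in> X" "\<And>v. v \<in> X \<Longrightarrow> res H Q (-\<i>) v \<in> X"
  shows "reducing (orth H X)"
  unfolding reducing_def
proof (intro conjI ballI)
  show "closed_subspace H (orth H X)" by (rule closed_subspace_orth[OF assms(1)])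
  fix v assume v: "v \<in> orth H X"
  show "res H Q \<i> v \<in> orth H X" "res H Q (- \<i>) v \<in> orth H X"
    using orth_in[OF v] orthD[OF v] assms by (auto simp: orth_def subset_iff res_adjoint)
qed

lemma proj_res:
  assumes X: "reducing X" and l: "l = \<i> \<or> l = -\<i>" and v: "v \<in> carrier H"
  shows "proj H X (res H Q l v) = res H Q l (proj H X v)"
proof (rule proj_eqI)
  note C = reducing_closed_subspace[OF X]
  have l0: "Im l \<noteq> 0" using l by auto
  have l': "cnj l = \<i> \<or> cnj l = -\<i>" using l by auto
  show "closed_subspace H X" "res H Q l v \<in> carrier H" using C l0 v by auto
  show "res H Q l (proj H X v) \<in> X" by (rule reducing_res[OF X proj_mem[OF C v] l])
  fix s assume s: "s \<in> X"
  then have "res H Q (cnj l) s \<in> X" by (rule reducing_res[OF X _ l'])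
  then show "cinner H (res H Q l (proj H X v)) s = cinner H (res H Q l v) s"
    using s reducing_sub[OF X] by (simp add: res_adjoint l0 v proj_in[OF C] cinner_proj[OF C] subset_iff)
qed

text \<open>An operator graph is recovered from the resolvent, so maps commuting with the resolvent
  preserve it.\<close>

lemma Q_image:
  assumes xy: "(x, y) \<in> Q" and V: "V (res H Q \<i> (y \<ominus> \<i> \<odot> x)) = res H Q \<i> (V (y \<ominus> \<i> \<odot> x))"
    and H: "V x \<in> carrier H" "V y \<in> carrier H" and lin: "V (y \<ominus> \<i> \<odot> x) = V y \<ominus> \<i> \<odot> V x"
  shows "(V x, V y) \<in> Q"
proof -
  have i: "Im \<i> \<noteq> 0" by simp
  have "V x = res H Q \<i> (V y \<ominus> \<i> \<odot> V x)"
    using V Q_res[OF xy i] lin by simp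
  moreover have "(V y \<ominus> \<i> \<odot> V x) \<oplus> \<i> \<odot> V x = V y"
    using H by (intro vec_eqI) auto
  ultimately show ?thesis using res_Q[OF i, of "V y \<ominus> \<i> \<odot> V x"] H by auto
qed

lemma proj_Q:
  assumes X: "reducing X" and xy: "(x, y) \<in> Q"
  shows "(proj H X x, proj H X y) \<in> Q"
proof (rule Q_image[OF xy])
  note C = reducing_closed_subspace[OF X]
  show "proj H X (res H Q \<i> (y \<ominus> \<i> \<odot> x)) = res H Q \<i> (proj H X (y \<ominus> \<i> \<odot> x))"
    using Q_in[OF xy] by (intro proj_res[OF X]) auto
  show "proj H X (y \<ominus> \<i> \<odot> x) = proj H X y \<ominus> \<i> \<odot> proj H X x"
    using Q_in[OF xy] C by (simp add: diff_eq proj_add proj_smult proj_in)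
qed (use Q_in[OF xy] reducing_closed_subspace[OF X] in \<open>auto simp: proj_in\<close>)

text \<open>A pair in the adjoint of the restricted graph is tested against an arbitrary pair of
  \<open>Q\<close> by projecting the latter into \<open>X\<close>; it therefore lies in
  \<open>Q\<close>.\<close>

lemma selfadjoint_subspace:
  assumes X: "reducing X"
  shows "selfadjoint_space (H\<lparr>carrier := X\<rparr>) (Q \<inter> X \<times> X)"
proof -
  note C = reducing_closed_subspace[OF X]
  interpret S: complex_hilbert_space "H\<lparr>carrier := X\<rparr>" by (rule hilbert_subspace[OF C])
  show ?thesis
  proof (intro selfadjoint_space.intro selfadjoint_space_axioms.intro S.selfadjoint_operatorI)
    show "complex_hilbert_space (H\<lparr>carrier := X\<rparr>)" by (rule hilbert_subspace[OF C])
    show "linear_operator (H\<lparr>carrier := X\<rparr>) (Q \<inter> X \<times> X)"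
      unfolding linear_operator_def
      using Q_zero closed_subspaceD(2-4)[OF C]
      by (auto simp: single_valued_def Q_add Q_smult intro: Q_unique)
    show "Q \<inter> X \<times> X \<subseteq> adjoint_graph (H\<lparr>carrier := X\<rparr>) (Q \<inter> X \<times> X)"
      unfolding adjoint_graph_def using Q_sym by auto
    show "adjoint_graph (H\<lparr>carrier := X\<rparr>) (Q \<inter> X \<times> X) \<subseteq> Q \<inter> X \<times> X"
    proof
      fix p assume p: "p \<in> adjoint_graph (H\<lparr>carrier := X\<rparr>) (Q \<inter> X \<times> X)"
      obtain y z where yz: "p = (y, z)" by (cases p)
      with p have X': "y \<in> X" "z \<in> X"
        and adj: "\<And>x w. (x, w) \<in> Q \<Longrightarrow> x \<in> X \<Longrightarrow> w \<in> X \<Longrightarrow> cinner H w y = cinner H x z"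
        by (auto simp: adjoint_graph_def)
      have "(y, z) \<in> Q"
      proof (rule QI)
        fix x w assume xw: "(x, w) \<in> Q"
        have "cinner H (proj H X w) y = cinner H (proj H X x) z"
          using proj_Q[OF X xw] proj_mem[OF C] Q_in[OF xw] by (intro adj) auto
        then show "cinner H w y = cinner H x z"
          using cinner_proj[OF C] X' Q_in[OF xw] by simp
      qed (use X' reducing_sub[OF X] in auto)
      then show "p \<in> Q \<inter> X \<times> X" using X' yz by simp
    qed
  qed
qed

end

section \<open>Isometric intertwiners\<close>

text \<open>Inclusion of graphs suffices: uniqueness of resolvents upgrades it to
  \<open>j_res\<close>, so the range is reducing. Source and target may have different types, as one
  notion serves automorphisms, subspaces, direct sums and embeddings.\<close>

locale intertwiner = A: selfadjoint_space A QA + B: selfadjoint_space B QB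
  for A :: "('a, 'm) hilbert_scheme" and QA and B :: "('b, 'n) hilbert_scheme" and QB +
  fixes j :: "'a \<Rightarrow> 'b"
  assumes j_in [simp]: "x \<in> carrier A \<Longrightarrow> j x \<in> carrier B"
    and j_add: "\<lbrakk>x \<in> carrier A; y \<in> carrier A\<rbrakk> \<Longrightarrow> j (x \<oplus>\<^bsub>A\<^esub> y) = j x \<oplus>\<^bsub>B\<^esub> j y"
    and j_smult: "x \<in> carrier A \<Longrightarrow> j (c \<odot>\<^bsub>A\<^esub> x) = c \<odot>\<^bsub>B\<^esub> j x"
    and j_cinner [simp]: "\<lbrakk>x \<in> carrier A; y \<in> carrier A\<rbrakk> \<Longrightarrow> cinner B (j x) (j y) = cinner A x y"
    and j_Q: "(x, y) \<in> QA \<Longrightarrow> (j x, j y) \<in> QB"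
begin

lemma j_diff: "\<lbrakk>x \<in> carrier A; y \<in> carrier A\<rbrakk> \<Longrightarrow> j (x \<ominus>\<^bsub>A\<^esub> y) = j x \<ominus>\<^bsub>B\<^esub> j y"
  by (simp add: A.diff_eq B.diff_eq j_add j_smult)

lemma j_zero: "j \<zero>\<^bsub>A\<^esub> = \<zero>\<^bsub>B\<^esub>"
  using j_diff[of "\<zero>\<^bsub>A\<^esub>" "\<zero>\<^bsub>A\<^esub>"] by simp

lemma j_hnorm [simp]: "x \<in> carrier A \<Longrightarrow> hnorm B (j x) = hnorm A x"
  by (simp add: hnorm_def)

lemma j_inj: "inj_on j (carrier A)"
proof (rule inj_onI)
  fix x y assume H: "x \<in> carrier A" "y \<in> carrier A" and "j x = j y"
  then have "hnorm B (j (x \<ominus>\<^bsub>A\<^esub> y)) = 0" by (simp add: j_diff)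
  then show "x = y" using H by (simp add: A.hnorm_eq_0_iff A.diff_eq_zero_iff)
qed

lemma j_hlim_iff:
  assumes "\<And>n. f n \<in> carrier A" "l \<in> carrier A"
  shows "hlim B (\<lambda>n. j (f n)) (j l) \<longleftrightarrow> hlim A f l"
  using assms by (simp add: hlim_def flip: j_diff)

lemma j_hcauchy_iff:
  assumes "\<And>n. f n \<in> carrier A"
  shows "hcauchy B (\<lambda>n. j (f n)) \<longleftrightarrow> hcauchy A f"
  using assms by (simp add: hcauchy_def flip: j_diff)

text \<open>A convergent sequence in the image comes from a Cauchy sequence in \<open>A\<close>,
  whose completeness supplies the preimage of the limit.\<close>

lemma j_image_closed_subspace:
  assumes S: "closed_subspace A S"
  shows "closed_subspace B (j ` S)"
proof (rule B.closed_subspaceI)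
  note SD = A.closed_subspaceD[OF S]
  show "j ` S \<subseteq> carrier B" using SD(1) by auto
  show "\<zero>\<^bsub>B\<^esub> \<in> j ` S" using SD(2) j_zero by force
  show "x \<oplus>\<^bsub>B\<^esub> y \<in> j ` S" if xy: "x \<in> j ` S" "y \<in> j ` S" for x y
  proof -
    obtain a b where "a \<in> S" "b \<in> S" "x = j a" "y = j b" using xy by blast
    then have "x \<oplus>\<^bsub>B\<^esub> y = j (a \<oplus>\<^bsub>A\<^esub> b)" "a \<oplus>\<^bsub>A\<^esub> b \<in> S" using SD(1,3) by (auto simp: j_add subset_iff)
    then show ?thesis by blast
  qed
  show "c \<odot>\<^bsub>B\<^esub> x \<in> j ` S" if x: "x \<in> j ` S" for c x
  proof -
    obtain a where "a \<in> S" "x = j a" using x by blast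
    then have "c \<odot>\<^bsub>B\<^esub> x = j (c \<odot>\<^bsub>A\<^esub> a)" "c \<odot>\<^bsub>A\<^esub> a \<in> S" using SD(1,4) by (auto simp: j_smult subset_iff)
    then show ?thesis by blast
  qed
  fix f l assume f: "\<And>n. f n \<in> j ` S" and l: "hlim B f l"
  have "\<forall>n. \<exists>x. x \<in> S \<and> f n = j x" using f by blast
  from choice[OF this] obtain g where "\<forall>n. g n \<in> S \<and> f n = j (g n)" ..
  then have g: "g n \<in> S" "f n = j (g n)" for n by auto
  have gA: "g n \<in> carrier A" for n using g SD(1) by auto
  have "hcauchy A g"
    using B.hlim_imp_hcauchy[OF l] j_hcauchy_iff[of g, OF gA] by (simp flip: g(2))
  then obtain m where m: "hlim A g m" by (rule A.hcauchy_convergent)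
  have "hlim B (\<lambda>n. j (g n)) (j m)" using m j_hlim_iff[of g m, OF gA] A.hlimD(2)[OF m] by simp
  then have "hlim B f (j m)" by (simp flip: g(2))
  then have "l = j m" using B.hlim_unique[OF l] by simp
  then show "l \<in> j ` S" using SD(6)[OF g(1) m] by simp
qed

lemma j_vimage_closed_subspace:
  assumes S: "closed_subspace B S"
  shows "closed_subspace A {x \<in> carrier A. j x \<in> S}"
proof (rule A.closed_subspaceI)
  note SD = B.closed_subspaceD[OF S]
  fix f l assume f: "\<And>n. f n \<in> {x \<in> carrier A. j x \<in> S}" and l: "hlim A f l"
  then have "hlim B (\<lambda>n. j (f n)) (j l)" using j_hlim_iff[of f l] A.hlimD[OF l] by simp
  then show "l \<in> {x \<in> carrier A. j x \<in> S}" using SD(6)[of "\<lambda>n. j (f n)" "j l"] f A.hlimD(2)[OF l] by simp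
qed (use B.closed_subspaceD[OF S] in \<open>auto simp: j_add j_smult j_zero\<close>)

lemma j_closed_span:
  assumes X: "X \<subseteq> carrier A"
  shows "closed_span B (j ` X) = j ` closed_span A X"
proof
  note C = A.closed_subspace_closed_span[OF X]
  show "closed_span B (j ` X) \<subseteq> j ` closed_span A X"
    by (intro B.closed_span_minimal j_image_closed_subspace C image_mono A.closed_span_superset)
  have jX: "j ` X \<subseteq> carrier B" using X by auto
  have "closed_span A X \<subseteq> {x \<in> carrier A. j x \<in> closed_span B (j ` X)}"
    using X B.closed_span_superset[of "j ` X"]
    by (intro A.closed_span_minimal j_vimage_closed_subspace B.closed_subspace_closed_span jX) auto
  then show "j ` closed_span A X \<subseteq> closed_span B (j ` X)" by auto
qed

lemma j_res:
  assumes l: "Im l \<noteq> 0" and v: "v \<in> carrier A"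
  shows "j (res A QA l v) = res B QB l (j v)"
  using j_Q[OF A.res_Q[OF l v]] l v by (intro B.res_eqI[symmetric]) (auto simp: j_add j_smult)

lemma reducing_range: "B.reducing (j ` carrier A)"
  unfolding B.reducing_def
  by (auto simp: j_image_closed_subspace A.closed_subspace_carrier simp flip: j_res)

text \<open>The Hilbert space adjoint of \<open>j\<close>: project onto the range, then invert. Once
  \<open>cinner_jadj\<close> is known, linearity and commutation with resolvents are read off from
  it.\<close>

definition jadj :: "'b \<Rightarrow> 'a" where
  "jadj y = inv_into (carrier A) j (proj B (j ` carrier A) y)"

lemma closed_range: "closed_subspace B (j ` carrier A)"
  by (rule B.reducing_closed_subspace[OF reducing_range])

lemma jadj_in [simp]: "y \<in> carrier B \<Longrightarrow> jadj y \<in> carrier A"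
  unfolding jadj_def by (rule inv_into_into) (rule B.proj_mem[OF closed_range])

lemma j_jadj: "y \<in> carrier B \<Longrightarrow> j (jadj y) = proj B (j ` carrier A) y"
  unfolding jadj_def by (rule f_inv_into_f) (rule B.proj_mem[OF closed_range])

lemma cinner_jadj:
  assumes "y \<in> carrier B" "a \<in> carrier A"
  shows "cinner A (jadj y) a = cinner B y (j a)"
proof -
  have "cinner A (jadj y) a = cinner B (proj B (j ` carrier A) y) (j a)"
    using assms by (simp flip: j_jadj)
  then show ?thesis using B.cinner_proj[OF closed_range assms(1)] assms(2) by simp
qed

lemma cinner_jadj': "y \<in> carrier B \<Longrightarrow> a \<in> carrier A \<Longrightarrow> cinner A a (jadj y) = cinner B (j a) y"
  using cinner_jadj[of y a] A.cinner_commute[of a "jadj y"] B.cinner_commute[of "j a" y] by simp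

lemma jadj_j [simp]: "x \<in> carrier A \<Longrightarrow> jadj (j x) = x"
  by (rule A.vec_eqI) (auto simp: cinner_jadj)

lemma jadj_add: "\<lbrakk>x \<in> carrier B; y \<in> carrier B\<rbrakk> \<Longrightarrow> jadj (x \<oplus>\<^bsub>B\<^esub> y) = jadj x \<oplus>\<^bsub>A\<^esub> jadj y"
  by (rule A.vec_eqI) (auto simp: cinner_jadj)

lemma jadj_smult: "x \<in> carrier B \<Longrightarrow> jadj (c \<odot>\<^bsub>B\<^esub> x) = c \<odot>\<^bsub>A\<^esub> jadj x"
  by (rule A.vec_eqI) (auto simp: cinner_jadj)

lemma jadj_diff: "\<lbrakk>x \<in> carrier B; y \<in> carrier B\<rbrakk> \<Longrightarrow> jadj (x \<ominus>\<^bsub>B\<^esub> y) = jadj x \<ominus>\<^bsub>A\<^esub> jadj y"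
  by (rule A.vec_eqI) (auto simp: cinner_jadj)

lemma jadj_hnorm:
  assumes y: "y \<in> carrier B"
  shows "hnorm A (jadj y) \<le> hnorm B y"
proof -
  have "(hnorm A (jadj y))\<^sup>2 = cmod (cinner A (jadj y) (jadj y))"
    using y by (simp add: A.cinner_self norm_power)
  also have "\<dots> = cmod (cinner B y (j (jadj y)))"
    using y by (simp add: cinner_jadj)
  also have "\<dots> \<le> hnorm B y * hnorm A (jadj y)"
    using B.Cauchy_Schwarz[of y "j (jadj y)"] y by simp
  finally have "hnorm A (jadj y) * hnorm A (jadj y) \<le> hnorm B y * hnorm A (jadj y)"
    by (simp add: power2_eq_square)
  moreover have "0 \<le> hnorm A (jadj y)" "0 \<le> hnorm B y" using y by auto
  ultimately show ?thesis by (cases "hnorm A (jadj y) = 0") (auto simp: mult_le_cancel_right)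
qed

lemma jadj_res:
  assumes "Im l \<noteq> 0" "v \<in> carrier B"
  shows "jadj (res B QB l v) = res A QA l (jadj v)"
  using assms by (intro A.vec_eqI) (auto simp: cinner_jadj A.res_adjoint B.res_adjoint j_res)

text \<open>By duality \<open>jadj\<close> intertwines the resolvents, and a graph can be rebuilt
  from its resolvent at \<open>\<i>\<close>. This is what lets approximate inverses be compressed
  from \<open>B\<close> to \<open>A\<close>.\<close>

lemma jadj_Q:
  assumes xy: "(x, y) \<in> QB"
  shows "(jadj x, jadj y) \<in> QA"
proof -
  note H = B.Q_in[OF xy]
  have i: "Im \<i> \<noteq> 0" by simp
  have "jadj x = res A QA \<i> (jadj y \<ominus>\<^bsub>A\<^esub> \<i> \<odot>\<^bsub>A\<^esub> jadj x)"
    using arg_cong[OF B.Q_res[OF xy i], of jadj] H by (simp add: jadj_res jadj_diff jadj_smult)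
  moreover have "(jadj y \<ominus>\<^bsub>A\<^esub> \<i> \<odot>\<^bsub>A\<^esub> jadj x) \<oplus>\<^bsub>A\<^esub> \<i> \<odot>\<^bsub>A\<^esub> jadj x = jadj y"
    using H by (intro A.vec_eqI) auto
  ultimately show ?thesis using A.res_Q[OF i, of "jadj y \<ominus>\<^bsub>A\<^esub> \<i> \<odot>\<^bsub>A\<^esub> jadj x"] H by auto
qed

end

section \<open>Automorphisms\<close>

locale op_space = selfadjoint_space M "opgraph M"
  for M :: "'a op_structure" (structure)
begin

abbreviation R :: "complex \<Rightarrow> 'a \<Rightarrow> 'a" where "R \<equiv> res M (opgraph M)"

lemma automorphism_intertwiner:
  assumes "automorphism M U"
  shows "intertwiner M (opgraph M) M (opgraph M) U"
  using assms
  by unfold_locales (auto simp: automorphism_def linear_map_on_def bij_betw_def)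

lemma automorphism_in [simp]: "automorphism M U \<Longrightarrow> x \<in> carrier M \<Longrightarrow> U x \<in> carrier M"
  by (auto simp: automorphism_def bij_betw_def)

text \<open>Commutation with a single resolvent replaces the conditions on the domain and the graph,
  and \<open>U'\<close> enters only as a set-theoretic inverse.\<close>

lemma automorphismI:
  assumes U: "\<And>x. x \<in> carrier M \<Longrightarrow> U x \<in> carrier M" "\<And>x. x \<in> carrier M \<Longrightarrow> U' x \<in> carrier M"
    and inv: "\<And>x. x \<in> carrier M \<Longrightarrow> U (U' x) = x" "\<And>x. x \<in> carrier M \<Longrightarrow> U' (U x) = x"
    and add: "\<And>x y. x \<in> carrier M \<Longrightarrow> y \<in> carrier M \<Longrightarrow> U (x \<oplus> y) = U x \<oplus> U y"
    and smult: "\<And>c x. x \<in> carrier M \<Longrightarrow> U (c \<odot> x) = c \<odot> U x"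
    and inner: "\<And>x y. x \<in> carrier M \<Longrightarrow> y \<in> carrier M \<Longrightarrow> cinner M (U x) (U y) = cinner M x y"
    and R: "\<And>x. x \<in> carrier M \<Longrightarrow> U (R \<i> x) = R \<i> (U x)"
  shows "automorphism M U"
proof -
  have Q: "(U x, U y) \<in> opgraph M" if "(x, y) \<in> opgraph M" for x y
    using Q_in[OF that] by (intro Q_image[OF that]) (auto simp: R U diff_eq add smult)
  have i: "Im \<i> \<noteq> 0" by simp
  have "x \<in> U ` Domain (opgraph M)" if x: "(x, y) \<in> opgraph M" for x y
  proof -
    \<comment> \<open>\<open>x\<close> is the resolvent of \<open>y - \<i> x\<close>; pulling that
      vector back by \<open>U'\<close> exhibits \<open>x\<close> as the image of a domain
      element.\<close>
    define v where "v = U' (y \<ominus> \<i> \<odot> x)"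
    have v: "v \<in> carrier M" using Q_in[OF x] by (simp add: v_def U)
    have "x = U (R \<i> v)"
      using Q_res[OF x i] Q_in[OF x] by (simp add: R v inv) (simp add: v_def inv)
    then show ?thesis using res_Q[OF i v] by blast
  qed
  then have "U ` Domain (opgraph M) = Domain (opgraph M)" using Q by blast
  moreover have "bij_betw U (carrier M) (carrier M)"
    by (rule bij_betw_byWitness[of _ U']) (use U inv in auto)
  ultimately show ?thesis
    using Q U add smult inner by (auto simp: automorphism_def linear_map_on_def)
qed

lemma automorphism_id: "automorphism M (\<lambda>x. x)"
  by (rule automorphismI[of _ "\<lambda>x. x"]) auto

lemma automorphism_comp:
  assumes "automorphism M U" "automorphism M V"
  shows "automorphism M (\<lambda>x. U (V x))"
proof -
  interpret U: intertwiner M "opgraph M" M "opgraph M" U by (rule automorphism_intertwiner[OF assms(1)])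
  interpret V: intertwiner M "opgraph M" M "opgraph M" V by (rule automorphism_intertwiner[OF assms(2)])
  have "bij_betw (\<lambda>x. U (V x)) (carrier M) (carrier M)"
    using assms bij_betw_trans[of V "carrier M" "carrier M" U "carrier M"]
    by (auto simp: automorphism_def o_def)
  moreover have "(\<lambda>x. U (V x)) ` Domain (opgraph M) = Domain (opgraph M)"
    using assms unfolding automorphism_def by (metis image_image)
  ultimately show ?thesis
    unfolding automorphism_def linear_map_on_def
    by (auto simp: U.j_add V.j_add U.j_smult V.j_smult U.j_Q V.j_Q)
qed

definition ainv :: "('a \<Rightarrow> 'a) \<Rightarrow> 'a \<Rightarrow> 'a" where
  "ainv U = inv_into (carrier M) U"

lemma ainv_simps:
  assumes "automorphism M U" "x \<in> carrier M"
  shows "ainv U x \<in> carrier M" "U (ainv U x) = x" "ainv U (U x) = x"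
  using assms unfolding automorphism_def bij_betw_def ainv_def
  by (auto intro: inv_into_into f_inv_into_f inv_into_f_f)

lemma cinner_ainv:
  assumes "automorphism M U" "x \<in> carrier M" "y \<in> carrier M"
  shows "cinner M (ainv U x) y = cinner M x (U y)"
  using assms ainv_simps[OF assms(1)] unfolding automorphism_def by metis

lemma cinner_ainv':
  assumes "automorphism M U" "x \<in> carrier M" "y \<in> carrier M"
  shows "cinner M x (ainv U y) = cinner M (U x) y"
  using assms ainv_simps[OF assms(1)] unfolding automorphism_def by metis

lemma automorphism_ainv:
  assumes U: "automorphism M U"
  shows "automorphism M (ainv U)"
proof -
  interpret U: intertwiner M "opgraph M" M "opgraph M" U by (rule automorphism_intertwiner[OF U])
  have i: "Im \<i> \<noteq> 0" by simp
  show ?thesis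
  proof (rule automorphismI[of _ U])
    fix x assume x: "x \<in> carrier M"
    show "cinner M (ainv U x) (ainv U y) = cinner M x y" if "y \<in> carrier M" for y
      using x that by (simp add: cinner_ainv[OF U] ainv_simps[OF U])
    show "ainv U (R \<i> x) = R \<i> (ainv U x)"
      using x U.j_res[OF i, of "ainv U x"] ainv_simps[OF U]
      by (metis i res_in)
  qed (auto simp: ainv_simps[OF U] cinner_ainv[OF U] intro!: vec_eqI)
qed

lemma Aut_over_id: "(\<lambda>x. x) \<in> Aut_over M G"
  by (simp add: Aut_over_def automorphism_id)

lemma Aut_over_comp: "U \<in> Aut_over M G \<Longrightarrow> V \<in> Aut_over M G \<Longrightarrow> (\<lambda>x. U (V x)) \<in> Aut_over M G"
  by (auto simp: Aut_over_def automorphism_comp)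

lemma Aut_over_ainv: "U \<in> Aut_over M G \<Longrightarrow> G \<subseteq> carrier M \<Longrightarrow> ainv U \<in> Aut_over M G"
  by (auto simp: Aut_over_def automorphism_ainv) (metis ainv_simps(3) subsetD)

text \<open>The map is \<open>V\<close> on \<open>P\<close> and the identity on the complement.
  Projection onto \<open>P\<close> commutes with the resolvent, so commutation has to be checked on
  \<open>P\<close> only.\<close>

lemma automorphism_extension:
  assumes P: "reducing P"
    and V: "\<And>x. x \<in> P \<Longrightarrow> V x \<in> P" "\<And>x. x \<in> P \<Longrightarrow> V' x \<in> P"
    and inv: "\<And>x. x \<in> P \<Longrightarrow> V (V' x) = x" "\<And>x. x \<in> P \<Longrightarrow> V' (V x) = x"
    and add: "\<And>x y. x \<in> P \<Longrightarrow> y \<in> P \<Longrightarrow> V (x \<oplus> y) = V x \<oplus> V y"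
    and smult: "\<And>c x. x \<in> P \<Longrightarrow> V (c \<odot> x) = c \<odot> V x"
    and inner: "\<And>x y. x \<in> P \<Longrightarrow> y \<in> P \<Longrightarrow> cinner M (V x) (V y) = cinner M x y"
    and R: "\<And>x. x \<in> P \<Longrightarrow> V (R \<i> x) = R \<i> (V x)"
  shows "automorphism M (\<lambda>z. V (proj M P z) \<oplus> (z \<ominus> proj M P z))"
proof -
  note C = reducing_closed_subspace[OF P]
  define p where "p = proj M P"
  have p: "p z \<in> P" if "z \<in> carrier M" for z
    unfolding p_def by (rule proj_mem[OF C that])
  have P_in: "x \<in> carrier M" if "x \<in> P" for x using that reducing_sub[OF P] by auto
  note pH = P_in[OF p] and VH = P_in[OF V(1)] P_in[OF V(2)]
  have ip: "cinner M (p z) s = cinner M z s" if "z \<in> carrier M" "s \<in> P" for z s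
    unfolding p_def by (rule cinner_proj[OF C that])
  have ip': "cinner M s (p z) = cinner M s z" if "z \<in> carrier M" "s \<in> P" for z s
    using ip[OF that] cinner_commute[of s "p z"] cinner_commute[of s z] that pH P_in by simp
  have p_eq: "p (x \<oplus> (z \<ominus> p z)) = x" if "x \<in> P" "z \<in> carrier M" for x z
    unfolding p_def
  proof (rule proj_eqI[OF C])
    show "cinner M x s = cinner M (x \<oplus> (z \<ominus> proj M P z)) s" if "s \<in> P" for s
      using that \<open>x \<in> P\<close> \<open>z \<in> carrier M\<close> P_in ip pH by (simp flip: p_def)
  qed (use that P_in pH in \<open>auto simp flip: p_def\<close>)
  \<comment> \<open>Stated for an arbitrary pair of maps so that both compositions, \<open>V\<close>
    after \<open>V'\<close> and \<open>V'\<close> after \<open>V\<close>, are instances.\<close>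
  have undo: "W' (p (W (p z) \<oplus> (z \<ominus> p z))) \<oplus> (W (p z) \<oplus> (z \<ominus> p z) \<ominus> p (W (p z) \<oplus> (z \<ominus> p z))) = z"
    if "z \<in> carrier M" "W (p z) \<in> P" "W' (W (p z)) = p z" for W W' z
    using that pH P_in by (simp add: p_eq) (intro vec_eqI, auto)
  have "automorphism M (\<lambda>z. V (p z) \<oplus> (z \<ominus> p z))"
  proof (rule automorphismI[of _ "\<lambda>z. V' (p z) \<oplus> (z \<ominus> p z)"])
    fix x y assume x: "x \<in> carrier M" and y: "y \<in> carrier M"
    have "p (x \<oplus> y) = p x \<oplus> p y" unfolding p_def by (rule proj_add[OF C x y])
    then show "V (p (x \<oplus> y)) \<oplus> (x \<oplus> y \<ominus> p (x \<oplus> y)) = V (p x) \<oplus> (x \<ominus> p x) \<oplus> (V (p y) \<oplus> (y \<ominus> p y))"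
      using x y p pH VH by (intro vec_eqI) (auto simp: add)
    show "cinner M (V (p x) \<oplus> (x \<ominus> p x)) (V (p y) \<oplus> (y \<ominus> p y)) = cinner M x y"
      using x y p pH VH V ip[of x "p y"] ip'[of y "p x"] by (simp add: inner ip ip')
  next
    fix c x assume x: "x \<in> carrier M"
    have "p (c \<odot> x) = c \<odot> p x" unfolding p_def by (rule proj_smult[OF C x])
    then show "V (p (c \<odot> x)) \<oplus> (c \<odot> x \<ominus> p (c \<odot> x)) = c \<odot> (V (p x) \<oplus> (x \<ominus> p x))"
      using x p pH VH by (intro vec_eqI) (auto simp: smult algebra_simps)
  next
    fix x assume x: "x \<in> carrier M"
    have "p (R \<i> x) = R \<i> (p x)" unfolding p_def by (rule proj_res[OF P _ x]) simp
    then show "V (p (R \<i> x)) \<oplus> (R \<i> x \<ominus> p (R \<i> x)) = R \<i> (V (p x) \<oplus> (x \<ominus> p x))"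
      using x p pH VH by (simp add: R res_add res_diff)
  next
    fix x assume x: "x \<in> carrier M"
    show "V (p (V' (p x) \<oplus> (x \<ominus> p x))) \<oplus> (V' (p x) \<oplus> (x \<ominus> p x) \<ominus> p (V' (p x) \<oplus> (x \<ominus> p x))) = x"
      by (rule undo[OF x]) (use V p x inv in auto)
    show "V' (p (V (p x) \<oplus> (x \<ominus> p x))) \<oplus> (V (p x) \<oplus> (x \<ominus> p x) \<ominus> p (V (p x) \<oplus> (x \<ominus> p x))) = x"
      by (rule undo[OF x]) (use V p x inv in auto)
  qed (use V p pH VH in auto)
  then show ?thesis by (simp add: p_def)
qed

text \<open>The exchange is a self-adjoint involution: linearity follows by testing against vectors,
  preservation of inner products by moving one factor across. Commutation with the resolvent is
  inherited from \<open>j\<close>, \<open>k\<close> and their adjoints.\<close>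

lemma swap_automorphism:
  assumes j: "intertwiner A QA M (opgraph M) j" and k: "intertwiner A QA M (opgraph M) k"
    and orth: "\<And>a b. a \<in> carrier A \<Longrightarrow> b \<in> carrier A \<Longrightarrow> cinner M (j a) (k b) = 0"
  obtains U where "automorphism M U" "\<forall>a\<in>carrier A. U (j a) = k a" "\<forall>a\<in>carrier A. U (k a) = j a"
    "\<forall>z\<in>carrier M. (\<forall>a\<in>carrier A. cinner M z (j a) = 0) \<longrightarrow>
       (\<forall>a\<in>carrier A. cinner M z (k a) = 0) \<longrightarrow> U z = z"
proof -
  interpret J: intertwiner A QA M "opgraph M" j by (rule j)
  interpret K: intertwiner A QA M "opgraph M" k by (rule k)
  \<comment> \<open>The first bracket is the part of \<open>z\<close> orthogonal to both ranges; the
    coordinates \<open>J.jadj z\<close> and \<open>K.jadj z\<close> then re-enter with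
    \<open>j\<close> and \<open>k\<close> exchanged.\<close>
  define U where "U z = (z \<ominus> j (J.jadj z) \<ominus> k (K.jadj z)) \<oplus> (k (J.jadj z) \<oplus> j (K.jadj z))" for z
  have orth': "cinner M (k a) (j b) = 0" if "a \<in> carrier A" "b \<in> carrier A" for a b
    using orth[OF that(2,1)] cinner_commute[of "k a" "j b"] that by simp
  have Jk: "J.jadj (k a) = \<zero>\<^bsub>A\<^esub>" and Kj: "K.jadj (j a) = \<zero>\<^bsub>A\<^esub>" if "a \<in> carrier A" for a
    using that by (auto intro!: J.A.vec_eqI simp: J.cinner_jadj K.cinner_jadj orth orth')
  have UH: "U z \<in> carrier M" if "z \<in> carrier M" for z using that by (simp add: U_def)
  have JU: "J.jadj (U z) = K.jadj z" and KU: "K.jadj (U z) = J.jadj z" if "z \<in> carrier M" for z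
    using that by (auto intro!: J.A.vec_eqI simp: U_def J.cinner_jadj K.cinner_jadj orth orth')
  have UU: "U (U z) = z" if z: "z \<in> carrier M" for z
  proof -
    have "U (U z) = (U z \<ominus> j (K.jadj z) \<ominus> k (J.jadj z)) \<oplus> (k (K.jadj z) \<oplus> j (J.jadj z))"
      unfolding U_def[of "U z"] by (simp add: JU KU z)
    also have "\<dots> = z"
      unfolding U_def using z by (intro vec_eqI) auto
    finally show ?thesis .
  qed
  have Uip: "cinner M (U x) y = cinner M x (U y)" if "x \<in> carrier M" "y \<in> carrier M" for x y
    using that
    by (simp add: U_def J.cinner_jadj[symmetric] K.cinner_jadj[symmetric]
        J.cinner_jadj'[symmetric] K.cinner_jadj'[symmetric])
  show ?thesis
  proof (rule that[of U])
    show "automorphism M U"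
    proof (rule automorphismI[of _ U])
      fix x y assume "x \<in> carrier M" "y \<in> carrier M"
      then show "cinner M (U x) (U y) = cinner M x y" "U (x \<oplus> y) = U x \<oplus> U y"
        by (simp_all add: Uip UH UU) (auto intro!: vec_eqI simp: Uip UH)
    next
      fix c x assume "x \<in> carrier M"
      then show "U (c \<odot> x) = c \<odot> U x"
        by (auto intro!: vec_eqI simp: Uip UH)
      show "U (R \<i> x) = R \<i> (U x)"
        using \<open>x \<in> carrier M\<close>
        by (simp add: U_def J.jadj_res K.jadj_res J.j_res K.j_res res_add res_diff)
    qed (auto simp: UH UU)
    show "\<forall>a\<in>carrier A. U (j a) = k a"
      by (intro ballI vec_eqI UH) (auto simp: U_def Kj J.j_zero K.j_zero)
    show "\<forall>a\<in>carrier A. U (k a) = j a"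
      by (intro ballI vec_eqI UH) (auto simp: U_def Jk J.j_zero K.j_zero)
    show "\<forall>z\<in>carrier M. (\<forall>a\<in>carrier A. cinner M z (j a) = 0) \<longrightarrow>
        (\<forall>a\<in>carrier A. cinner M z (k a) = 0) \<longrightarrow> U z = z"
    proof (intro ballI impI)
      fix z assume z: "z \<in> carrier M" "\<forall>a\<in>carrier A. cinner M z (j a) = 0"
        "\<forall>a\<in>carrier A. cinner M z (k a) = 0"
      have "J.jadj z = \<zero>\<^bsub>A\<^esub>" "K.jadj z = \<zero>\<^bsub>A\<^esub>"
        using z by (auto intro!: J.A.vec_eqI simp: J.cinner_jadj K.cinner_jadj)
      then show "U z = z" using z by (simp add: U_def J.j_zero K.j_zero)
    qed
  qed
qed

text \<open>\<open>U\<close> maps the graph onto itself isometrically, so both infima run over the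
  same set of distances.\<close>

lemma Gam_automorphism:
  assumes U: "automorphism M U" and xy: "x \<in> carrier M" "y \<in> carrier M"
  shows "Gam M (U x) (U y) = Gam M x y"
proof -
  interpret U: intertwiner M "opgraph M" M "opgraph M" U by (rule automorphism_intertwiner[OF U])
  interpret I: intertwiner M "opgraph M" M "opgraph M" "ainv U"
    by (rule automorphism_intertwiner[OF automorphism_ainv[OF U]])
  have im: "opgraph M = map_prod U U ` opgraph M"
  proof
    show "map_prod U U ` opgraph M \<subseteq> opgraph M" using U.j_Q by auto
    show "opgraph M \<subseteq> map_prod U U ` opgraph M"
    proof
      fix p assume p: "p \<in> opgraph M"
      obtain a b where ab: "p = (a, b)" by (cases p)
      then have "(ainv U a, ainv U b) \<in> opgraph M" using I.j_Q p by auto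
      moreover have "p = map_prod U U (ainv U a, ainv U b)"
        using ab p Q_in ainv_simps[OF U] by auto
      ultimately show "p \<in> map_prod U U ` opgraph M" by blast
    qed
  qed
  have "prod_dist (hdist M) (hdist M) (U x, U y) (map_prod U U p) = prod_dist (hdist M) (hdist M) (x, y) p"
    if "p \<in> opgraph M" for p
    using that xy Q_in by (cases p) (auto simp: prod_dist_def hdist_def simp flip: U.j_diff)
  then have "(\<lambda>p. prod_dist (hdist M) (hdist M) (U x, U y) (map_prod U U p)) ` opgraph M
      = prod_dist (hdist M) (hdist M) (x, y) ` opgraph M"
    by (rule image_cong[OF refl])
  then show ?thesis
    unfolding Gam_def by (subst im) (simp add: image_image)
qed

text \<open>In the homogeneity argument Galois types are compared inside \<open>M\<close> itself,
  with an automorphism as one of the two embeddings.\<close>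

lemma K_embedding_automorphism:
  assumes U: "automorphism M U"
  shows "K_embedding M M U"
proof -
  interpret U: intertwiner M "opgraph M" M "opgraph M" U by (rule automorphism_intertwiner[OF U])
  have "metric_embedding M M U"
    unfolding metric_embedding_def
    by (auto simp: U.j_zero U.j_add U.j_smult Gam_automorphism[OF U])
  moreover have "prec (image_structure U M M) M"
    unfolding prec_def image_structure_def using U.j_Q by auto
  ultimately show ?thesis by (simp add: K_embedding_def)
qed

end

section \<open>Precompact orbits\<close>

lemma (in inner_module) hcauchy_subseq:
  assumes "hcauchy H f" "strict_mono r"
  shows "hcauchy H (\<lambda>n. f (r n))"
  using assms seq_suble[OF assms(2)] unfolding hcauchy_def by (meson order_trans)

text \<open>A diagonal subsequence is only eventually a subsequence of each stage; the finitely many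
  initial terms are discarded here.\<close>

lemma (in inner_module) hcauchy_shift:
  assumes f: "\<And>n. f n \<in> carrier H" and "hcauchy H (\<lambda>n. f (k + n))"
  shows "hcauchy H f"
  unfolding hcauchy_def
proof (intro conjI allI impI)
  fix e :: real assume "e > 0"
  then obtain N where N: "\<And>m n. m \<ge> N \<Longrightarrow> n \<ge> N \<Longrightarrow> hnorm H (f (k + m) \<ominus> f (k + n)) < e"
    using assms(2) unfolding hcauchy_def by meson
  have "hnorm H (f m \<ominus> f n) < e" if "m \<ge> k + N" "n \<ge> k + N" for m n
    using N[of "m - k" "n - k"] that by simp
  then show "\<exists>N. \<forall>m\<ge>N. \<forall>n\<ge>N. hnorm H (f m \<ominus> f n) < e" by blast
qed (rule f)

section \<open>Vectors with totally bounded orbit\<close>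

context op_space
begin

abbreviation orbit :: "'a set \<Rightarrow> 'a \<Rightarrow> 'a set" where
  "orbit G m \<equiv> (\<lambda>U. U m) ` Aut_over M G"

text \<open>Centres are allowed anywhere in the carrier: nets can then be added, mapped and
  transferred to limits without returning to the orbit.\<close>

definition precompact :: "'a set \<Rightarrow> 'a set" where
  "precompact G = {m \<in> carrier M. \<forall>e>0. \<exists>F. finite F \<and> F \<subseteq> carrier M \<and>
    (\<forall>U\<in>Aut_over M G. \<exists>y\<in>F. hnorm M (U m \<ominus> y) < e)}"

lemma Aut_over_in: "U \<in> Aut_over M G \<Longrightarrow> x \<in> carrier M \<Longrightarrow> U x \<in> carrier M"
  by (simp add: Aut_over_def)

lemma orbit_sub: "m \<in> carrier M \<Longrightarrow> orbit G m \<subseteq> carrier M"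
  by (auto simp: Aut_over_in)

lemma Aut_over_intertwiner: "U \<in> Aut_over M G \<Longrightarrow> intertwiner M (opgraph M) M (opgraph M) U"
  by (simp add: Aut_over_def automorphism_intertwiner)

lemma precompactI:
  assumes "m \<in> carrier M" "\<And>e. e > 0 \<Longrightarrow> \<exists>F. finite F \<and> F \<subseteq> carrier M \<and>
    (\<forall>U\<in>Aut_over M G. \<exists>y\<in>F. hnorm M (U m \<ominus> y) < e)"
  shows "m \<in> precompact G"
  using assms by (simp add: precompact_def)

lemma precompactD:
  assumes "m \<in> precompact G" "e > 0"
  obtains F where "finite F" "F \<subseteq> carrier M"
    "\<And>U. U \<in> Aut_over M G \<Longrightarrow> \<exists>y\<in>F. hnorm M (U m \<ominus> y) < e"
  using assms by (auto simp: precompact_def)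

lemma precompact_in: "m \<in> precompact G \<Longrightarrow> m \<in> carrier M"
  by (simp add: precompact_def)

lemma precompact_mono: "G \<subseteq> G' \<Longrightarrow> precompact G \<subseteq> precompact G'"
proof
  fix m assume "G \<subseteq> G'" and m: "m \<in> precompact G"
  then have "Aut_over M G' \<subseteq> Aut_over M G" by (auto simp: Aut_over_def)
  moreover have "\<exists>F. finite F \<and> F \<subseteq> carrier M \<and> (\<forall>U\<in>Aut_over M G. \<exists>y\<in>F. hnorm M (U m \<ominus> y) < e)"
    if "e > 0" for e
    using m that by (simp add: precompact_def)
  ultimately show "m \<in> precompact G'" 
    using precompact_in[OF m] by (intro precompactI) (assumption, meson subsetD)
qed

lemma precompact_add:
  assumes m: "m \<in> precompact G" and n: "n \<in> precompact G"
  shows "m \<oplus> n \<in> precompact G"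
proof (rule precompactI)
  show "m \<oplus> n \<in> carrier M" using m n precompact_in by auto
  fix e :: real assume "e > 0"
  then have e: "e / 2 > 0" by simp
  obtain F where F: "finite F" "F \<subseteq> carrier M"
    "\<And>U. U \<in> Aut_over M G \<Longrightarrow> \<exists>y\<in>F. hnorm M (U m \<ominus> y) < e / 2"
    using precompactD[OF m e] by blast
  obtain F' where F': "finite F'" "F' \<subseteq> carrier M"
    "\<And>U. U \<in> Aut_over M G \<Longrightarrow> \<exists>y\<in>F'. hnorm M (U n \<ominus> y) < e / 2"
    using precompactD[OF n e] by blast
  have "\<exists>y\<in>(\<lambda>(a, b). a \<oplus> b) ` (F \<times> F'). hnorm M (U (m \<oplus> n) \<ominus> y) < e" if U: "U \<in> Aut_over M G" for U
  proof -
    interpret U: intertwiner M "opgraph M" M "opgraph M" U by (rule Aut_over_intertwiner[OF U])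
    obtain a where a: "a \<in> F" "hnorm M (U m \<ominus> a) < e / 2" using F(3)[OF U] by blast
    obtain b where b: "b \<in> F'" "hnorm M (U n \<ominus> b) < e / 2" using F'(3)[OF U] by blast
    have H: "a \<in> carrier M" "b \<in> carrier M" "m \<in> carrier M" "n \<in> carrier M"
      using a b F(2) F'(2) m n precompact_in by auto
    have "U (m \<oplus> n) \<ominus> (a \<oplus> b) = (U m \<ominus> a) \<oplus> (U n \<ominus> b)"
      using H by (intro vec_eqI) (auto simp: U.j_add)
    then have "hnorm M (U (m \<oplus> n) \<ominus> (a \<oplus> b)) < e"
      using hnorm_triangle[of "U m \<ominus> a" "U n \<ominus> b"] H a b by simp
    then show ?thesis using a(1) b(1) by force
  qed
  then show "\<exists>F. finite F \<and> F \<subseteq> carrier M \<and> (\<forall>U\<in>Aut_over M G. \<exists>y\<in>F. hnorm M (U (m \<oplus> n) \<ominus> y) < e)"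
    using F(1,2) F'(1,2)
    by (intro exI[of _ "(\<lambda>(a, b). a \<oplus> b) ` (F \<times> F')"]) (auto simp: subset_iff)
qed

text \<open>The image of a net under a Lipschitz map is again a net, with the radius scaled; scalar
  multiplication and the resolvents are the instances in view.\<close>

lemma precompact_map:
  assumes m: "m \<in> precompact G" and T: "\<And>x. x \<in> carrier M \<Longrightarrow> T x \<in> carrier M"
    and C: "\<And>x y. x \<in> carrier M \<Longrightarrow> y \<in> carrier M \<Longrightarrow> hnorm M (T x \<ominus> T y) \<le> C * hnorm M (x \<ominus> y)"
    and U: "\<And>U. U \<in> Aut_over M G \<Longrightarrow> U (T m) = T (U m)"
  shows "T m \<in> precompact G"
proof (rule precompactI)
  have mH: "m \<in> carrier M" by (rule precompact_in[OF m])
  then show "T m \<in> carrier M" by (rule T)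
  fix e :: real assume e: "e > 0"
  \<comment> \<open>Adding 1 keeps the divisor positive whatever the value of
    \<open>C\<close>.\<close>
  have C0: "\<bar>C\<bar> + 1 > 0" by simp
  obtain F where F: "finite F" "F \<subseteq> carrier M"
    "\<And>U. U \<in> Aut_over M G \<Longrightarrow> \<exists>y\<in>F. hnorm M (U m \<ominus> y) < e / (\<bar>C\<bar> + 1)"
    using precompactD[OF m, of "e / (\<bar>C\<bar> + 1)"] e C0 by (metis divide_pos_pos)
  have "\<exists>y\<in>T ` F. hnorm M (U (T m) \<ominus> y) < e" if U': "U \<in> Aut_over M G" for U
  proof -
    obtain a where a: "a \<in> F" "hnorm M (U m \<ominus> a) < e / (\<bar>C\<bar> + 1)" using F(3)[OF U'] by blast
    have H: "a \<in> carrier M" "U m \<in> carrier M" using a F(2) mH Aut_over_in[OF U'] by auto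
    have "hnorm M (U (T m) \<ominus> T a) \<le> C * hnorm M (U m \<ominus> a)" using C[OF H(2,1)] U[OF U'] by simp
    also have "\<dots> \<le> (\<bar>C\<bar> + 1) * hnorm M (U m \<ominus> a)" using H by (intro mult_right_mono) auto
    also have "\<dots> < e" using a(2) C0 by (simp add: field_simps)
    finally show ?thesis using a(1) by blast
  qed
  then show "\<exists>F. finite F \<and> F \<subseteq> carrier M \<and> (\<forall>U\<in>Aut_over M G. \<exists>y\<in>F. hnorm M (U (T m) \<ominus> y) < e)"
    using F(1,2) T by (intro exI[of _ "T ` F"]) auto
qed

lemma reducing_precompact: "reducing (precompact G)"
proof -
  have "closed_subspace M (precompact G)"
  proof (rule closed_subspaceI)
    show "precompact G \<subseteq> carrier M" using precompact_in by auto
    show "\<zero> \<in> precompact G"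
    proof (rule precompactI)
      fix e :: real assume e: "e > 0"
      have "hnorm M (U \<zero> \<ominus> \<zero>) < e" if U: "U \<in> Aut_over M G" for U
        using intertwiner.j_zero[OF Aut_over_intertwiner[OF U]] e by simp
      then show "\<exists>F. finite F \<and> F \<subseteq> carrier M \<and> (\<forall>U\<in>Aut_over M G. \<exists>y\<in>F. hnorm M (U \<zero> \<ominus> y) < e)"
        using e by (intro exI[of _ "{\<zero>}"]) auto
    qed simp
    show "m \<oplus> n \<in> precompact G" if "m \<in> precompact G" "n \<in> precompact G" for m n
      using precompact_add that .
    show "c \<odot> m \<in> precompact G" if m: "m \<in> precompact G" for c m
    proof (rule precompact_map[OF m])
      show "hnorm M (c \<odot> x \<ominus> c \<odot> y) \<le> cmod c * hnorm M (x \<ominus> y)"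
        if "x \<in> carrier M" "y \<in> carrier M" for x y
      proof -
        have "c \<odot> x \<ominus> c \<odot> y = c \<odot> (x \<ominus> y)"
          using that by (intro vec_eqI) (auto simp: algebra_simps)
        then show ?thesis using that by simp
      qed
      show "U (c \<odot> m) = c \<odot> U m" if "U \<in> Aut_over M G" for U
        using intertwiner.j_smult[OF Aut_over_intertwiner[OF that] precompact_in[OF m]] .
    qed simp
    fix f l assume f: "\<And>n. f n \<in> precompact G" and l: "hlim M f l"
    show "l \<in> precompact G"
    proof (rule precompactI)
      show lH: "l \<in> carrier M" using hlimD(2)[OF l] .
      fix e :: real assume "e > 0"
      then have e: "e / 2 > 0" by simp
      have "\<forall>\<^sub>F n in sequentially. hnorm M (f n \<ominus> l) < e / 2"
        by (rule order_tendstoD(2)[OF hlimD(3)[OF l] e])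
      then obtain n where n: "hnorm M (f n \<ominus> l) < e / 2" by (auto simp: eventually_sequentially)
      obtain F where F: "finite F" "F \<subseteq> carrier M"
        "\<And>U. U \<in> Aut_over M G \<Longrightarrow> \<exists>y\<in>F. hnorm M (U (f n) \<ominus> y) < e / 2"
        using precompactD[OF f e] by blast
      have fH: "f n \<in> carrier M" by (rule hlimD(1)[OF l])
      have "\<exists>y\<in>F. hnorm M (U l \<ominus> y) < e" if U: "U \<in> Aut_over M G" for U
      proof -
        interpret U: intertwiner M "opgraph M" M "opgraph M" U by (rule Aut_over_intertwiner[OF U])
        obtain y where y: "y \<in> F" "hnorm M (U (f n) \<ominus> y) < e / 2" using F(3)[OF U] by blast
        have "hnorm M (U l \<ominus> y) \<le> hnorm M (U l \<ominus> U (f n)) + hnorm M (U (f n) \<ominus> y)"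
          using lH fH y F(2) by (intro hnorm_diff_triangle) auto
        also have "hnorm M (U l \<ominus> U (f n)) = hnorm M (f n \<ominus> l)"
          using lH fH by (simp add: hnorm_diff_commute flip: U.j_diff)
        finally show ?thesis using y n by (intro bexI[of _ y]) auto
      qed
      then show "\<exists>F. finite F \<and> F \<subseteq> carrier M \<and> (\<forall>U\<in>Aut_over M G. \<exists>y\<in>F. hnorm M (U l \<ominus> y) < e)"
        using F(1,2) by blast
    qed
  qed
  moreover have "R l m \<in> precompact G" if m: "m \<in> precompact G" and l: "l = \<i> \<or> l = -\<i>" for l m
  proof (rule precompact_map[OF m])
    have l0: "Im l \<noteq> 0" "\<bar>Im l\<bar> = 1" using l by auto
    show "hnorm M (R l x \<ominus> R l y) \<le> 1 * hnorm M (x \<ominus> y)"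
      if "x \<in> carrier M" "y \<in> carrier M" for x y
      using res_bound[OF l0(1), of "x \<ominus> y"] that l0 by (simp add: res_diff)
    show "U (R l m) = R l (U m)" if "U \<in> Aut_over M G" for U
      using intertwiner.j_res[OF Aut_over_intertwiner[OF that] l0(1) precompact_in[OF m]] .
  qed (use l in auto)
  ultimately show ?thesis unfolding reducing_def by blast
qed

text \<open>\<open>mtotally_bounded\<close> wants centres inside the orbit. Each centre with an
  orbit point within half the radius is replaced by such a point; the other centres cover
  nothing.\<close>

lemma mtotally_bounded_orbit_iff:
  assumes m: "m \<in> carrier M"
  shows "Met.mtotally_bounded (orbit G m) \<longleftrightarrow> m \<in> precompact G"
proof
  assume tb: "Met.mtotally_bounded (orbit G m)"
  show "m \<in> precompact G"
  proof (rule precompactI[OF m])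
    fix e :: real assume "e > 0"
    then obtain K where K: "finite K" "K \<subseteq> orbit G m" "orbit G m \<subseteq> (\<Union>x\<in>K. Met.mball x e)"
      using tb unfolding Met.mtotally_bounded_def by meson
    have "\<exists>y\<in>K. hnorm M (U m \<ominus> y) < e" if U: "U \<in> Aut_over M G" for U
    proof -
      have "U m \<in> orbit G m" using U by blast
      then obtain y where "y \<in> K" "U m \<in> Met.mball y e" using K(3) by blast
      then show ?thesis by (intro bexI[of _ y]) (auto simp: hdist_def hnorm_diff_commute[of "U m"])
    qed
    then show "\<exists>F. finite F \<and> F \<subseteq> carrier M \<and> (\<forall>U\<in>Aut_over M G. \<exists>y\<in>F. hnorm M (U m \<ominus> y) < e)"
      using K(1) order_trans[OF K(2) orbit_sub[OF m]] by (intro exI[of _ K] conjI ballI)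
  qed
next
  assume pm: "m \<in> precompact G"
  show "Met.mtotally_bounded (orbit G m)"
    unfolding Met.mtotally_bounded_def
  proof (intro allI impI)
    fix e :: real assume "e > 0"
    then have e: "e / 2 > 0" by simp
    obtain F where F: "finite F" "F \<subseteq> carrier M"
      "\<And>U. U \<in> Aut_over M G \<Longrightarrow> \<exists>y\<in>F. hnorm M (U m \<ominus> y) < e / 2"
      using precompactD[OF pm e] by blast
    define c where "c y = (SOME z. z \<in> orbit G m \<and> hnorm M (z \<ominus> y) < e / 2)" for y
    define F' where "F' = {y \<in> F. \<exists>z. z \<in> orbit G m \<and> hnorm M (z \<ominus> y) < e / 2}"
    have c: "c y \<in> orbit G m \<and> hnorm M (c y \<ominus> y) < e / 2" if "y \<in> F'" for y
      unfolding c_def by (rule someI_ex) (use that F'_def in blast)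
    have "orbit G m \<subseteq> (\<Union>x\<in>c ` F'. Met.mball x e)"
    proof
      fix z assume z: "z \<in> orbit G m"
      then obtain y where y: "y \<in> F" "hnorm M (z \<ominus> y) < e / 2" using F(3) by blast
      then have y': "y \<in> F'" using z by (auto simp: F'_def)
      have H: "z \<in> carrier M" "y \<in> carrier M" "c y \<in> carrier M"
        using z y F(2) c[OF y'] orbit_sub[OF m] by auto
      have "hnorm M (c y \<ominus> z) \<le> hnorm M (c y \<ominus> y) + hnorm M (y \<ominus> z)"
        by (rule hnorm_diff_triangle) (use H in auto)
      then have "hnorm M (c y \<ominus> z) < e"
        using y(2) c[OF y'] H by (simp add: hnorm_diff_commute[of y z])
      then have "z \<in> Met.mball (c y) e" using H by (simp add: hdist_def)
      then show "z \<in> (\<Union>x\<in>c ` F'. Met.mball x e)" using y' by blast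
    qed
    then show "\<exists>K. finite K \<and> K \<subseteq> orbit G m \<and> orbit G m \<subseteq> (\<Union>x\<in>K. Met.mball x e)"
      using F(1) c by (intro exI[of _ "c ` F'"]) (auto simp: F'_def)
  qed
qed

text \<open>Isometry gives closedness by an estimate in three parts, and each \<open>W n\<close>
  commutes with the resolvents. Convergence on a reducing subspace therefore has to be checked on
  generators only.\<close>

lemma reducing_convergence:
  assumes W: "\<And>n. automorphism M (W n)"
  shows "reducing {v \<in> carrier M. hcauchy M (\<lambda>n::nat. W n v)}" (is "reducing ?C")
proof -
  have I: "intertwiner M (opgraph M) M (opgraph M) (W n)" for n
    by (rule automorphism_intertwiner[OF W])
  have lim: "\<exists>l. hlim M (\<lambda>n. W n v) l" if "v \<in> ?C" for v
    using that hcauchy_convergent[of "\<lambda>n. W n v"] by blast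
  have inC: "v \<in> ?C" if "v \<in> carrier M" "hlim M (\<lambda>n. W n v) l" for v l
    using that hlim_imp_hcauchy by blast
  have "closed_subspace M ?C"
  proof (rule closed_subspaceI)
    show "\<zero> \<in> ?C" by (rule inC[of _ \<zero>]) (auto simp: intertwiner.j_zero[OF I] hlim_const)
    show "x \<oplus> y \<in> ?C" if xy: "x \<in> ?C" "y \<in> ?C" for x y
    proof -
      obtain a where a: "hlim M (\<lambda>n. W n x) a" using lim[OF xy(1)] by blast
      obtain b where b: "hlim M (\<lambda>n. W n y) b" using lim[OF xy(2)] by blast
      show ?thesis
        using hlim_add[OF a b] xy by (intro inC[of _ "a \<oplus> b"]) (auto simp: intertwiner.j_add[OF I])
    qed
    show "c \<odot> x \<in> ?C" if x: "x \<in> ?C" for c x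
    proof -
      obtain a where a: "hlim M (\<lambda>n. W n x) a" using lim[OF x] by blast
      show ?thesis
        using hlim_smult[OF a] x by (intro inC[of _ "c \<odot> a"]) (auto simp: intertwiner.j_smult[OF I])
    qed
    fix f l assume f: "\<And>n. f n \<in> ?C" and l: "hlim M f l"
    note H = hlimD[OF l]
    have "hcauchy M (\<lambda>n. W n l)"
      unfolding hcauchy_def
    proof (intro conjI allI impI)
      fix e :: real assume "e > 0"
      then have e: "e / 3 > 0" by simp
      have "\<forall>\<^sub>F n in sequentially. hnorm M (f n \<ominus> l) < e / 3"
        by (rule order_tendstoD(2)[OF H(3) e])
      then obtain k where k: "hnorm M (f k \<ominus> l) < e / 3" by (auto simp: eventually_sequentially)
      obtain N where N: "\<And>m n. m \<ge> N \<Longrightarrow> n \<ge> N \<Longrightarrow> hnorm M (W m (f k) \<ominus> W n (f k)) < e / 3"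
        using f[of k] e unfolding hcauchy_def by blast
      have d: "hnorm M (W n (f k) \<ominus> W n l) < e / 3" for n
        using k H intertwiner.j_hnorm[OF I[of n], of "f k \<ominus> l"]
        by (simp add: intertwiner.j_diff[OF I])
      have "hnorm M (W m l \<ominus> W n l) < e" if "m \<ge> N" "n \<ge> N" for m n
      proof -
        have "hnorm M (W m l \<ominus> W n l) \<le> hnorm M (W m l \<ominus> W m (f k)) + hnorm M (W m (f k) \<ominus> W n l)"
          by (rule hnorm_diff_triangle) (use H W in auto)
        also have "hnorm M (W m l \<ominus> W m (f k)) = hnorm M (W m (f k) \<ominus> W m l)"
          by (rule hnorm_diff_commute) (use H W in auto)
        also have "hnorm M (W m (f k) \<ominus> W n l)
            \<le> hnorm M (W m (f k) \<ominus> W n (f k)) + hnorm M (W n (f k) \<ominus> W n l)"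
          by (rule hnorm_diff_triangle) (use H W in auto)
        finally show ?thesis using d[of m] d[of n] N[OF that] by simp
      qed
      then show "\<exists>N. \<forall>m\<ge>N. \<forall>n\<ge>N. hnorm M (W m l \<ominus> W n l) < e" by blast
    qed (use H W in auto)
    then show "l \<in> ?C" using H by simp
  qed auto
  moreover have "R l v \<in> ?C" if v: "v \<in> ?C" and l: "l = \<i> \<or> l = -\<i>" for l v
  proof -
    have l0: "Im l \<noteq> 0" using l by auto
    obtain a where a: "hlim M (\<lambda>n. W n v) a" using lim[OF v] by blast
    show ?thesis
      using res_lim[OF l0 a] v l0 by (intro inC[of _ "R l a"]) (auto simp: intertwiner.j_res[OF I])
  qed
  ultimately show ?thesis unfolding reducing_def by blast
qed

text \<open>The vectors that \<open>U\<close> sends into \<open>red_span Z\<close> form a reducing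
  subspace, a preimage of one; it contains \<open>Z\<close>, hence all of
  \<open>red_span Z\<close>.\<close>

lemma automorphism_image_red_span:
  assumes U: "automorphism M U" and Z: "Z \<subseteq> carrier M" "\<And>z. z \<in> Z \<Longrightarrow> U z \<in> Z"
    and x: "x \<in> red_span Z"
  shows "U x \<in> red_span Z"
proof -
  interpret U: intertwiner M "opgraph M" M "opgraph M" U by (rule automorphism_intertwiner[OF U])
  note P = reducing_red_span[OF Z(1)]
  have "reducing {x \<in> carrier M. U x \<in> red_span Z}"
    unfolding reducing_def
    using U.j_vimage_closed_subspace[OF reducing_closed_subspace[OF P]] reducing_res[OF P]
    by (auto simp: U.j_res)
  then have "red_span Z \<subseteq> {x \<in> carrier M. U x \<in> red_span Z}"
    by (rule red_span_minimal) (use Z red_span_superset in blast)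
  then show ?thesis using x by auto
qed

text \<open>On the reducing subspace generated by a precompact orbit, a sequence of automorphisms
  has a strongly convergent subsequence along which the inverses converge as well; the limit is
  extended by the identity.\<close>

lemma precompact_limit_automorphism:
  assumes G: "G \<subseteq> carrier M" and m: "m \<in> precompact G" and U: "\<And>n::nat. U n \<in> Aut_over M G"
  obtains r E where "strict_mono r" "E \<in> Aut_over M G" "hlim M (\<lambda>n. U (r n) m) (E m)"
proof -
  define Z where "Z = orbit G m"
  have mH: "m \<in> carrier M" by (rule precompact_in[OF m])
  have ZH: "Z \<subseteq> carrier M" unfolding Z_def by (rule orbit_sub[OF mH])
  have mZ: "m \<in> Z" unfolding Z_def using Aut_over_id[of G] by (intro image_eqI[of _ _ "\<lambda>x. x"]) auto
  have inZ: "V z \<in> Z" if V: "V \<in> Aut_over M G" and z: "z \<in> Z" for V z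
  proof -
    obtain W where W: "W \<in> Aut_over M G" "z = W m" using z unfolding Z_def by blast
    then show ?thesis
      unfolding Z_def using Aut_over_comp[OF V W(1)] by (intro image_eqI[of _ _ "\<lambda>x. V (W x)"]) simp_all
  qed
  have tb: "Met.mtotally_bounded Z"
    unfolding Z_def using m mtotally_bounded_orbit_iff[OF mH] by simp
  define U' where "U' n = ainv (U n)" for n
  have U': "U' n \<in> Aut_over M G" for n unfolding U'_def by (rule Aut_over_ainv[OF U G])
  have aut: "automorphism M (U n)" "automorphism M (U' n)" for n
    using U U' by (auto simp: Aut_over_def)
  have "\<exists>K. finite K \<and> K \<subseteq> Z \<and> Z \<subseteq> (\<Union>x\<in>K. Met.mball x (1 / (real k + 1)))" for k
    using tb unfolding Met.mtotally_bounded_def by simp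
  then obtain K where K: "\<And>k. finite (K k)" "\<And>k. K k \<subseteq> Z"
    "\<And>k. Z \<subseteq> (\<Union>x\<in>K k. Met.mball x (1 / (real k + 1)))"
    by metis
  \<comment> \<open>A countable dense subset of the orbit, assembled from finite nets with radii
    tending to 0.\<close>
  define D where "D = (\<Union>k. K k)"
  have "countable D" unfolding D_def using K(1) by (simp add: countable_finite)
  moreover have "D \<noteq> {}" using K(3)[of 0] mZ unfolding D_def by blast
  ultimately obtain d :: "nat \<Rightarrow> 'a" where d: "range d = D"
    using uncountable_def by metis
  have dZ: "d i \<in> Z" for i using d K(2) unfolding D_def by blast
  have sub: "\<exists>r. strict_mono r \<and> hcauchy M (\<lambda>n. f (r n))" if "\<And>n. f n \<in> Z" for f :: "nat \<Rightarrow> 'a"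
  proof -
    have "range f \<subseteq> Z" using that by auto
    then obtain r where "strict_mono r" "Met.MCauchy (f \<circ> r)"
      using tb unfolding Met.mtotally_bounded_sequentially by meson
    then show ?thesis by (auto simp: MCauchy_iff_hcauchy o_def)
  qed
  \<comment> \<open>The inverses are made to converge along the same subsequence; without them the
    limit would be an isometry that might fail to be onto.\<close>
  define P where "P i s \<longleftrightarrow> hcauchy M (\<lambda>n. U (s n) (d i)) \<and> hcauchy M (\<lambda>n. U' (s n) (d i))" for i and s :: "nat \<Rightarrow> nat"
  interpret subseqs P
  proof
    fix i and s :: "nat \<Rightarrow> nat"
    obtain r1 where r1: "strict_mono r1" "hcauchy M (\<lambda>n. U (s (r1 n)) (d i))"
      using sub[of "\<lambda>n. U (s n) (d i)"] inZ[OF U dZ] by blast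
    obtain r2 where r2: "strict_mono r2" "hcauchy M (\<lambda>n. U' (s (r1 (r2 n))) (d i))"
      using sub[of "\<lambda>n. U' (s (r1 n)) (d i)"] inZ[OF U' dZ] by blast
    have "P i (s \<circ> (r1 \<circ> r2))"
      using r2(2) hcauchy_subseq[OF r1(2) r2(1)] by (simp add: P_def o_def)
    then show "\<exists>r'. strict_mono r' \<and> P i (s \<circ> r')"
      using strict_mono_o[OF r1(1) r2(1)] by blast
  qed
  define r where "r = diagseq"
  have r: "strict_mono r" unfolding r_def by (rule subseq_diagseq)
  \<comment> \<open>The diagonal sequence is known to have property \<open>k\<close> only after the
    shift by \<open>Suc k\<close>, which \<open>hcauchy_shift\<close> undoes.\<close>
  have P: "P k (r \<circ> (+) (Suc k))" for k
    unfolding r_def by (rule diagseq_holds) (auto simp: P_def o_def intro: hcauchy_subseq)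
  define W where "W n = U (r n)" for n
  define W' where "W' n = U' (r n)" for n
  have W: "automorphism M (W n)" "automorphism M (W' n)" "W n \<in> Aut_over M G" "W' n \<in> Aut_over M G" for n
    by (auto simp: W_def W'_def aut U U')
  have WW': "W n (W' n x) = x" "W' n (W n x) = x" if "x \<in> carrier M" for n x
    using ainv_simps[OF aut(1) that] by (auto simp: W_def W'_def U'_def)
  have dH: "d i \<in> carrier M" for i using dZ ZH by auto
  have "hcauchy M (\<lambda>n. W n (d i))" "hcauchy M (\<lambda>n. W' n (d i))" for i
    using P[of i] hcauchy_shift[of "\<lambda>n. W n (d i)" "Suc i"] hcauchy_shift[of "\<lambda>n. W' n (d i)" "Suc i"]
      automorphism_in[OF W(1) dH] automorphism_in[OF W(2) dH]
    by (auto simp: P_def W_def W'_def o_def)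
  have red1: "reducing {v \<in> carrier M. hcauchy M (\<lambda>n. W n v)}"
    and red2: "reducing {v \<in> carrier M. hcauchy M (\<lambda>n. W' n v)}"
    by (rule reducing_convergence, rule W)+
  have dC: "D \<subseteq> {v \<in> carrier M. hcauchy M (\<lambda>n. W n v)} \<inter> {v \<in> carrier M. hcauchy M (\<lambda>n. W' n v)}"
    using \<open>\<And>i. hcauchy M (\<lambda>n. W n (d i))\<close> \<open>\<And>i. hcauchy M (\<lambda>n. W' n (d i))\<close> dH d by auto
  \<comment> \<open>Every orbit point is a limit of net points, so a reducing subspace containing
    \<open>D\<close> contains the whole orbit.\<close>
  have Zlim: "z \<in> S" if S: "reducing S" "D \<subseteq> S" and z: "z \<in> Z" for z S
  proof -
    have "\<exists>x\<in>K k. z \<in> Met.mball x (1 / (real k + 1))" for k using K(3)[of k] z by blast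
    then obtain x where x: "\<And>k. x k \<in> K k" "\<And>k. z \<in> Met.mball (x k) (1 / (real k + 1))" by metis
    have xS: "x k \<in> S" for k using x(1)[of k] S(2) unfolding D_def by blast
    have "hlim M x z"
    proof (rule hlimI_le)
      show "x k \<in> carrier M" for k using x(2)[of k] by simp
      show "z \<in> carrier M" using x(2)[of 0] by simp
      show "hnorm M (x k \<ominus> z) \<le> 1 / (real k + 1)" for k using x(2)[of k] by (auto simp: hdist_def)
      show "(\<lambda>k. 1 / (real k + 1)) \<longlonglongrightarrow> 0"
        using LIMSEQ_inverse_real_of_nat by (simp add: inverse_eq_divide add.commute)
    qed
    then show ?thesis
      using closed_subspaceD(6)[OF reducing_closed_subspace[OF S(1)], of x z] xS by simp
  qed
  define Y where "Y = red_span Z"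
  have Y: "reducing Y" unfolding Y_def by (rule reducing_red_span[OF ZH])
  note YC = closed_subspaceD[OF reducing_closed_subspace[OF Y]]
  have "Y \<subseteq> {v \<in> carrier M. hcauchy M (\<lambda>n. W n v)}"
    unfolding Y_def by (rule red_span_minimal[OF red1]) (use Zlim[OF red1] dC in blast)
  moreover have "Y \<subseteq> {v \<in> carrier M. hcauchy M (\<lambda>n. W' n v)}"
    unfolding Y_def by (rule red_span_minimal[OF red2]) (use Zlim[OF red2] dC in blast)
  ultimately have cauchy: "hcauchy M (\<lambda>n. W n v)" "hcauchy M (\<lambda>n. W' n v)" if "v \<in> Y" for v
    using that by blast+
  define V where "V v = (SOME l. hlim M (\<lambda>n. W n v) l)" for v
  define V' where "V' v = (SOME l. hlim M (\<lambda>n. W' n v) l)" for v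
  have V: "hlim M (\<lambda>n. W n v) (V v)" if "v \<in> Y" for v
    unfolding V_def by (rule hcauchy_convergent[OF cauchy(1)[OF that]]) (rule someI)
  have V': "hlim M (\<lambda>n. W' n v) (V' v)" if "v \<in> Y" for v
    unfolding V'_def by (rule hcauchy_convergent[OF cauchy(2)[OF that]]) (rule someI)
  have WY: "T x \<in> Y" if "T \<in> Aut_over M G" "x \<in> Y" for T x
    unfolding Y_def
    by (rule automorphism_image_red_span[OF _ ZH]) (use that inZ in \<open>auto simp: Aut_over_def Y_def\<close>)
  have YH: "x \<in> carrier M" if "x \<in> Y" for x using that YC(1) by auto
  have VY: "V x \<in> Y" "V' x \<in> Y" if "x \<in> Y" for x
    using YC(6)[OF WY[OF W(3) that] V[OF that]] YC(6)[OF WY[OF W(4) that] V'[OF that]] by auto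
  note I = automorphism_intertwiner[OF W(1)] and I' = automorphism_intertwiner[OF W(2)]
  \<comment> \<open>As \<open>W n\<close> is isometric with inverse \<open>W' n\<close>, the
    distance from \<open>W n (V' x)\<close> to \<open>x\<close> equals that from \<open>V' x\<close>
    to \<open>W' n x\<close>, which tends to 0; likewise with the roles exchanged.\<close>
  have lims: "V (V' x) = x" "V' (V x) = x" if x: "x \<in> Y" for x
  proof -
    have "hnorm M (W n (V' x) \<ominus> x) = hnorm M (W' n x \<ominus> V' x)" for n
    proof -
      have H: "V' x \<in> carrier M" "W' n x \<in> carrier M" "x \<in> carrier M"
        using VY[OF x] YH x W(2) by auto
      have "hnorm M (W n (V' x) \<ominus> x) = hnorm M (W n (V' x \<ominus> W' n x))"
        using H WW'(1) by (simp add: intertwiner.j_diff[OF I])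
      then show ?thesis using H intertwiner.j_hnorm[OF I, of "V' x \<ominus> W' n x"]
        by (simp add: hnorm_diff_commute)
    qed
    then have "hlim M (\<lambda>n. W n (V' x)) x"
      using V'[OF x] YH[OF x] YH[OF VY(2)[OF x]] W(1) by (auto simp: hlim_def)
    then show "V (V' x) = x" using hlim_unique V[OF VY(2)[OF x]] by blast
    have "hnorm M (W' n (V x) \<ominus> x) = hnorm M (W n x \<ominus> V x)" for n
    proof -
      have H: "V x \<in> carrier M" "W n x \<in> carrier M" "x \<in> carrier M"
        using VY[OF x] YH x W(1) by auto
      have "hnorm M (W' n (V x) \<ominus> x) = hnorm M (W' n (V x \<ominus> W n x))"
        using H WW'(2) by (simp add: intertwiner.j_diff[OF I'])
      then show ?thesis using H intertwiner.j_hnorm[OF I', of "V x \<ominus> W n x"]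
        by (simp add: hnorm_diff_commute)
    qed
    then have "hlim M (\<lambda>n. W' n (V x)) x"
      using V[OF x] YH[OF x] YH[OF VY(1)[OF x]] W(2) by (auto simp: hlim_def)
    then show "V' (V x) = x" using hlim_unique V'[OF VY(1)[OF x]] by blast
  qed
  define E where "E z = V (proj M Y z) \<oplus> (z \<ominus> proj M Y z)" for z
  note C = reducing_closed_subspace[OF Y]
  have "automorphism M E"
    unfolding E_def
  proof (rule automorphism_extension[OF Y VY lims])
    fix x y assume x: "x \<in> Y" and y: "y \<in> Y"
    have "hlim M (\<lambda>n. W n (x \<oplus> y)) (V x \<oplus> V y)"
      using hlim_add[OF V[OF x] V[OF y]] YH[OF x] YH[OF y] by (simp add: intertwiner.j_add[OF I])
    then show "V (x \<oplus> y) = V x \<oplus> V y" using hlim_unique V[OF YC(3)[OF x y]] by blast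
    have "(\<lambda>n. cinner M (W n x) (W n y)) \<longlonglongrightarrow> cinner M (V x) (V y)"
      by (rule hlim_cinner[OF V[OF x] V[OF y]])
    moreover have "(\<lambda>n. cinner M (W n x) (W n y)) = (\<lambda>n. cinner M x y)"
      using intertwiner.j_cinner[OF I YH[OF x] YH[OF y]] by auto
    ultimately show "cinner M (V x) (V y) = cinner M x y"
      using LIMSEQ_unique tendsto_const by metis
  next
    fix c x assume x: "x \<in> Y"
    have "hlim M (\<lambda>n. W n (c \<odot> x)) (c \<odot> V x)"
      using hlim_smult[OF V[OF x]] YH[OF x] by (simp add: intertwiner.j_smult[OF I])
    then show "V (c \<odot> x) = c \<odot> V x" using hlim_unique V[OF YC(4)[OF x]] by blast
  next
    fix x assume x: "x \<in> Y"
    have i: "Im \<i> \<noteq> 0" by simp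
    have "hlim M (\<lambda>n. W n (R \<i> x)) (R \<i> (V x))"
      using res_lim[OF i V[OF x]] YH[OF x] by (simp add: intertwiner.j_res[OF I i])
    moreover have "R \<i> x \<in> Y" using reducing_res[OF Y x] by simp
    ultimately show "V (R \<i> x) = R \<i> (V x)" using hlim_unique V by blast
  qed auto
  moreover have "E g = g" if g: "g \<in> G" for g
  proof -
    have gH: "g \<in> carrier M" using g G by auto
    let ?p = "proj M Y g"
    have pY: "?p \<in> Y" by (rule proj_mem[OF C gH])
    \<comment> \<open>Each \<open>W n\<close> fixes \<open>g\<close>, and it preserves
      \<open>Y\<close> together with its inverse, so it fixes the projection of \<open>g\<close>;
      the limit \<open>V\<close> then fixes it as well, and \<open>E\<close> fixes
      \<open>g\<close>.\<close>
    have "W n ?p = ?p" for n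
    proof (rule proj_eqI[OF C gH, symmetric])
      show "W n ?p \<in> Y" by (rule WY[OF W(3) pY])
      fix s assume s: "s \<in> Y"
      have a: "ainv (W n) \<in> Aut_over M G" by (rule Aut_over_ainv[OF W(3) G])
      have "cinner M (W n ?p) s = cinner M ?p (ainv (W n) s)"
        by (rule cinner_ainv'[OF W(1) YH[OF pY] YH[OF s], symmetric])
      also have "\<dots> = cinner M g (ainv (W n) s)"
        by (rule cinner_proj[OF C gH WY[OF a s]])
      also have "\<dots> = cinner M (W n g) s"
        by (rule cinner_ainv'[OF W(1) gH YH[OF s]])
      also have "W n g = g" using W(3)[of n] g by (simp add: Aut_over_def)
      finally show "cinner M (W n ?p) s = cinner M g s" .
    qed
    then have "V ?p = ?p" using hlim_unique[OF V[OF pY]] hlim_const[OF YH[OF pY]] by simp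
    then show ?thesis
      unfolding E_def using gH YH[OF pY] by (intro vec_eqI) auto
  qed
  ultimately have "E \<in> Aut_over M G" by (simp add: Aut_over_def)
  moreover have "m \<in> Y" using mZ red_span_superset[of Z] unfolding Y_def by blast
  then have "E m = V m"
    unfolding E_def using YH VY by (simp add: proj_ident[OF C])
  then have "hlim M (\<lambda>n. U (r n) m) (E m)" using V[OF \<open>m \<in> Y\<close>] by (simp add: W_def)
  ultimately show ?thesis using that r by blast
qed

text \<open>Compactness adds to total boundedness that sequences in the orbit have subsequential
  limits in the orbit; the automorphism over \<open>G\<close> from
  \<open>precompact_limit_automorphism\<close> provides them.\<close>

lemma acl_eq_precompact:
  assumes G: "G \<subseteq> carrier M"
  shows "acl M G = precompact G"
proof
  show "acl M G \<subseteq> precompact G"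
    using Met.compactin_imp_mtotally_bounded mtotally_bounded_orbit_iff by (auto simp: acl_def)
  show "precompact G \<subseteq> acl M G"
  proof
    fix m assume m: "m \<in> precompact G"
    have mH: "m \<in> carrier M" by (rule precompact_in[OF m])
    have "compactin (htopology M) (orbit G m)"
      unfolding Met.compactin_sequentially
    proof (intro conjI allI impI)
      show "orbit G m \<subseteq> carrier M" by (rule orbit_sub[OF mH])
      fix s :: "nat \<Rightarrow> 'a" assume s: "range s \<subseteq> orbit G m"
      have "\<forall>n. \<exists>U. U \<in> Aut_over M G \<and> s n = U m" using s by blast
      from choice[OF this] obtain U where U: "\<And>n. U n \<in> Aut_over M G" "\<And>n. s n = U n m" by blast
      obtain r E where rE: "strict_mono r" "E \<in> Aut_over M G" "hlim M (\<lambda>n. U (r n) m) (E m)"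
        using precompact_limit_automorphism[OF G m U(1)] .
      have "limitin (htopology M) (s \<circ> r) (E m) sequentially"
        using rE(3) limitin_iff_hlim[of "s \<circ> r"] hlimD(1)[OF rE(3)] by (simp add: o_def U(2))
      then show "\<exists>l r. l \<in> orbit G m \<and> strict_mono r \<and> limitin (htopology M) (s \<circ> r) l sequentially"
        using rE(1,2) by blast
    qed
    then show "m \<in> acl M G" using mH by (simp add: acl_def)
  qed
qed

lemma dcl_subset_acl: "dcl M G \<subseteq> acl M G"
proof
  fix m assume m: "m \<in> dcl M G"
  then have "orbit G m = {m}" using Aut_over_id[of G] by (force simp: dcl_def)
  then show "m \<in> acl M G" using m by (simp add: acl_def dcl_def)
qed

lemma res_dcl:
  assumes v: "v \<in> dcl M G" and l: "Im l \<noteq> 0"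
  shows "R l v \<in> dcl M G"
proof -
  have "v \<in> carrier M" using v by (simp add: dcl_def)
  then have "U (R l v) = R l v" if U: "U \<in> Aut_over M G" for U
    using intertwiner.j_res[OF Aut_over_intertwiner[OF U] l, of v] U v by (auto simp: dcl_def)
  then show ?thesis using v l by (simp add: dcl_def)
qed

end

section \<open>Points outside the essential spectrum\<close>

context complex_hilbert_space
begin

lemma linear_map_onD:
  assumes "linear_map_on H S"
  shows "x \<in> carrier H \<Longrightarrow> S x \<in> carrier H"
    and "x \<in> carrier H \<Longrightarrow> y \<in> carrier H \<Longrightarrow> S (x \<oplus> y) = S x \<oplus> S y"
    and "x \<in> carrier H \<Longrightarrow> S (c \<odot> x) = c \<odot> S x"
    and "x \<in> carrier H \<Longrightarrow> y \<in> carrier H \<Longrightarrow> S (x \<ominus> y) = S x \<ominus> S y"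
  using assms unfolding linear_map_on_def by (auto simp: diff_eq image_subset_iff)

lemma bounded_opD:
  assumes "bounded_op H S"
  obtains C where "C \<ge> 0" "\<And>x. x \<in> carrier H \<Longrightarrow> hnorm H (S x) \<le> C * hnorm H x"
proof -
  obtain C where C: "\<And>x. x \<in> carrier H \<Longrightarrow> hnorm H (S x) \<le> C * hnorm H x"
    using assms unfolding bounded_op_def by blast
  show ?thesis
  proof (rule that[of "\<bar>C\<bar>"])
    fix x assume x: "x \<in> carrier H"
    have "C * hnorm H x \<le> \<bar>C\<bar> * hnorm H x" using x by (intro mult_right_mono) auto
    then show "hnorm H (S x) \<le> \<bar>C\<bar> * hnorm H x" using C[OF x] by simp
  qed simp
qed

lemma compact_op_subseq:
  assumes K: "compact_op H K" and x: "\<And>n::nat. x n \<in> carrier H" "\<And>n. hnorm H (x n) \<le> 1"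
  obtains r where "strict_mono r" "hcauchy H (\<lambda>n. K (x (r n)))"
proof -
  let ?B = "K ` {x \<in> carrier H. hnorm H x \<le> 1}"
  have lin: "linear_map_on H K" using K by (simp add: compact_op_def bounded_op_def)
  have BH: "?B \<subseteq> carrier H" using linear_map_onD(1)[OF lin] by auto
  have "range (\<lambda>n. K (x n)) \<subseteq> htopology H closure_of ?B"
    using closure_of_subset[of ?B "htopology H"] BH x by auto
  moreover have "compactin (htopology H) (htopology H closure_of ?B)"
    using K by (simp add: compact_op_def)
  ultimately obtain l r where r: "strict_mono r" "limitin (htopology H) ((\<lambda>n. K (x n)) \<circ> r) l sequentially"
    unfolding Met.compactin_sequentially by meson
  then have "hlim H (\<lambda>n. K (x (r n))) l"
    using limitin_iff_hlim[of "\<lambda>n. K (x (r n))"] linear_map_onD(1)[OF lin] x(1) by (simp add: o_def)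
  then show ?thesis using that r(1) hlim_imp_hcauchy by blast
qed

text \<open>In a complete space a totally bounded set has compact closure. Together with
  \<open>compact_op_subseq\<close> this reduces compactness of operators to extracting Cauchy
  subsequences on the unit ball.\<close>

lemma compact_opI:
  assumes K: "bounded_op H K"
    and seq: "\<And>x. (\<And>n::nat. x n \<in> carrier H) \<Longrightarrow> (\<And>n. hnorm H (x n) \<le> 1) \<Longrightarrow>
      \<exists>r. strict_mono r \<and> hcauchy H (\<lambda>n. K (x (r n)))"
  shows "compact_op H K"
proof -
  let ?B = "K ` {x \<in> carrier H. hnorm H x \<le> 1}"
  have lin: "linear_map_on H K" using K by (simp add: bounded_op_def)
  have BH: "?B \<subseteq> carrier H" using linear_map_onD(1)[OF lin] by auto
  have "Met.mtotally_bounded ?B"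
    unfolding Met.mtotally_bounded_sequentially
  proof (intro conjI allI impI BH)
    fix s :: "nat \<Rightarrow> 'a" assume s: "range s \<subseteq> ?B"
    have "\<forall>n. \<exists>x. x \<in> carrier H \<and> hnorm H x \<le> 1 \<and> s n = K x" using s by blast
    from choice[OF this] obtain x where x: "\<And>n. x n \<in> carrier H" "\<And>n. hnorm H (x n) \<le> 1"
      "\<And>n. s n = K (x n)" by blast
    then show "\<exists>r. strict_mono r \<and> Met.MCauchy (s \<circ> r)"
      using seq[OF x(1,2)] by (simp add: MCauchy_iff_hcauchy o_def x(3))
  qed
  then have "compactin (htopology H) (htopology H closure_of ?B)"
    using Met.mtotally_bounded_eq_compact_closure_of[OF complete] by blast
  then show ?thesis using K by (simp add: compact_op_def)
qed

end

section \<open>Spectrum, essential spectrum and approximate inverses\<close>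

context selfadjoint_space
begin

lemma shift_graph_iff:
  assumes "x \<in> carrier H" "z \<in> carrier H"
  shows "(x, z) \<in> shift_graph H Q l \<longleftrightarrow> (x, z \<oplus> l \<odot> x) \<in> Q"
proof
  assume "(x, z) \<in> shift_graph H Q l"
  then obtain y where y: "(x, y) \<in> Q" "z = y \<ominus> l \<odot> x" by (auto simp: shift_graph_def)
  then have "z \<oplus> l \<odot> x = y" using Q_in[OF y(1)] by (intro vec_eqI) auto
  then show "(x, z \<oplus> l \<odot> x) \<in> Q" using y by simp
next
  assume "(x, z \<oplus> l \<odot> x) \<in> Q"
  moreover have "(z \<oplus> l \<odot> x) \<ominus> l \<odot> x = z" using assms by (intro vec_eqI) auto
  ultimately show "(x, z) \<in> shift_graph H Q l"
    unfolding shift_graph_def by (intro image_eqI[of _ _ "(x, z \<oplus> l \<odot> x)"]) auto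
qed

lemma ess_spectrum_iff:
  "l \<notin> ess_spectrum H Q \<longleftrightarrow> (\<exists>S K. bounded_op H S \<and> compact_op H K \<and>
    (\<forall>v\<in>carrier H. (S v, (v \<oplus> K v) \<oplus> l \<odot> S v) \<in> Q))"
proof -
  have eq: "(S v, v \<oplus> K v) \<in> shift_graph H Q l \<longleftrightarrow> (S v, (v \<oplus> K v) \<oplus> l \<odot> S v) \<in> Q"
    if "bounded_op H S" "compact_op H K" "v \<in> carrier H" for S K v
    using that linear_map_onD(1) by (intro shift_graph_iff) (auto simp: bounded_op_def compact_op_def)
  show ?thesis
    unfolding ess_spectrum_def mem_Collect_eq not_not
    by (intro ex_cong1 conj_cong ball_cong refl) (rule eq)
qed

lemma spectrum_iff:
  "l \<notin> spectrum H Q \<longleftrightarrow> (\<exists>S. bounded_op H S \<and>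
    (\<forall>v\<in>carrier H. (S v, v \<oplus> l \<odot> S v) \<in> Q) \<and> (\<forall>(x, y)\<in>Q. S (y \<ominus> l \<odot> x) = x))"
proof -
  have eq: "(S v, v) \<in> shift_graph H Q l \<longleftrightarrow> (S v, v \<oplus> l \<odot> S v) \<in> Q"
    if "bounded_op H S" "v \<in> carrier H" for S v
    using that linear_map_onD(1) by (intro shift_graph_iff) (auto simp: bounded_op_def)
  have eq': "(\<forall>(x, y)\<in>shift_graph H Q l. S y = x) \<longleftrightarrow> (\<forall>(x, y)\<in>Q. S (y \<ominus> l \<odot> x) = x)" for S
    by (auto simp: shift_graph_def)
  show ?thesis
    unfolding spectrum_def mem_Collect_eq not_not
    by (intro ex_cong1 conj_cong eq') (auto simp: eq)
qed

lemma bounded_op_zero: "bounded_op H (\<lambda>x. \<zero>)"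
  unfolding bounded_op_def linear_map_on_def by (auto intro!: exI[of _ 0])

lemma compact_op_zero: "compact_op H (\<lambda>x. \<zero>)"
  by (rule compact_opI[OF bounded_op_zero])
    (auto intro!: exI[of _ "\<lambda>n. n"] hlim_imp_hcauchy[OF hlim_const] simp: strict_mono_def)

lemma ess_spectrum_subset_spectrum: "ess_spectrum H Q \<subseteq> spectrum H Q"
proof -
  have "l \<notin> ess_spectrum H Q" if l: "l \<notin> spectrum H Q" for l
  proof -
    obtain S where S: "bounded_op H S" "\<forall>v\<in>carrier H. (S v, v \<oplus> l \<odot> S v) \<in> Q"
      using l unfolding spectrum_iff by blast
    show ?thesis
      unfolding ess_spectrum_iff
      by (rule exI[of _ S], rule exI[of _ "\<lambda>x. \<zero>"]) (use S compact_op_zero in auto)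
  qed
  then show ?thesis by blast
qed

text \<open>The lower bound and the trivial kernel at \<open>cnj l\<close> make \<open>Q - l\<close>
  onto; the lower bound also makes preimages unique, whence the chosen inverse is linear, and bounds
  it by \<open>1 / c\<close>.\<close>

lemma not_in_spectrumI:
  assumes c: "c > 0" and bb: "\<And>x y. (x, y) \<in> Q \<Longrightarrow> c * hnorm H x \<le> hnorm H (y \<ominus> l \<odot> x)"
    and inj: "\<And>x. (x, cnj l \<odot> x) \<in> Q \<Longrightarrow> x = \<zero>"
  shows "l \<notin> spectrum H Q"
proof -
  have "\<forall>v. \<exists>u. v \<in> carrier H \<longrightarrow> (u, v \<oplus> l \<odot> u) \<in> Q"
    using bounded_below_imp_onto[OF c bb inj] by blast
  from choice[OF this] obtain S where S: "\<And>v. v \<in> carrier H \<Longrightarrow> (S v, v \<oplus> l \<odot> S v) \<in> Q" by blast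
  have SH: "S v \<in> carrier H" if "v \<in> carrier H" for v using Q_in(1)[OF S[OF that]] .
  have uniq: "u = u'" if u: "(u, v \<oplus> l \<odot> u) \<in> Q" "(u', v \<oplus> l \<odot> u') \<in> Q" and v: "v \<in> carrier H" for u u' v
  proof -
    have H: "u \<in> carrier H" "u' \<in> carrier H" using u Q_in by auto
    have "((v \<oplus> l \<odot> u) \<ominus> (v \<oplus> l \<odot> u')) \<ominus> l \<odot> (u \<ominus> u') = \<zero>"
      using H v by (intro vec_eqI) (auto simp: algebra_simps)
    then have "c * hnorm H (u \<ominus> u') \<le> 0" using bb[OF Q_diff[OF u]] by simp
    then have "hnorm H (u \<ominus> u') \<le> 0" using c by (auto simp: mult_le_0_iff)
    then have "hnorm H (u \<ominus> u') = 0" using hnorm_ge_0[OF diff_in[OF H]] by linarith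
    then show ?thesis using H by (simp add: hnorm_eq_0_iff diff_eq_zero_iff)
  qed
  have "linear_map_on H S"
    unfolding linear_map_on_def
  proof (intro conjI ballI allI)
    show "S ` carrier H \<subseteq> carrier H" using SH by auto
    fix x assume x: "x \<in> carrier H"
    show "S (x \<oplus> y) = S x \<oplus> S y" if y: "y \<in> carrier H" for y
    proof (rule uniq[OF S])
      have "(x \<oplus> y) \<oplus> l \<odot> (S x \<oplus> S y) = (x \<oplus> l \<odot> S x) \<oplus> (y \<oplus> l \<odot> S y)"
        using x y SH by (intro vec_eqI) (auto simp: algebra_simps)
      then show "(S x \<oplus> S y, (x \<oplus> y) \<oplus> l \<odot> (S x \<oplus> S y)) \<in> Q"
        using Q_add[OF S[OF x] S[OF y]] by simp
    qed (use x y in auto)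
    show "S (k \<odot> x) = k \<odot> S x" for k
    proof (rule uniq[OF S])
      have "(k \<odot> x) \<oplus> l \<odot> (k \<odot> S x) = k \<odot> (x \<oplus> l \<odot> S x)"
        using x SH by (intro vec_eqI) (auto simp: algebra_simps)
      then show "(k \<odot> S x, (k \<odot> x) \<oplus> l \<odot> (k \<odot> S x)) \<in> Q"
        using Q_smult[OF S[OF x]] by simp
    qed (use x in auto)
  qed
  moreover have "hnorm H (S x) \<le> 1 / c * hnorm H x" if x: "x \<in> carrier H" for x
  proof -
    have "(x \<oplus> l \<odot> S x) \<ominus> l \<odot> S x = x" using x SH by (intro vec_eqI) auto
    then show ?thesis using bb[OF S[OF x]] c by (simp add: field_simps)
  qed
  ultimately have "bounded_op H S" unfolding bounded_op_def by blast
  moreover have "S (y \<ominus> l \<odot> x) = x" if xy: "(x, y) \<in> Q" for x y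
  proof (rule uniq[OF S])
    have "(y \<ominus> l \<odot> x) \<oplus> l \<odot> x = y" using Q_in[OF xy] by (intro vec_eqI) auto
    then show "(x, (y \<ominus> l \<odot> x) \<oplus> l \<odot> x) \<in> Q" using xy by simp
  qed (use Q_in[OF xy] in auto)
  ultimately show ?thesis unfolding spectrum_iff using S by blast
qed

lemma not_in_spectrum_nonreal:
  assumes "Im l \<noteq> 0"
  shows "l \<notin> spectrum H Q"
proof (rule not_in_spectrumI)
  show "\<bar>Im l\<bar> > 0" using assms by simp
  show "x = \<zero>" if "(x, cnj l \<odot> x) \<in> Q" for x using nonreal_eigen_zero[OF that] assms by simp
qed (rule Im_bound)

text \<open>A right inverse modulo compacts acts as a left one by self-adjointness: for real
  \<open>l\<close>, the squared norm of \<open>x\<close> plus the inner product of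
  \<open>K x\<close> with \<open>x\<close> equals the inner product of \<open>S x\<close> with
  \<open>y - l x\<close>. Cauchy-Schwarz and division by the norm of \<open>x\<close>
  finish.\<close>

lemma parametrix_estimate:
  assumes l: "Im l = 0" and SK: "\<And>v. v \<in> carrier H \<Longrightarrow> (S v, (v \<oplus> K v) \<oplus> l \<odot> S v) \<in> Q"
    and C: "hnorm H (S x) \<le> C * hnorm H x"
    and Kx: "K x \<in> carrier H" and xy: "(x, y) \<in> Q"
  shows "hnorm H x \<le> hnorm H (K x) + C * hnorm H (y \<ominus> l \<odot> x)"
proof -
  note H = Q_in[OF xy]
  have SH: "S x \<in> carrier H" using Q_in(1)[OF SK[OF H(1)]] .
  have cl: "cnj l = l" using l by (simp add: complex_eq_iff)
  have "cinner H ((x \<oplus> K x) \<oplus> l \<odot> S x) x = cinner H (S x) y"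
    by (rule Q_sym[OF SK[OF H(1)] xy])
  then have "cinner H x x + cinner H (K x) x = cinner H (S x) (y \<ominus> l \<odot> x)"
    using H SH Kx by (simp add: cl algebra_simps)
  then have "(hnorm H x)\<^sup>2 = Re (cinner H (S x) (y \<ominus> l \<odot> x) - cinner H (K x) x)"
    using H by (simp only: hnorm_sq) (simp add: complex_eq_iff)
  also have "\<dots> \<le> cmod (cinner H (S x) (y \<ominus> l \<odot> x) - cinner H (K x) x)"
    by (rule complex_Re_le_cmod)
  also have "\<dots> \<le> cmod (cinner H (S x) (y \<ominus> l \<odot> x)) + cmod (cinner H (K x) x)"
    by (rule norm_triangle_ineq4)
  also have "\<dots> \<le> hnorm H (S x) * hnorm H (y \<ominus> l \<odot> x) + hnorm H (K x) * hnorm H x"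
    using H SH Kx by (intro add_mono Cauchy_Schwarz) auto
  also have "\<dots> \<le> C * hnorm H x * hnorm H (y \<ominus> l \<odot> x) + hnorm H (K x) * hnorm H x"
    using C H by (intro add_right_mono mult_right_mono) auto
  finally have "hnorm H x * hnorm H x \<le> (hnorm H (K x) + C * hnorm H (y \<ominus> l \<odot> x)) * hnorm H x"
    by (simp add: power2_eq_square algebra_simps)
  then show ?thesis
  proof (cases "hnorm H x = 0")
    case True
    have "0 \<le> C * hnorm H x" using C SH hnorm_ge_0[OF SH] by linarith
    have x0: "x = \<zero>" using True H by (simp add: hnorm_eq_0_iff)
    then have "y = \<zero>" using Q_unique[OF _ Q_zero] xy by blast
    then show ?thesis using True x0 Kx by simp
  next
    case False
    moreover have "0 \<le> hnorm H x" using H by simp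
    ultimately show ?thesis
      using \<open>hnorm H x * hnorm H x \<le> _\<close> by (simp add: mult_le_cancel_right)
  qed
qed

text \<open>Otherwise there are unit vectors \<open>x n\<close> in \<open>X\<close> with
  \<open>y n - l x n\<close> tending to 0. Along a subsequence on which \<open>K (x n)\<close> is
  Cauchy, the estimate makes \<open>x n\<close> Cauchy, and the limit is a unit eigenvector in
  \<open>X\<close>.\<close>

lemma bounded_below_off_kernel:
  assumes l: "Im l = 0" "l \<notin> ess_spectrum H Q" and X: "closed_subspace H X"
    and ker: "\<And>x. x \<in> X \<Longrightarrow> (x, l \<odot> x) \<in> Q \<Longrightarrow> x = \<zero>"
  obtains c where "c > 0" "\<And>x y. (x, y) \<in> Q \<Longrightarrow> x \<in> X \<Longrightarrow> c * hnorm H x \<le> hnorm H (y \<ominus> l \<odot> x)"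
proof -
  obtain S K where S: "bounded_op H S" and K: "compact_op H K"
    and SK: "\<And>v. v \<in> carrier H \<Longrightarrow> (S v, (v \<oplus> K v) \<oplus> l \<odot> S v) \<in> Q"
    using l(2) unfolding ess_spectrum_iff by blast
  obtain C where C: "C \<ge> 0" "\<And>x. x \<in> carrier H \<Longrightarrow> hnorm H (S x) \<le> C * hnorm H x"
    using bounded_opD[OF S] by blast
  have Klin: "linear_map_on H K" using K by (simp add: compact_op_def bounded_op_def)
  note KH = linear_map_onD(1)[OF Klin]
  have False if no: "\<And>c. c > 0 \<Longrightarrow> \<exists>x y. (x, y) \<in> Q \<and> x \<in> X \<and> \<not> c * hnorm H x \<le> hnorm H (y \<ominus> l \<odot> x)"
  proof -
    have "\<exists>x y. (x, y) \<in> Q \<and> x \<in> X \<and> hnorm H x = 1 \<and> hnorm H (y \<ominus> l \<odot> x) \<le> 1 / (real n + 1)" for n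
    proof -
      obtain x y where xy: "(x, y) \<in> Q" "x \<in> X" "hnorm H (y \<ominus> l \<odot> x) < 1 / (real n + 1) * hnorm H x"
        using no[of "1 / (real n + 1)"] by force
      note H = Q_in[OF xy(1)]
      have "0 \<le> hnorm H (y \<ominus> l \<odot> x)" using H by simp
      then have pos: "hnorm H x > 0"
        using xy(3) hnorm_ge_0[OF H(1)] by (cases "hnorm H x = 0") auto
      define k where "k = complex_of_real (1 / hnorm H x)"
      have km: "cmod k = 1 / hnorm H x" using pos by (simp add: k_def norm_divide)
      have "(k \<odot> y) \<ominus> l \<odot> (k \<odot> x) = k \<odot> (y \<ominus> l \<odot> x)"
        using H by (intro vec_eqI) (auto simp: algebra_simps)
      then have "hnorm H ((k \<odot> y) \<ominus> l \<odot> (k \<odot> x)) = hnorm H (y \<ominus> l \<odot> x) / hnorm H x"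
        using H by (simp only: hnorm_smult diff_in smult_in km) simp
      also have "\<dots> \<le> 1 / (real n + 1)" using xy(3) pos by (simp add: field_simps)
      finally show ?thesis
        using Q_smult[OF xy(1), of k] closed_subspaceD(4)[OF X xy(2), of k] pos H km
        by (intro exI[of _ "k \<odot> x"] exI[of _ "k \<odot> y"]) simp
    qed
    then obtain x y where xy: "\<And>n. (x n, y n) \<in> Q" "\<And>n. x n \<in> X" "\<And>n. hnorm H (x n) = 1"
      "\<And>n. hnorm H (y n \<ominus> l \<odot> x n) \<le> 1 / (real n + 1)"
      by metis
    note H = Q_in[OF xy(1)]
    obtain r where r: "strict_mono r" "hcauchy H (\<lambda>n. K (x (r n)))"
      using compact_op_subseq[OF K, of x] H xy(3) by (metis order_refl)
    define z where "z n = y (r n) \<ominus> l \<odot> x (r n)" for n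
    have zH: "z n \<in> carrier H" for n using H by (simp add: z_def)
    have "hlim H (\<lambda>n. y n \<ominus> l \<odot> x n) \<zero>"
    proof (rule hlimI_le)
      show "hnorm H ((y n \<ominus> l \<odot> x n) \<ominus> \<zero>) \<le> 1 / (real n + 1)" for n using xy(4)[of n] H by simp
      show "(\<lambda>k. 1 / (real k + 1)) \<longlonglongrightarrow> 0"
        using LIMSEQ_inverse_real_of_nat by (simp add: inverse_eq_divide add.commute)
    qed (use H in auto)
    then have z0: "hlim H z \<zero>" unfolding z_def by (rule hlim_subseq[OF _ r(1)])
    have est: "hnorm H (x (r p) \<ominus> x (r q)) \<le> hnorm H (K (x (r p)) \<ominus> K (x (r q))) + C * hnorm H (z p \<ominus> z q)" for p q
    proof -
      have e: "(y (r p) \<ominus> y (r q)) \<ominus> l \<odot> (x (r p) \<ominus> x (r q)) = z p \<ominus> z q"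
        using H by (intro vec_eqI) (auto simp: z_def algebra_simps)
      show ?thesis
        using parametrix_estimate[OF l(1) SK _ _ Q_diff[OF xy(1)[of "r p"] xy(1)[of "r q"]], where C = C] C(2) KH H
        unfolding e by (simp add: linear_map_onD(4)[OF Klin])
    qed
    have "hcauchy H (\<lambda>n. x (r n))"
      unfolding hcauchy_def
    proof (intro conjI allI impI)
      fix e :: real assume e: "e > 0"
      obtain N where N: "\<And>m n. m \<ge> N \<Longrightarrow> n \<ge> N \<Longrightarrow> hnorm H (K (x (r m)) \<ominus> K (x (r n))) < e / 2"
        using r(2) e unfolding hcauchy_def by (meson half_gt_zero)
      \<comment> \<open>\<open>C + 1\<close> in place of \<open>C\<close> keeps the divisor positive
        when \<open>C = 0\<close>.\<close>
      have "e / (2 * (C + 1)) > 0" using e C(1) by simp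
      then obtain N' where N': "\<And>m n. m \<ge> N' \<Longrightarrow> n \<ge> N' \<Longrightarrow> hnorm H (z m \<ominus> z n) < e / (2 * (C + 1))"
        using hlim_imp_hcauchy[OF z0] unfolding hcauchy_def by meson
      have "hnorm H (x (r p) \<ominus> x (r q)) < e" if "p \<ge> max N N'" "q \<ge> max N N'" for p q
      proof -
        have "C * hnorm H (z p \<ominus> z q) \<le> (C + 1) * hnorm H (z p \<ominus> z q)"
          using zH by (intro mult_right_mono) auto
        also have "\<dots> < e / 2" using N'[of p q] that C(1) by (simp add: field_simps)
        finally show ?thesis using est[of p q] N[of p q] that by simp
      qed
      then show "\<exists>N. \<forall>m\<ge>N. \<forall>n\<ge>N. hnorm H (x (r m) \<ominus> x (r n)) < e" by blast
    qed (rule H)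
    then obtain u where u: "hlim H (\<lambda>n. x (r n)) u" by (rule hcauchy_convergent)
    have uX: "u \<in> X" by (rule closed_subspaceD(6)[OF X xy(2) u])
    have "hlim H (\<lambda>n. z n \<oplus> l \<odot> x (r n)) (\<zero> \<oplus> l \<odot> u)"
      by (intro hlim_add hlim_smult z0 u)
    moreover have "z n \<oplus> l \<odot> x (r n) = y (r n)" for n
      using H by (intro vec_eqI) (auto simp: z_def)
    moreover have uH: "u \<in> carrier H" by (rule hlimD(2)[OF u])
    ultimately have "(u, l \<odot> u) \<in> Q" using Q_lim[OF xy(1) u] by simp
    then have "u = \<zero>" using ker uX by blast
    moreover have "hnorm H u = 1"
      using LIMSEQ_unique[OF hlim_hnorm[OF u]] xy(3) by simp
    ultimately show False by simp
  qed
  then show ?thesis using that by meson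
qed

text \<open>Nonreal points are never in the spectrum. At real ones the lower bound off the kernel,
  restricted to \<open>X\<close>, meets the criterion, since \<open>l\<close> is its own
  conjugate.\<close>

lemma reducing_not_in_spectrum:
  assumes l: "l \<notin> ess_spectrum H Q" and X: "reducing X"
    and ker: "\<And>x. Im l = 0 \<Longrightarrow> x \<in> X \<Longrightarrow> (x, l \<odot> x) \<in> Q \<Longrightarrow> x = \<zero>"
  shows "l \<notin> spectrum (H\<lparr>carrier := X\<rparr>) (Q \<inter> X \<times> X)"
proof -
  note C = reducing_closed_subspace[OF X]
  interpret S: selfadjoint_space "H\<lparr>carrier := X\<rparr>" "Q \<inter> X \<times> X"
    by (rule selfadjoint_subspace[OF X])
  have hn: "hnorm (H\<lparr>carrier := X\<rparr>) x = hnorm H x" for x by (simp add: hnorm_def)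
  show ?thesis
  proof (cases "Im l = 0")
    case False
    then show ?thesis by (rule S.not_in_spectrum_nonreal)
  next
    case True
    have cl: "cnj l = l" using True by (simp add: complex_eq_iff)
    obtain c where c: "c > 0" "\<And>x y. (x, y) \<in> Q \<Longrightarrow> x \<in> X \<Longrightarrow> c * hnorm H x \<le> hnorm H (y \<ominus> l \<odot> x)"
      using bounded_below_off_kernel[OF True l C ker[OF True]] by blast
    show ?thesis
    proof (rule S.not_in_spectrumI[OF c(1)])
      show "c * hnorm (H\<lparr>carrier := X\<rparr>) x
          \<le> hnorm (H\<lparr>carrier := X\<rparr>) (y \<ominus>\<^bsub>H\<lparr>carrier := X\<rparr>\<^esub> l \<odot>\<^bsub>H\<lparr>carrier := X\<rparr>\<^esub> x)"
        if "(x, y) \<in> Q \<inter> X \<times> X" for x y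
        using that c(2) closed_subspaceD(4)[OF C] by (simp add: hn diff_subspace[OF C])
      show "x = \<zero>\<^bsub>H\<lparr>carrier := X\<rparr>\<^esub>"
        if "(x, cnj l \<odot>\<^bsub>H\<lparr>carrier := X\<rparr>\<^esub> x) \<in> Q \<inter> X \<times> X" for x
        using that ker[OF True] by (simp add: cl)
    qed
  qed
qed

end

text \<open>Automorphisms preserve the eigenspace, where the estimate bounds the norm of
  \<open>x\<close> by that of \<open>K x\<close>. Compactness of \<open>K\<close> thus yields Cauchy
  subsequences in the orbit; finite dimensionality of the eigenspace stays implicit.\<close>

lemma (in op_space) eigenvector_precompact:
  assumes l: "Im l = 0" "l \<notin> ess_spectrum M (opgraph M)" and w: "(w, l \<odot> w) \<in> opgraph M"
  shows "w \<in> precompact {}"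
proof -
  obtain S K where S: "bounded_op M S" and K: "compact_op M K"
    and SK: "\<And>v. v \<in> carrier M \<Longrightarrow> (S v, (v \<oplus> K v) \<oplus> l \<odot> S v) \<in> opgraph M"
    using l(2) unfolding ess_spectrum_iff by blast
  obtain C where C: "C \<ge> 0" "\<And>x. x \<in> carrier M \<Longrightarrow> hnorm M (S x) \<le> C * hnorm M x"
    using bounded_opD[OF S] by blast
  have Klin: "linear_map_on M K" using K by (simp add: compact_op_def bounded_op_def)
  note KH = linear_map_onD(1)[OF Klin]
  have unit: "w \<in> precompact {}" if w: "(w, l \<odot> w) \<in> opgraph M" and n1: "hnorm M w \<le> 1" for w
  proof -
    have wH: "w \<in> carrier M" by (rule Q_in(1)[OF w])
    have "Met.mtotally_bounded (orbit {} w)"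
      unfolding Met.mtotally_bounded_sequentially
    proof (intro conjI allI impI)
      show "orbit {} w \<subseteq> carrier M" by (rule orbit_sub[OF wH])
      fix s :: "nat \<Rightarrow> 'a" assume s: "range s \<subseteq> orbit {} w"
      have "\<forall>n. \<exists>U. U \<in> Aut_over M {} \<and> s n = U w" using s by blast
      from choice[OF this] obtain U where U: "\<And>n. U n \<in> Aut_over M {}" "\<And>n. s n = U n w" by blast
      note I = Aut_over_intertwiner[OF U(1)]
      have sQ: "(s n, l \<odot> s n) \<in> opgraph M" for n
        using intertwiner.j_Q[OF I w] intertwiner.j_smult[OF I wH] by (simp add: U(2))
      note sH = Q_in(1)[OF sQ]
      have sn: "hnorm M (s n) \<le> 1" for n using intertwiner.j_hnorm[OF I wH] n1 by (simp add: U(2))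
      obtain r where r: "strict_mono r" "hcauchy M (\<lambda>n. K (s (r n)))"
        using compact_op_subseq[of K s, OF K sH sn] .
      have est: "hnorm M (s p \<ominus> s q) \<le> hnorm M (K (s p) \<ominus> K (s q))" for p q
      proof -
        have e: "(l \<odot> s p \<ominus> l \<odot> s q) \<ominus> l \<odot> (s p \<ominus> s q) = \<zero>"
          using sH by (intro vec_eqI) (auto simp: algebra_simps)
        show ?thesis
          using parametrix_estimate[OF l(1) SK _ _ Q_diff[OF sQ[of p] sQ[of q]], where C = C] C(2) KH sH
          unfolding e by (simp add: linear_map_onD(4)[OF Klin])
      qed
      have "hcauchy M (\<lambda>n. s (r n))"
        by (rule hcauchyI_le[OF r(2) sH est])
      then show "\<exists>r. strict_mono r \<and> Met.MCauchy (s \<circ> r)"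
        using r(1) by (auto simp: MCauchy_iff_hcauchy o_def)
    qed
    then show ?thesis using mtotally_bounded_orbit_iff[OF wH] by simp
  qed
  have wH: "w \<in> carrier M" by (rule Q_in(1)[OF w])
  \<comment> \<open>Compactness is stated on the unit ball, so \<open>w\<close> is rescaled into it;
    the summand 1 avoids division by zero for \<open>w = \<zero>\<close>.\<close>
  define k where "k = complex_of_real (1 / (hnorm M w + 1))"
  have pos: "hnorm M w + 1 > 0" using hnorm_ge_0[OF wH] by linarith
  have "l \<odot> (k \<odot> w) = k \<odot> (l \<odot> w)" using wH by (simp add: mult.commute)
  then have kQ: "(k \<odot> w, l \<odot> (k \<odot> w)) \<in> opgraph M" using Q_smult[OF w, of k] by simp
  have km: "cmod k = 1 / (hnorm M w + 1)"
    unfolding k_def using pos by (simp only: norm_of_real)  simp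
  then have k0: "k \<noteq> 0" using pos by auto
  have "hnorm M (k \<odot> w) \<le> 1" using wH pos km norm_ge_zero[of k] by (simp add: field_simps del: norm_ge_zero)
  then have "k \<odot> w \<in> precompact {}" by (rule unit[OF kQ])
  then have "(1 / k) \<odot> (k \<odot> w) \<in> precompact {}"
    by (rule closed_subspaceD(4)[OF reducing_closed_subspace[OF reducing_precompact]])
  then show ?thesis using wH k0 by simp
qed

section \<open>Spectral data along intertwiners\<close>

context intertwiner
begin

lemma hcauchy_jadj:
  assumes f: "hcauchy B f"
  shows "hcauchy A (\<lambda>n. jadj (f n))"
proof (rule A.hcauchyI_le[OF f])
  note fB = B.hcauchyD[OF f]
  show "jadj (f n) \<in> carrier A" for n using fB by simp
  show "hnorm A (jadj (f m) \<ominus>\<^bsub>A\<^esub> jadj (f n)) \<le> hnorm B (f m \<ominus>\<^bsub>B\<^esub> f n)" for m n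
    using jadj_hnorm[of "f m \<ominus>\<^bsub>B\<^esub> f n"] fB by (simp add: jadj_diff)
qed

lemma bounded_op_compress:
  assumes S: "bounded_op B S"
  shows "bounded_op A (\<lambda>x. jadj (S (j x)))"
proof -
  have lin: "linear_map_on B S" using S by (simp add: bounded_op_def)
  note L = B.linear_map_onD[OF lin]
  obtain C where C: "C \<ge> 0" "\<And>x. x \<in> carrier B \<Longrightarrow> hnorm B (S x) \<le> C * hnorm B x"
    using B.bounded_opD[OF S] by blast
  have "hnorm A (jadj (S (j x))) \<le> C * hnorm A x" if x: "x \<in> carrier A" for x
    using jadj_hnorm[of "S (j x)"] C(2)[of "j x"] x L(1) by simp
  then show ?thesis
    unfolding bounded_op_def linear_map_on_def
    by (auto simp: L j_add j_smult jadj_add jadj_smult)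
qed

text \<open>The inverse on \<open>B\<close> is compressed to \<open>A\<close>: both \<open>j\<close>
  and \<open>jadj\<close> respect the graphs, so \<open>jadj\<close> after \<open>S\<close> after
  \<open>j\<close> is the inverse sought.\<close>

lemma spectrum_mono: "spectrum A QA \<subseteq> spectrum B QB"
proof -
  have "l \<notin> spectrum A QA" if l: "l \<notin> spectrum B QB" for l
  proof -
    obtain S where S: "bounded_op B S" "\<And>v. v \<in> carrier B \<Longrightarrow> (S v, v \<oplus>\<^bsub>B\<^esub> l \<odot>\<^bsub>B\<^esub> S v) \<in> QB"
      "\<And>x y. (x, y) \<in> QB \<Longrightarrow> S (y \<ominus>\<^bsub>B\<^esub> l \<odot>\<^bsub>B\<^esub> x) = x"
      using l unfolding B.spectrum_iff by blast
    have SH: "S v \<in> carrier B" if "v \<in> carrier B" for v using B.Q_in(1)[OF S(2)[OF that]] .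
    show ?thesis
      unfolding A.spectrum_iff
    proof (intro exI[of _ "\<lambda>x. jadj (S (j x))"] conjI ballI)
      show "bounded_op A (\<lambda>x. jadj (S (j x)))" by (rule bounded_op_compress[OF S(1)])
      show "(jadj (S (j v)), v \<oplus>\<^bsub>A\<^esub> l \<odot>\<^bsub>A\<^esub> jadj (S (j v))) \<in> QA" if "v \<in> carrier A" for v
        using jadj_Q[OF S(2)[of "j v"]] that SH by (simp add: jadj_add jadj_smult)
      show "case p of (x, y) \<Rightarrow> jadj (S (j (y \<ominus>\<^bsub>A\<^esub> l \<odot>\<^bsub>A\<^esub> x))) = x" if "p \<in> QA" for p
        using that A.Q_in S(3)[OF j_Q] by (cases p) (auto simp: j_diff j_smult)
    qed
  qed
  then show ?thesis by blast
qed

text \<open>The same compression applies to both parts of the approximate inverse; it keeps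
  compactness because \<open>jadj\<close> is a contraction and preserves Cauchy sequences.\<close>

lemma ess_spectrum_mono: "ess_spectrum A QA \<subseteq> ess_spectrum B QB"
proof -
  have "l \<notin> ess_spectrum A QA" if l: "l \<notin> ess_spectrum B QB" for l
  proof -
    obtain S K where S: "bounded_op B S" and K: "compact_op B K"
      and SK: "\<And>v. v \<in> carrier B \<Longrightarrow> (S v, (v \<oplus>\<^bsub>B\<^esub> K v) \<oplus>\<^bsub>B\<^esub> l \<odot>\<^bsub>B\<^esub> S v) \<in> QB"
      using l unfolding B.ess_spectrum_iff by blast
    have SH: "S v \<in> carrier B" if "v \<in> carrier B" for v using B.Q_in(1)[OF SK[OF that]] .
    have Kb: "bounded_op B K" using K by (simp add: compact_op_def)
    have KH: "K v \<in> carrier B" if "v \<in> carrier B" for v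
      using Kb that B.linear_map_onD(1) by (auto simp: bounded_op_def)
    show ?thesis
      unfolding A.ess_spectrum_iff
    proof (rule exI[of _ "\<lambda>x. jadj (S (j x))"], rule exI[of _ "\<lambda>x. jadj (K (j x))"], intro conjI ballI)
      show "bounded_op A (\<lambda>x. jadj (S (j x)))" by (rule bounded_op_compress[OF S])
      show "compact_op A (\<lambda>x. jadj (K (j x)))"
      proof (rule A.compact_opI[OF bounded_op_compress[OF Kb]])
        fix x :: "nat \<Rightarrow> 'a" assume x: "\<And>n. x n \<in> carrier A" "\<And>n. hnorm A (x n) \<le> 1"
        have jx: "j (x n) \<in> carrier B" "hnorm B (j (x n)) \<le> 1" for n using x by auto
        obtain r where "strict_mono r" "hcauchy B (\<lambda>n. K (j (x (r n))))"
          using B.compact_op_subseq[of K "\<lambda>n. j (x n)", OF K jx] .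
        then show "\<exists>r. strict_mono r \<and> hcauchy A (\<lambda>n. jadj (K (j (x (r n)))))"
          using hcauchy_jadj by blast
      qed
      show "(jadj (S (j v)), (v \<oplus>\<^bsub>A\<^esub> jadj (K (j v))) \<oplus>\<^bsub>A\<^esub> l \<odot>\<^bsub>A\<^esub> jadj (S (j v))) \<in> QA"
        if "v \<in> carrier A" for v
        using jadj_Q[OF SK[of "j v"]] that SH KH by (simp add: jadj_add jadj_smult)
    qed
  qed
  then show ?thesis by blast
qed

lemma same_dim_image:
  assumes E: "E \<subseteq> carrier A" and "same_dim A E H' E'"
  shows "same_dim B (j ` E) H' E'"
proof -
  obtain B1 B2 where B1: "orthonormal_basis A E B1" and B2: "orthonormal_basis H' E' B2"
    and card: "|B1| =o |B2|"
    using assms(2) unfolding same_dim_def by blast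
  have sub: "B1 \<subseteq> carrier A" using B1 E by (auto simp: orthonormal_basis_def)
  have "orthonormal_basis B (j ` E) (j ` B1)"
    using B1 sub inj_on_subset[OF j_inj sub] j_closed_span[OF sub]
    by (auto simp: orthonormal_basis_def subset_iff inj_on_eq_iff)
  moreover have "|j ` B1| =o |B1|"
    using inj_on_subset[OF j_inj sub] card_of_ordIso[of B1 "j ` B1"] ordIso_symmetric
    by (metis inj_on_imp_bij_betw)
  ultimately show ?thesis
    using B2 card ordIso_transitive unfolding same_dim_def by blast
qed

end

section \<open>The direct sum of one space and countably many copies of another\<close>

definition sum_carrier ::
  "('h, 'm) hilbert_scheme \<Rightarrow> ('a, 'n) hilbert_scheme \<Rightarrow> ('h \<times> (nat \<Rightarrow> 'a)) set" where
  "sum_carrier H1 H2 = {(u, f). u \<in> carrier H1 \<and> (\<forall>n. f n \<in> carrier H2) \<and>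
    summable (\<lambda>n. (hnorm H2 (f n))\<^sup>2)}"

text \<open>The sum is built on the image of an injection \<open>\<phi>\<close>, because the members of the class have
  carriers in a fixed type; \<open>p1\<close> and \<open>p2\<close> read off the components.\<close>

locale direct_sum = A: selfadjoint_space H1 Q1 + B: selfadjoint_space H2 Q2
  for H1 :: "('h, 'm) hilbert_scheme" and Q1 and H2 :: "('a, 'n) hilbert_scheme" and Q2 +
  fixes \<phi> :: "'h \<times> (nat \<Rightarrow> 'a) \<Rightarrow> 'c"
  assumes inj_\<phi>: "inj_on \<phi> (sum_carrier H1 H2)"
begin

definition p1 :: "'c \<Rightarrow> 'h" where
  "p1 x = fst (inv_into (sum_carrier H1 H2) \<phi> x)"

definition p2 :: "'c \<Rightarrow> nat \<Rightarrow> 'a" where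
  "p2 x = snd (inv_into (sum_carrier H1 H2) \<phi> x)"

text \<open>The graph carries no summability condition of its own: requiring \<open>x\<close> and
  \<open>y\<close> in the carrier makes both the vector and its image square-summable.\<close>

definition N :: "'c op_structure" where
  "N = \<lparr>carrier = \<phi> ` sum_carrier H1 H2, mult = undefined, one = undefined,
    zero = \<phi> (\<zero>\<^bsub>H1\<^esub>, \<lambda>n. \<zero>\<^bsub>H2\<^esub>),
    add = (\<lambda>x y. \<phi> (p1 x \<oplus>\<^bsub>H1\<^esub> p1 y, \<lambda>n. p2 x n \<oplus>\<^bsub>H2\<^esub> p2 y n)),
    smult = (\<lambda>c x. \<phi> (c \<odot>\<^bsub>H1\<^esub> p1 x, \<lambda>n. c \<odot>\<^bsub>H2\<^esub> p2 x n)),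
    cinner = (\<lambda>x y. cinner H1 (p1 x) (p1 y) + (\<Sum>n. cinner H2 (p2 x n) (p2 y n))),
    opgraph = {(x, y). x \<in> \<phi> ` sum_carrier H1 H2 \<and> y \<in> \<phi> ` sum_carrier H1 H2 \<and>
      (p1 x, p1 y) \<in> Q1 \<and> (\<forall>n. (p2 x n, p2 y n) \<in> Q2)}\<rparr>"

lemma mk_in: "p \<in> sum_carrier H1 H2 \<Longrightarrow> \<phi> p \<in> carrier N"
  by (simp add: N_def)

lemma p1_mk: "(u, f) \<in> sum_carrier H1 H2 \<Longrightarrow> p1 (\<phi> (u, f)) = u"
  and p2_mk: "(u, f) \<in> sum_carrier H1 H2 \<Longrightarrow> p2 (\<phi> (u, f)) = f"
  by (simp_all add: p1_def p2_def inv_into_f_f[OF inj_\<phi>])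

lemma N_cases:
  assumes "x \<in> carrier N"
  obtains u f where "(u, f) \<in> sum_carrier H1 H2" "x = \<phi> (u, f)"
  using assms by (auto simp: N_def)

lemma p_mem: "x \<in> carrier N \<Longrightarrow> (p1 x, p2 x) \<in> sum_carrier H1 H2"
  by (erule N_cases) (simp add: p1_mk p2_mk)

lemma p_in [simp]:
  "x \<in> carrier N \<Longrightarrow> p1 x \<in> carrier H1" "x \<in> carrier N \<Longrightarrow> p2 x n \<in> carrier H2"
  using p_mem[of x] by (auto simp: sum_carrier_def)

lemma p2_summable: "x \<in> carrier N \<Longrightarrow> summable (\<lambda>n. (hnorm H2 (p2 x n))\<^sup>2)"
  using p_mem[of x] by (auto simp: sum_carrier_def)

lemma N_eqI:
  assumes "x \<in> carrier N" "y \<in> carrier N" "p1 x = p1 y" "\<And>n. p2 x n = p2 y n"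
  shows "x = y"
proof -
  have "x = \<phi> (p1 x, p2 x)" "y = \<phi> (p1 y, p2 y)"
    using assms(1,2) by (auto elim!: N_cases simp: p1_mk p2_mk)
  moreover have "p2 x = p2 y" using assms(4) by auto
  ultimately show ?thesis using assms(3) by simp
qed

lemma sum_carrierI:
  assumes "u \<in> carrier H1" "\<And>n. f n \<in> carrier H2"
    and "summable g" "\<And>n. (hnorm H2 (f n))\<^sup>2 \<le> g n"
  shows "(u, f) \<in> sum_carrier H1 H2"
  using assms by (auto simp: sum_carrier_def intro!: summable_comparison_test'[OF assms(3), of 0])

lemma zero_mem: "(\<zero>\<^bsub>H1\<^esub>, \<lambda>n. \<zero>\<^bsub>H2\<^esub>) \<in> sum_carrier H1 H2"
  by (rule sum_carrierI[of _ _ "\<lambda>n. 0"]) auto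

lemma add_mem:
  assumes "(u, f) \<in> sum_carrier H1 H2" "(v, g) \<in> sum_carrier H1 H2"
  shows "(u \<oplus>\<^bsub>H1\<^esub> v, \<lambda>n. f n \<oplus>\<^bsub>H2\<^esub> g n) \<in> sum_carrier H1 H2"
proof (rule sum_carrierI)
  have H: "u \<in> carrier H1" "v \<in> carrier H1" "\<And>n. f n \<in> carrier H2" "\<And>n. g n \<in> carrier H2"
    and s: "summable (\<lambda>n. (hnorm H2 (f n))\<^sup>2)" "summable (\<lambda>n. (hnorm H2 (g n))\<^sup>2)"
    using assms by (auto simp: sum_carrier_def)
  show "summable (\<lambda>n. 2 * (hnorm H2 (f n))\<^sup>2 + 2 * (hnorm H2 (g n))\<^sup>2)"
    using s by (intro summable_add summable_mult)
  show "(hnorm H2 (f n \<oplus>\<^bsub>H2\<^esub> g n))\<^sup>2 \<le> 2 * (hnorm H2 (f n))\<^sup>2 + 2 * (hnorm H2 (g n))\<^sup>2" for n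
  proof -
    have "(hnorm H2 (f n \<oplus>\<^bsub>H2\<^esub> g n))\<^sup>2 \<le> (hnorm H2 (f n) + hnorm H2 (g n))\<^sup>2"
      using H by (intro power_mono B.hnorm_triangle) auto
    also have "\<dots> \<le> 2 * (hnorm H2 (f n))\<^sup>2 + 2 * (hnorm H2 (g n))\<^sup>2"
      using zero_le_power2[of "hnorm H2 (f n) - hnorm H2 (g n)"]
      by (simp add: power2_sum power2_diff)
    finally show ?thesis .
  qed
qed (use assms in \<open>auto simp: sum_carrier_def\<close>)

lemma smult_mem:
  assumes "(u, f) \<in> sum_carrier H1 H2"
  shows "(c \<odot>\<^bsub>H1\<^esub> u, \<lambda>n. c \<odot>\<^bsub>H2\<^esub> f n) \<in> sum_carrier H1 H2"
proof (rule sum_carrierI)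
  have "summable (\<lambda>n. (hnorm H2 (f n))\<^sup>2)" using assms by (auto simp: sum_carrier_def)
  then show "summable (\<lambda>n. (cmod c)\<^sup>2 * (hnorm H2 (f n))\<^sup>2)" by (intro summable_mult)
qed (use assms in \<open>auto simp: sum_carrier_def power_mult_distrib\<close>)

lemma zero_N: "\<zero>\<^bsub>N\<^esub> = \<phi> (\<zero>\<^bsub>H1\<^esub>, \<lambda>n. \<zero>\<^bsub>H2\<^esub>)"
  and add_N: "x \<oplus>\<^bsub>N\<^esub> y = \<phi> (p1 x \<oplus>\<^bsub>H1\<^esub> p1 y, \<lambda>n. p2 x n \<oplus>\<^bsub>H2\<^esub> p2 y n)"
  and smult_N: "c \<odot>\<^bsub>N\<^esub> x = \<phi> (c \<odot>\<^bsub>H1\<^esub> p1 x, \<lambda>n. c \<odot>\<^bsub>H2\<^esub> p2 x n)"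
  and cinner_N: "cinner N x y = cinner H1 (p1 x) (p1 y) + (\<Sum>n. cinner H2 (p2 x n) (p2 y n))"
  by (simp_all add: N_def)

lemma opgraph_N: "(x, y) \<in> opgraph N \<longleftrightarrow> x \<in> carrier N \<and> y \<in> carrier N \<and>
    (p1 x, p1 y) \<in> Q1 \<and> (\<forall>n. (p2 x n, p2 y n) \<in> Q2)"
  by (simp add: N_def)

lemma N_closed:
  "\<zero>\<^bsub>N\<^esub> \<in> carrier N"
  "x \<in> carrier N \<Longrightarrow> y \<in> carrier N \<Longrightarrow> x \<oplus>\<^bsub>N\<^esub> y \<in> carrier N"
  "x \<in> carrier N \<Longrightarrow> c \<odot>\<^bsub>N\<^esub> x \<in> carrier N"
  by (simp_all add: zero_N add_N smult_N mk_in zero_mem add_mem smult_mem p_mem)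

lemma p_N [simp]:
  "p1 \<zero>\<^bsub>N\<^esub> = \<zero>\<^bsub>H1\<^esub>" "p2 \<zero>\<^bsub>N\<^esub> n = \<zero>\<^bsub>H2\<^esub>"
  "x \<in> carrier N \<Longrightarrow> y \<in> carrier N \<Longrightarrow> p1 (x \<oplus>\<^bsub>N\<^esub> y) = p1 x \<oplus>\<^bsub>H1\<^esub> p1 y"
  "x \<in> carrier N \<Longrightarrow> y \<in> carrier N \<Longrightarrow> p2 (x \<oplus>\<^bsub>N\<^esub> y) n = p2 x n \<oplus>\<^bsub>H2\<^esub> p2 y n"
  "x \<in> carrier N \<Longrightarrow> p1 (c \<odot>\<^bsub>N\<^esub> x) = c \<odot>\<^bsub>H1\<^esub> p1 x"
  "x \<in> carrier N \<Longrightarrow> p2 (c \<odot>\<^bsub>N\<^esub> x) n = c \<odot>\<^bsub>H2\<^esub> p2 x n"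
  by (simp_all add: zero_N add_N smult_N p1_mk p2_mk zero_mem add_mem smult_mem p_mem)

lemma cinner_summable:
  assumes "x \<in> carrier N" "y \<in> carrier N"
  shows "summable (\<lambda>n. cinner H2 (p2 x n) (p2 y n))"
proof (rule summable_comparison_test')
  show "summable (\<lambda>n. (hnorm H2 (p2 x n))\<^sup>2 + (hnorm H2 (p2 y n))\<^sup>2)"
    using assms by (intro summable_add p2_summable)
  fix n :: nat
  have "cmod (cinner H2 (p2 x n) (p2 y n)) \<le> hnorm H2 (p2 x n) * hnorm H2 (p2 y n)"
    using assms by (intro B.Cauchy_Schwarz) auto
  also have "\<dots> \<le> (hnorm H2 (p2 x n))\<^sup>2 + (hnorm H2 (p2 y n))\<^sup>2"
    using sum_squares_bound[of "hnorm H2 (p2 x n)" "hnorm H2 (p2 y n)"]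
      mult_nonneg_nonneg[OF B.hnorm_ge_0[OF p_in(2)[OF assms(1), of n]] B.hnorm_ge_0[OF p_in(2)[OF assms(2), of n]]]
    by linarith
  finally show "norm (cinner H2 (p2 x n) (p2 y n)) \<le> (hnorm H2 (p2 x n))\<^sup>2 + (hnorm H2 (p2 y n))\<^sup>2" .
qed

lemma cinner_N_self:
  assumes x: "x \<in> carrier N"
  shows "cinner N x x = of_real ((hnorm H1 (p1 x))\<^sup>2 + (\<Sum>n. (hnorm H2 (p2 x n))\<^sup>2))"
proof -
  have "(\<lambda>n. cinner H2 (p2 x n) (p2 x n)) = (\<lambda>n. of_real ((hnorm H2 (p2 x n))\<^sup>2))"
    using x by (simp add: B.cinner_self)
  then show ?thesis
    using x suminf_of_real[OF p2_summable[OF x], where 'a = complex]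
    by (simp add: cinner_N A.cinner_self)
qed

lemma module_N: "Module.module complex_field N"
proof (rule moduleI[OF cring_complex_field])
  show "abelian_group N"
  proof (rule abelian_groupI)
    fix x assume x: "x \<in> carrier N"
    show "\<exists>y\<in>carrier N. y \<oplus>\<^bsub>N\<^esub> x = \<zero>\<^bsub>N\<^esub>"
      by (rule bexI[of _ "(-1) \<odot>\<^bsub>N\<^esub> x"])
        (use x in \<open>auto intro!: N_eqI A.vec_eqI B.vec_eqI simp: N_closed\<close>)
  qed (auto intro!: N_eqI A.vec_eqI B.vec_eqI simp: N_closed)
qed (auto intro!: N_eqI A.vec_eqI B.vec_eqI simp: N_closed algebra_simps)

sublocale NI: inner_module N
proof (intro inner_module.intro inner_module_axioms.intro module_N)
  fix x y assume x: "x \<in> carrier N" and y: "y \<in> carrier N"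
  show "cinner N x y = cnj (cinner N y x)"
  proof -
    have "(\<Sum>n. cinner H2 (p2 x n) (p2 y n)) = (\<Sum>n. cnj (cinner H2 (p2 y n) (p2 x n)))"
      using x y by (intro suminf_cong B.cinner_commute) auto
    also have "\<dots> = cnj (\<Sum>n. cinner H2 (p2 y n) (p2 x n))"
      using cinner_summable[OF y x] by (intro bounded_linear.suminf[OF bounded_linear_cnj, symmetric])
    finally show ?thesis
      using x y A.cinner_commute[of "p1 x" "p1 y"] by (simp add: cinner_N)
  qed
  show "cinner N (c \<odot>\<^bsub>N\<^esub> x) y = c * cinner N x y" for c
    using x y suminf_mult[OF cinner_summable[OF x y], of c]
    by (simp add: cinner_N algebra_simps)
  show "cinner N (x \<oplus>\<^bsub>N\<^esub> y) z = cinner N x z + cinner N y z" if z: "z \<in> carrier N" for z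
    using x y z suminf_add[OF cinner_summable[OF x z] cinner_summable[OF y z]]
    by (simp add: cinner_N algebra_simps)
next
  fix x assume x: "x \<in> carrier N"
  have s: "0 \<le> (\<Sum>n. (hnorm H2 (p2 x n))\<^sup>2)"
    by (intro suminf_nonneg p2_summable[OF x]) auto
  show "0 \<le> Re (cinner N x x)" using s by (simp add: cinner_N_self[OF x])
  show "cinner N x x = 0 \<longleftrightarrow> x = \<zero>\<^bsub>N\<^esub>"
  proof
    assume "cinner N x x = 0"
    then have "(hnorm H1 (p1 x))\<^sup>2 + (\<Sum>n. (hnorm H2 (p2 x n))\<^sup>2) = 0"
      by (simp only: cinner_N_self[OF x] of_real_eq_0_iff)
    then have "(hnorm H1 (p1 x))\<^sup>2 = 0" "(\<Sum>n. (hnorm H2 (p2 x n))\<^sup>2) = 0"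
      using s by (simp_all add: add_nonneg_eq_0_iff)
    moreover from this(2) have "(hnorm H2 (p2 x n))\<^sup>2 = 0" for n
      using suminf_eq_zero_iff[OF p2_summable[OF x]] by simp
    ultimately show "x = \<zero>\<^bsub>N\<^esub>"
      using x by (intro N_eqI) (auto simp: A.hnorm_eq_0_iff B.hnorm_eq_0_iff N_closed)
  next
    assume "x = \<zero>\<^bsub>N\<^esub>"
    then show "cinner N x x = 0" by (simp add: cinner_N)
  qed
qed

lemma hnorm_N_sq:
  assumes x: "x \<in> carrier N"
  shows "(hnorm N x)\<^sup>2 = (hnorm H1 (p1 x))\<^sup>2 + (\<Sum>n. (hnorm H2 (p2 x n))\<^sup>2)"
  using x by (simp add: NI.hnorm_sq cinner_N_self)

lemma p_diff [simp]:
  assumes "x \<in> carrier N" "y \<in> carrier N"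
  shows "p1 (x \<ominus>\<^bsub>N\<^esub> y) = p1 x \<ominus>\<^bsub>H1\<^esub> p1 y" "p2 (x \<ominus>\<^bsub>N\<^esub> y) n = p2 x n \<ominus>\<^bsub>H2\<^esub> p2 y n"
  using assms by (simp_all add: NI.diff_eq A.diff_eq B.diff_eq)

lemma partial_norm_le:
  assumes x: "x \<in> carrier N"
  shows "(hnorm H1 (p1 x))\<^sup>2 + (\<Sum>n<k. (hnorm H2 (p2 x n))\<^sup>2) \<le> (hnorm N x)\<^sup>2"
  unfolding hnorm_N_sq[OF x] by (intro add_left_mono sum_le_suminf p2_summable[OF x]) auto

lemma p1_norm_le: "x \<in> carrier N \<Longrightarrow> hnorm H1 (p1 x) \<le> hnorm N x"
  using partial_norm_le[of x 0] by (simp add: power2_le_iff_abs_le)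

lemma p2_norm_le:
  assumes x: "x \<in> carrier N"
  shows "hnorm H2 (p2 x n) \<le> hnorm N x"
proof -
  have "(hnorm H2 (p2 x n))\<^sup>2 \<le> (\<Sum>k<Suc n. (hnorm H2 (p2 x k))\<^sup>2)"
    by (rule member_le_sum) auto
  then have "(hnorm H2 (p2 x n))\<^sup>2 \<le> (hnorm N x)\<^sup>2"
    using partial_norm_le[OF x, of "Suc n"] zero_le_power2[of "hnorm H1 (p1 x)"] by linarith
  then show ?thesis using x by (simp add: power2_le_iff_abs_le)
qed

text \<open>Limits are taken coordinatewise, bounds on partial sums survive the limit, and letting
  the number of terms grow gives the bound on the full norm.\<close>

lemma hilbert_N: "complex_hilbert_space N"
proof (rule NI.complex_hilbert_spaceI)
  fix F assume F: "hcauchy N F"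
  have FN: "F m \<in> carrier N" for m using F by (simp add: hcauchy_def)
  have "hcauchy H1 (\<lambda>m. p1 (F m))"
  proof (rule A.hcauchyI_le[OF F])
    show "hnorm H1 (p1 (F m) \<ominus>\<^bsub>H1\<^esub> p1 (F n)) \<le> hnorm N (F m \<ominus>\<^bsub>N\<^esub> F n)" for m n
      using p1_norm_le[of "F m \<ominus>\<^bsub>N\<^esub> F n"] FN by simp
  qed (use FN in auto)
  then obtain u where u: "hlim H1 (\<lambda>m. p1 (F m)) u" by (rule A.hcauchy_convergent)
  have "\<exists>f. hlim H2 (\<lambda>m. p2 (F m) n) f" for n
  proof -
    have "hcauchy H2 (\<lambda>m. p2 (F m) n)"
    proof (rule B.hcauchyI_le[OF F])
      show "hnorm H2 (p2 (F m) n \<ominus>\<^bsub>H2\<^esub> p2 (F k) n) \<le> hnorm N (F m \<ominus>\<^bsub>N\<^esub> F k)" for m k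
        using p2_norm_le[of "F m \<ominus>\<^bsub>N\<^esub> F k" n] FN by simp
    qed (use FN in auto)
    then show ?thesis using B.hcauchy_convergent by blast
  qed
  then obtain f where f: "\<And>n. hlim H2 (\<lambda>m. p2 (F m) n) (f n)" by metis
  note uH = A.hlimD(2)[OF u] and fH = B.hlimD(2)[OF f]
  \<comment> \<open>Only \<open>k\<close> copies enter, so the limit can be taken termwise; the
    bound \<open>e\<^sup>2\<close> does not depend on \<open>k\<close>.\<close>
  have part: "(hnorm H1 (p1 (F m) \<ominus>\<^bsub>H1\<^esub> u))\<^sup>2 + (\<Sum>n<k. (hnorm H2 (p2 (F m) n \<ominus>\<^bsub>H2\<^esub> f n))\<^sup>2) \<le> e\<^sup>2"
    if K: "\<forall>m\<ge>K. \<forall>n\<ge>K. hnorm N (F m \<ominus>\<^bsub>N\<^esub> F n) < e" and m: "m \<ge> K" for K m k e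
  proof (rule LIMSEQ_le_const2)
    show "(\<lambda>i. (hnorm H1 (p1 (F m) \<ominus>\<^bsub>H1\<^esub> p1 (F i)))\<^sup>2 + (\<Sum>n<k. (hnorm H2 (p2 (F m) n \<ominus>\<^bsub>H2\<^esub> p2 (F i) n))\<^sup>2))
      \<longlonglongrightarrow> (hnorm H1 (p1 (F m) \<ominus>\<^bsub>H1\<^esub> u))\<^sup>2 + (\<Sum>n<k. (hnorm H2 (p2 (F m) n \<ominus>\<^bsub>H2\<^esub> f n))\<^sup>2)"
      by (intro tendsto_intros A.hlim_hnorm B.hlim_hnorm A.hlim_diff B.hlim_diff A.hlim_const
          B.hlim_const u f p_in FN)
    show "\<exists>K. \<forall>i\<ge>K. (hnorm H1 (p1 (F m) \<ominus>\<^bsub>H1\<^esub> p1 (F i)))\<^sup>2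
        + (\<Sum>n<k. (hnorm H2 (p2 (F m) n \<ominus>\<^bsub>H2\<^esub> p2 (F i) n))\<^sup>2) \<le> e\<^sup>2"
    proof (intro exI[of _ K] allI impI)
      fix i assume i: "i \<ge> K"
      have "(hnorm H1 (p1 (F m) \<ominus>\<^bsub>H1\<^esub> p1 (F i)))\<^sup>2
          + (\<Sum>n<k. (hnorm H2 (p2 (F m) n \<ominus>\<^bsub>H2\<^esub> p2 (F i) n))\<^sup>2) \<le> (hnorm N (F m \<ominus>\<^bsub>N\<^esub> F i))\<^sup>2"
        using partial_norm_le[of "F m \<ominus>\<^bsub>N\<^esub> F i" k] FN by simp
      also have "\<dots> \<le> e\<^sup>2"
        using K m i FN by (intro power_mono) (auto intro: less_imp_le)
      finally show "(hnorm H1 (p1 (F m) \<ominus>\<^bsub>H1\<^esub> p1 (F i)))\<^sup>2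
          + (\<Sum>n<k. (hnorm H2 (p2 (F m) n \<ominus>\<^bsub>H2\<^esub> p2 (F i) n))\<^sup>2) \<le> e\<^sup>2" .
    qed
  qed
  have tail: "summable (\<lambda>n. (hnorm H2 (p2 (F m) n \<ominus>\<^bsub>H2\<^esub> f n))\<^sup>2)"
    if K: "\<forall>m\<ge>K. \<forall>n\<ge>K. hnorm N (F m \<ominus>\<^bsub>N\<^esub> F n) < e" and m: "m \<ge> K" for K m e
  proof (rule summableI_nonneg_bounded)
    show "(\<Sum>n<k. (hnorm H2 (p2 (F m) n \<ominus>\<^bsub>H2\<^esub> f n))\<^sup>2) \<le> e\<^sup>2" for k
      using part[OF that, of k] zero_le_power2[of "hnorm H1 (p1 (F m) \<ominus>\<^bsub>H1\<^esub> u)"] by linarith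
  qed simp
  \<comment> \<open>Membership of the limit has to precede any use of the norm of \<open>N\<close>
    on it. One late term \<open>F K\<close> and the tail bound dominate \<open>f\<close>
    coordinatewise.\<close>
  have uf: "(u, f) \<in> sum_carrier H1 H2"
  proof -
    obtain K where K: "\<forall>m\<ge>K. \<forall>n\<ge>K. hnorm N (F m \<ominus>\<^bsub>N\<^esub> F n) < 1"
      using F unfolding hcauchy_def by (meson zero_less_one)
    show ?thesis
    proof (rule sum_carrierI)
      show "summable (\<lambda>n. 2 * (hnorm H2 (p2 (F K) n))\<^sup>2 + 2 * (hnorm H2 (p2 (F K) n \<ominus>\<^bsub>H2\<^esub> f n))\<^sup>2)"
        by (intro summable_add summable_mult p2_summable FN tail[OF K]) simp
      fix n
      have "f n = p2 (F K) n \<ominus>\<^bsub>H2\<^esub> (p2 (F K) n \<ominus>\<^bsub>H2\<^esub> f n)"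
        using fH FN by (intro B.vec_eqI) auto
      then have "hnorm H2 (f n) \<le> hnorm H2 (p2 (F K) n) + hnorm H2 (p2 (F K) n \<ominus>\<^bsub>H2\<^esub> f n)"
        using B.hnorm_triangle_diff[of "p2 (F K) n" "p2 (F K) n \<ominus>\<^bsub>H2\<^esub> f n"] fH FN by simp
      then have "(hnorm H2 (f n))\<^sup>2 \<le> (hnorm H2 (p2 (F K) n) + hnorm H2 (p2 (F K) n \<ominus>\<^bsub>H2\<^esub> f n))\<^sup>2"
        using fH by (intro power_mono) auto
      also have "\<dots> \<le> 2 * (hnorm H2 (p2 (F K) n))\<^sup>2 + 2 * (hnorm H2 (p2 (F K) n \<ominus>\<^bsub>H2\<^esub> f n))\<^sup>2"
        using zero_le_power2[of "hnorm H2 (p2 (F K) n) - hnorm H2 (p2 (F K) n \<ominus>\<^bsub>H2\<^esub> f n)"]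
        by (simp add: power2_sum power2_diff)
      finally show "(hnorm H2 (f n))\<^sup>2 \<le> 2 * (hnorm H2 (p2 (F K) n))\<^sup>2 + 2 * (hnorm H2 (p2 (F K) n \<ominus>\<^bsub>H2\<^esub> f n))\<^sup>2" .
    qed (use uH fH in auto)
  qed
  let ?L = "\<phi> (u, f)"
  have LN: "?L \<in> carrier N" by (rule mk_in[OF uf])
  have "(\<lambda>m. hnorm N (F m \<ominus>\<^bsub>N\<^esub> ?L)) \<longlonglongrightarrow> 0"
  proof (rule LIMSEQ_I)
    fix e :: real assume e: "e > 0"
    then have "e / 2 > 0" by simp
    then obtain K where K: "\<forall>m\<ge>K. \<forall>n\<ge>K. hnorm N (F m \<ominus>\<^bsub>N\<^esub> F n) < e / 2"
      using F unfolding hcauchy_def by meson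
    have "hnorm N (F m \<ominus>\<^bsub>N\<^esub> ?L) < e" if m: "m \<ge> K" for m
    proof -
      have "(\<Sum>n. (hnorm H2 (p2 (F m) n \<ominus>\<^bsub>H2\<^esub> f n))\<^sup>2) \<le> (e / 2)\<^sup>2 - (hnorm H1 (p1 (F m) \<ominus>\<^bsub>H1\<^esub> u))\<^sup>2"
      proof (rule suminf_le_const[OF tail[OF K m]])
        fix k
        show "(\<Sum>n<k. (hnorm H2 (p2 (F m) n \<ominus>\<^bsub>H2\<^esub> f n))\<^sup>2) \<le> (e / 2)\<^sup>2 - (hnorm H1 (p1 (F m) \<ominus>\<^bsub>H1\<^esub> u))\<^sup>2"
          using part[OF K m, of k] by linarith
      qed
      then have "(hnorm N (F m \<ominus>\<^bsub>N\<^esub> ?L))\<^sup>2 \<le> (e / 2)\<^sup>2"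
        using FN LN by (simp add: hnorm_N_sq p1_mk[OF uf] p2_mk[OF uf])
      then have "hnorm N (F m \<ominus>\<^bsub>N\<^esub> ?L) \<le> e / 2"
        by (rule power2_le_imp_le) (use e in simp)
      then show ?thesis using e by simp
    qed
    then show "\<exists>K. \<forall>m\<ge>K. norm (hnorm N (F m \<ominus>\<^bsub>N\<^esub> ?L) - 0) < e"
      using FN LN by (intro exI[of _ K]) auto
  qed
  then show "\<exists>l. hlim N F l" using FN LN by (auto simp: hlim_def)
qed

section \<open>Coordinate embeddings and self-adjointness of the sum\<close>

definition i1 :: "'h \<Rightarrow> 'c" where
  "i1 u = \<phi> (u, \<lambda>n. \<zero>\<^bsub>H2\<^esub>)"

definition i2 :: "nat \<Rightarrow> 'a \<Rightarrow> 'c" where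
  "i2 n x = \<phi> (\<zero>\<^bsub>H1\<^esub>, \<lambda>k. if k = n then x else \<zero>\<^bsub>H2\<^esub>)"

lemma i_mem:
  "u \<in> carrier H1 \<Longrightarrow> (u, \<lambda>n. \<zero>\<^bsub>H2\<^esub>) \<in> sum_carrier H1 H2"
  "x \<in> carrier H2 \<Longrightarrow> (\<zero>\<^bsub>H1\<^esub>, \<lambda>k. if k = n then x else \<zero>\<^bsub>H2\<^esub>) \<in> sum_carrier H1 H2"
  by (rule sum_carrierI[of _ _ "\<lambda>n. 0"], auto)
    (rule sum_carrierI[of _ _ "\<lambda>k. if k = n then (hnorm H2 x)\<^sup>2 else 0"], auto)

lemma i_in [simp]: "u \<in> carrier H1 \<Longrightarrow> i1 u \<in> carrier N" "x \<in> carrier H2 \<Longrightarrow> i2 n x \<in> carrier N"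
  by (simp_all add: i1_def i2_def i_mem mk_in)

lemma p_i [simp]:
  "u \<in> carrier H1 \<Longrightarrow> p1 (i1 u) = u" "u \<in> carrier H1 \<Longrightarrow> p2 (i1 u) n = \<zero>\<^bsub>H2\<^esub>"
  "x \<in> carrier H2 \<Longrightarrow> p1 (i2 n x) = \<zero>\<^bsub>H1\<^esub>"
  "x \<in> carrier H2 \<Longrightarrow> p2 (i2 n x) k = (if k = n then x else \<zero>\<^bsub>H2\<^esub>)"
  by (simp_all add: i1_def i2_def p1_mk p2_mk i_mem)

lemma cinner_i:
  "u \<in> carrier H1 \<Longrightarrow> y \<in> carrier N \<Longrightarrow> cinner N (i1 u) y = cinner H1 u (p1 y)"
  "x \<in> carrier H2 \<Longrightarrow> y \<in> carrier N \<Longrightarrow> cinner N (i2 n x) y = cinner H2 x (p2 y n)"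
proof -
  show "u \<in> carrier H1 \<Longrightarrow> y \<in> carrier N \<Longrightarrow> cinner N (i1 u) y = cinner H1 u (p1 y)"
    by (simp add: cinner_N)
  assume x: "x \<in> carrier H2" and y: "y \<in> carrier N"
  have "(\<Sum>k. cinner H2 (p2 (i2 n x) k) (p2 y k)) = (\<Sum>k\<in>{n}. cinner H2 (p2 (i2 n x) k) (p2 y k))"
    using x y by (intro suminf_finite) auto
  then show "cinner N (i2 n x) y = cinner H2 x (p2 y n)"
    using x y by (simp add: cinner_N)
qed

lemma i1_Q: "(x, y) \<in> Q1 \<Longrightarrow> (i1 x, i1 y) \<in> opgraph N"
  using A.Q_in[of x y] by (simp add: opgraph_N B.Q_zero)

lemma i2_Q: "(x, y) \<in> Q2 \<Longrightarrow> (i2 n x, i2 n y) \<in> opgraph N"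
  using B.Q_in[of x y] by (simp add: opgraph_N A.Q_zero B.Q_zero)

text \<open>Testing the adjoint relation against vectors supported in one coordinate, through
  \<open>i1\<close> and \<open>i2\<close>, isolates the relation in that coordinate, where
  self-adjointness applies.\<close>

sublocale N: selfadjoint_space N "opgraph N"
proof (intro selfadjoint_space.intro selfadjoint_space_axioms.intro hilbert_N
    complex_hilbert_space.selfadjoint_operatorI[OF hilbert_N])
  show "linear_operator N (opgraph N)"
    unfolding linear_operator_def
  proof (intro conjI)
    show "opgraph N \<subseteq> carrier N \<times> carrier N" by (auto simp: opgraph_N)
    show "single_valued (opgraph N)"
      unfolding single_valued_def
      by (auto simp: opgraph_N intro!: N_eqI intro: A.Q_unique B.Q_unique)
    show "(\<zero>\<^bsub>N\<^esub>, \<zero>\<^bsub>N\<^esub>) \<in> opgraph N"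
      by (simp add: opgraph_N A.Q_zero B.Q_zero)
    show "\<forall>(x, y)\<in>opgraph N. \<forall>(x', y')\<in>opgraph N. (x \<oplus>\<^bsub>N\<^esub> x', y \<oplus>\<^bsub>N\<^esub> y') \<in> opgraph N"
      by (auto simp: opgraph_N A.Q_add B.Q_add)
    show "\<forall>c. \<forall>(x, y)\<in>opgraph N. (c \<odot>\<^bsub>N\<^esub> x, c \<odot>\<^bsub>N\<^esub> y) \<in> opgraph N"
      by (auto simp: opgraph_N A.Q_smult B.Q_smult)
  qed
  show "opgraph N \<subseteq> adjoint_graph N (opgraph N)"
  proof
    fix p assume p: "p \<in> opgraph N"
    obtain x y where xy: "p = (x, y)" by (cases p)
    have "cinner N w x = cinner N v y" if "(v, w) \<in> opgraph N" for v w
    proof -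
      have "cinner H1 (p1 w) (p1 x) = cinner H1 (p1 v) (p1 y)"
        using that p xy by (intro A.Q_sym) (auto simp: opgraph_N)
      moreover have "cinner H2 (p2 w n) (p2 x n) = cinner H2 (p2 v n) (p2 y n)" for n
        using that p xy by (intro B.Q_sym) (auto simp: opgraph_N)
      ultimately show ?thesis by (simp add: cinner_N)
    qed
    then show "p \<in> adjoint_graph N (opgraph N)"
      using p xy by (auto simp: adjoint_graph_def opgraph_N)
  qed
  show "adjoint_graph N (opgraph N) \<subseteq> opgraph N"
  proof
    fix p assume p: "p \<in> adjoint_graph N (opgraph N)"
    obtain x y where xy: "p = (x, y)" by (cases p)
    then have H: "x \<in> carrier N" "y \<in> carrier N"
      and adj: "\<And>v w. (v, w) \<in> opgraph N \<Longrightarrow> cinner N w x = cinner N v y"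
      using p by (auto simp: adjoint_graph_def)
    have "(p1 x, p1 y) \<in> Q1"
    proof (rule A.QI)
      show "cinner H1 w (p1 x) = cinner H1 v (p1 y)" if "(v, w) \<in> Q1" for v w
        using adj[OF i1_Q[OF that]] A.Q_in[OF that] H by (simp add: cinner_i)
    qed (use H in auto)
    moreover have "(p2 x n, p2 y n) \<in> Q2" for n
    proof (rule B.QI)
      show "cinner H2 w (p2 x n) = cinner H2 v (p2 y n)" if "(v, w) \<in> Q2" for v w
        using adj[OF i2_Q[OF that, of n]] B.Q_in[OF that] H by (simp add: cinner_i)
    qed (use H in auto)
    ultimately show "p \<in> opgraph N" using H xy by (simp add: opgraph_N)
  qed
qed

lemma intertwiner_i1: "intertwiner H1 Q1 N (opgraph N) i1"
proof
  show "i1 (x \<oplus>\<^bsub>H1\<^esub> y) = i1 x \<oplus>\<^bsub>N\<^esub> i1 y" if "x \<in> carrier H1" "y \<in> carrier H1" for x y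
    using that by (intro N_eqI) auto
  show "i1 (c \<odot>\<^bsub>H1\<^esub> x) = c \<odot>\<^bsub>N\<^esub> i1 x" if "x \<in> carrier H1" for x c
    using that by (intro N_eqI) auto
qed (auto simp: cinner_i i1_Q)

lemma intertwiner_i2: "intertwiner H2 Q2 N (opgraph N) (i2 n)"
proof
  show "i2 n (x \<oplus>\<^bsub>H2\<^esub> y) = i2 n x \<oplus>\<^bsub>N\<^esub> i2 n y" if "x \<in> carrier H2" "y \<in> carrier H2" for x y
    using that by (intro N_eqI) auto
  show "i2 n (c \<odot>\<^bsub>H2\<^esub> x) = c \<odot>\<^bsub>N\<^esub> i2 n x" if "x \<in> carrier H2" for x c
    using that by (intro N_eqI) auto
qed (auto simp: cinner_i i2_Q)

lemma i2_orth: "x \<in> carrier H2 \<Longrightarrow> y \<in> carrier H2 \<Longrightarrow> n \<noteq> k \<Longrightarrow> cinner N (i2 n x) (i2 k y) = 0"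
  by (simp add: cinner_i)

section \<open>Diagonal operators and the spectral data of the sum\<close>

definition dop :: "('h \<Rightarrow> 'h) \<Rightarrow> ('a \<Rightarrow> 'a) \<Rightarrow> 'c \<Rightarrow> 'c" where
  "dop S T x = \<phi> (S (p1 x), \<lambda>n. T (p2 x n))"

lemma dop_mem:
  assumes S: "bounded_op H1 S" and T: "bounded_op H2 T" and x: "x \<in> carrier N"
  shows "(S (p1 x), \<lambda>n. T (p2 x n)) \<in> sum_carrier H1 H2"
proof -
  obtain C where C: "C \<ge> 0" "\<And>x. x \<in> carrier H2 \<Longrightarrow> hnorm H2 (T x) \<le> C * hnorm H2 x"
    using B.bounded_opD[OF T] by blast
  have lin: "linear_map_on H1 S" "linear_map_on H2 T" using S T by (auto simp: bounded_op_def)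
  show ?thesis
  proof (rule sum_carrierI)
    show "summable (\<lambda>n. C\<^sup>2 * (hnorm H2 (p2 x n))\<^sup>2)" by (intro summable_mult p2_summable x)
    show "(hnorm H2 (T (p2 x n)))\<^sup>2 \<le> C\<^sup>2 * (hnorm H2 (p2 x n))\<^sup>2" for n
      unfolding power_mult_distrib[symmetric]
      using x C B.linear_map_onD(1)[OF lin(2)] by (intro power_mono) auto
  qed (use x A.linear_map_onD(1)[OF lin(1)] B.linear_map_onD(1)[OF lin(2)] in auto)
qed

lemma p_dop:
  assumes "bounded_op H1 S" "bounded_op H2 T" "x \<in> carrier N"
  shows "dop S T x \<in> carrier N" "p1 (dop S T x) = S (p1 x)" "p2 (dop S T x) n = T (p2 x n)"
  using dop_mem[OF assms] by (simp_all add: dop_def mk_in p1_mk p2_mk)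

text \<open>All copies carry the same operator \<open>T\<close>, so a single constant bounds it on
  every coordinate; \<open>C + D\<close> dominates both coordinate bounds.\<close>

lemma bounded_dop:
  assumes S: "bounded_op H1 S" and T: "bounded_op H2 T"
  shows "bounded_op N (dop S T)"
proof -
  obtain C where C: "C \<ge> 0" "\<And>x. x \<in> carrier H1 \<Longrightarrow> hnorm H1 (S x) \<le> C * hnorm H1 x"
    using A.bounded_opD[OF S] by blast
  obtain D where D: "D \<ge> 0" "\<And>x. x \<in> carrier H2 \<Longrightarrow> hnorm H2 (T x) \<le> D * hnorm H2 x"
    using B.bounded_opD[OF T] by blast
  have lin: "linear_map_on H1 S" "linear_map_on H2 T" using S T by (auto simp: bounded_op_def)
  note L = A.linear_map_onD[OF lin(1)] B.linear_map_onD[OF lin(2)]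
  note p = p_dop[OF S T]
  have "hnorm N (dop S T x) \<le> (C + D) * hnorm N x" if x: "x \<in> carrier N" for x
  proof -
    have "(hnorm H1 (S (p1 x)))\<^sup>2 \<le> ((C + D) * hnorm H1 (p1 x))\<^sup>2"
    proof (rule power_mono)
      have "hnorm H1 (S (p1 x)) \<le> C * hnorm H1 (p1 x)" using C x by simp
      also have "\<dots> \<le> (C + D) * hnorm H1 (p1 x)" using C(1) D(1) x by (intro mult_right_mono) auto
      finally show "hnorm H1 (S (p1 x)) \<le> (C + D) * hnorm H1 (p1 x)" .
    qed (use L x in auto)
    moreover have "(\<Sum>n. (hnorm H2 (T (p2 x n)))\<^sup>2) \<le> (\<Sum>n. (C + D)\<^sup>2 * (hnorm H2 (p2 x n))\<^sup>2)"
    proof (rule suminf_le)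
      show "(hnorm H2 (T (p2 x n)))\<^sup>2 \<le> (C + D)\<^sup>2 * (hnorm H2 (p2 x n))\<^sup>2" for n
        unfolding power_mult_distrib[symmetric]
      proof (rule power_mono)
        have "hnorm H2 (T (p2 x n)) \<le> D * hnorm H2 (p2 x n)" using D x by simp
        also have "\<dots> \<le> (C + D) * hnorm H2 (p2 x n)" using C(1) D(1) x by (intro mult_right_mono) auto
        finally show "hnorm H2 (T (p2 x n)) \<le> (C + D) * hnorm H2 (p2 x n)" .
      qed (use L x in auto)
      show "summable (\<lambda>n. (hnorm H2 (T (p2 x n)))\<^sup>2)"
        using p2_summable[OF p(1)[OF x]] by (simp add: p(3)[OF x])
      show "summable (\<lambda>n. (C + D)\<^sup>2 * (hnorm H2 (p2 x n))\<^sup>2)"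
        by (intro summable_mult p2_summable x)
    qed
    moreover have "(\<Sum>n. (C + D)\<^sup>2 * (hnorm H2 (p2 x n))\<^sup>2) = (C + D)\<^sup>2 * (\<Sum>n. (hnorm H2 (p2 x n))\<^sup>2)"
      by (intro suminf_mult p2_summable x)
    ultimately have "(hnorm N (dop S T x))\<^sup>2 \<le> ((C + D) * hnorm N x)\<^sup>2"
      using x by (simp add: hnorm_N_sq p power_mult_distrib distrib_left)
    then show ?thesis
      using C(1) D(1) x by (auto intro: power2_le_imp_le mult_nonneg_nonneg)
  qed
  moreover have "linear_map_on N (dop S T)"
    unfolding linear_map_on_def using p L by (auto intro!: N_eqI)
  ultimately show ?thesis unfolding bounded_op_def by blast
qed

text \<open>A point off the spectrum of \<open>Q1\<close> is off its essential spectrum, hence off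
  the spectrum of \<open>Q2\<close>; the diagonal of the two inverses is an inverse.\<close>

lemma spectrum_N:
  assumes sub: "spectrum H2 Q2 \<subseteq> ess_spectrum H1 Q1"
  shows "spectrum N (opgraph N) = spectrum H1 Q1"
proof
  show "spectrum H1 Q1 \<subseteq> spectrum N (opgraph N)"
    by (rule intertwiner.spectrum_mono[OF intertwiner_i1])
  have "l \<notin> spectrum N (opgraph N)" if l: "l \<notin> spectrum H1 Q1" for l
  proof -
    have l2: "l \<notin> spectrum H2 Q2" using l sub A.ess_spectrum_subset_spectrum by blast
    obtain S where S: "bounded_op H1 S" "\<And>v. v \<in> carrier H1 \<Longrightarrow> (S v, v \<oplus>\<^bsub>H1\<^esub> l \<odot>\<^bsub>H1\<^esub> S v) \<in> Q1"
      "\<And>x y. (x, y) \<in> Q1 \<Longrightarrow> S (y \<ominus>\<^bsub>H1\<^esub> l \<odot>\<^bsub>H1\<^esub> x) = x"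
      using l unfolding A.spectrum_iff by blast
    obtain T where T: "bounded_op H2 T" "\<And>v. v \<in> carrier H2 \<Longrightarrow> (T v, v \<oplus>\<^bsub>H2\<^esub> l \<odot>\<^bsub>H2\<^esub> T v) \<in> Q2"
      "\<And>x y. (x, y) \<in> Q2 \<Longrightarrow> T (y \<ominus>\<^bsub>H2\<^esub> l \<odot>\<^bsub>H2\<^esub> x) = x"
      using l2 unfolding B.spectrum_iff by blast
    note p = p_dop[OF S(1) T(1)]
    show ?thesis
      unfolding N.spectrum_iff
    proof (intro exI[of _ "dop S T"] conjI ballI)
      show "bounded_op N (dop S T)" by (rule bounded_dop[OF S(1) T(1)])
      show "(dop S T v, v \<oplus>\<^bsub>N\<^esub> l \<odot>\<^bsub>N\<^esub> dop S T v) \<in> opgraph N" if "v \<in> carrier N" for v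
        using that S(2) T(2) by (simp add: opgraph_N p)
      show "case q of (x, y) \<Rightarrow> dop S T (y \<ominus>\<^bsub>N\<^esub> l \<odot>\<^bsub>N\<^esub> x) = x" if "q \<in> opgraph N" for q
        using that S(3) T(3) by (cases q) (auto simp: opgraph_N p intro!: N_eqI)
    qed
  qed
  then show "spectrum N (opgraph N) \<subseteq> spectrum H1 Q1" by blast
qed

text \<open>An operator repeated on infinitely many copies is compact only if it is zero. The
  correction is therefore confined to the first summand, with an exact inverse on the copies; this
  is why the hypothesis concerns the whole spectrum of \<open>Q2\<close>.\<close>

lemma ess_spectrum_N:
  assumes sub: "spectrum H2 Q2 \<subseteq> ess_spectrum H1 Q1"
  shows "ess_spectrum N (opgraph N) = ess_spectrum H1 Q1"
proof
  show "ess_spectrum H1 Q1 \<subseteq> ess_spectrum N (opgraph N)"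
    by (rule intertwiner.ess_spectrum_mono[OF intertwiner_i1])
  have "l \<notin> ess_spectrum N (opgraph N)" if l: "l \<notin> ess_spectrum H1 Q1" for l
  proof -
    have l2: "l \<notin> spectrum H2 Q2" using l sub by blast
    obtain S K where S: "bounded_op H1 S" and K: "compact_op H1 K"
      and SK: "\<And>v. v \<in> carrier H1 \<Longrightarrow> (S v, (v \<oplus>\<^bsub>H1\<^esub> K v) \<oplus>\<^bsub>H1\<^esub> l \<odot>\<^bsub>H1\<^esub> S v) \<in> Q1"
      using l unfolding A.ess_spectrum_iff by blast
    obtain T where T: "bounded_op H2 T" "\<And>v. v \<in> carrier H2 \<Longrightarrow> (T v, v \<oplus>\<^bsub>H2\<^esub> l \<odot>\<^bsub>H2\<^esub> T v) \<in> Q2"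
      using l2 unfolding B.spectrum_iff by blast
    have Kb: "bounded_op H1 K" using K by (simp add: compact_op_def)
    have Klin: "linear_map_on H1 K" using Kb by (simp add: bounded_op_def)
    let ?K = "dop K (\<lambda>x. \<zero>\<^bsub>H2\<^esub>)"
    note p = p_dop[OF S(1) T(1)] and pK = p_dop[OF Kb B.bounded_op_zero]
    show ?thesis
      unfolding N.ess_spectrum_iff
    proof (rule exI[of _ "dop S T"], rule exI[of _ ?K], intro conjI ballI)
      show "bounded_op N (dop S T)" by (rule bounded_dop[OF S(1) T(1)])
      show "(dop S T v, (v \<oplus>\<^bsub>N\<^esub> ?K v) \<oplus>\<^bsub>N\<^esub> l \<odot>\<^bsub>N\<^esub> dop S T v) \<in> opgraph N" if "v \<in> carrier N" for v
      proof -
        have "v' \<oplus>\<^bsub>H2\<^esub> \<zero>\<^bsub>H2\<^esub> = v'" if "v' \<in> carrier H2" for v'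
          using that by (intro B.vec_eqI) auto
        then show ?thesis using that SK T(2) by (simp add: opgraph_N p pK)
      qed
      show "compact_op N ?K"
      proof (rule N.compact_opI)
        show "bounded_op N ?K" by (rule bounded_dop[OF Kb B.bounded_op_zero])
        fix x :: "nat \<Rightarrow> 'c" assume x: "\<And>n. x n \<in> carrier N" "\<And>n. hnorm N (x n) \<le> 1"
        have y: "p1 (x n) \<in> carrier H1" "hnorm H1 (p1 (x n)) \<le> 1" for n
          using x(1)[of n] x(2)[of n] p1_norm_le[OF x(1)[of n]] by auto
        obtain r where r: "strict_mono r" "hcauchy H1 (\<lambda>n. K (p1 (x (r n))))"
          using A.compact_op_subseq[of K "\<lambda>n. p1 (x n)", OF K y] .
        have KH: "K (p1 (x n)) \<in> carrier H1" for n by (rule A.linear_map_onD(1)[OF Klin y(1)])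
        \<comment> \<open>\<open>?K\<close> is \<open>K\<close> on the first coordinate followed by
          the isometry \<open>i1\<close>, so Cauchy sequences transfer.\<close>
        have "hcauchy N (\<lambda>n. i1 (K (p1 (x (r n)))))"
          using r(2) intertwiner.j_hcauchy_iff[OF intertwiner_i1 KH] by simp
        then show "\<exists>r. strict_mono r \<and> hcauchy N (\<lambda>n. ?K (x (r n)))"
          using r(1) by (auto simp: i1_def dop_def)
      qed
    qed
  qed
  then show "ess_spectrum N (opgraph N) \<subseteq> ess_spectrum H1 Q1" by blast
qed

text \<open>The inverse on \<open>H2\<close> leaves no nonzero eigenvector for \<open>l\<close> in
  the copies, so all coordinates beyond the first vanish.\<close>

lemma eigenspace_N:
  assumes l: "l \<notin> spectrum H2 Q2"
  shows "eigenspace N (opgraph N) l = i1 ` eigenspace H1 Q1 l"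
proof
  show "i1 ` eigenspace H1 Q1 l \<subseteq> eigenspace N (opgraph N) l"
  proof clarify
    fix x assume x: "x \<in> eigenspace H1 Q1 l"
    then have xH: "x \<in> carrier H1" by (simp add: eigenspace_def)
    have "(i1 x, i1 (l \<odot>\<^bsub>H1\<^esub> x)) \<in> opgraph N" using x by (intro i1_Q) (simp add: eigenspace_def)
    then show "i1 x \<in> eigenspace N (opgraph N) l"
      using xH intertwiner.j_smult[OF intertwiner_i1 xH] by (simp add: eigenspace_def)
  qed
  obtain T where T: "bounded_op H2 T" "\<And>x y. (x, y) \<in> Q2 \<Longrightarrow> T (y \<ominus>\<^bsub>H2\<^esub> l \<odot>\<^bsub>H2\<^esub> x) = x"
    using l unfolding B.spectrum_iff by blast
  have zero: "x = \<zero>\<^bsub>H2\<^esub>" if x: "(x, l \<odot>\<^bsub>H2\<^esub> x) \<in> Q2" for x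
    using T(2)[OF x] T(2)[OF B.Q_zero] B.Q_in(1)[OF x] by simp
  show "eigenspace N (opgraph N) l \<subseteq> i1 ` eigenspace H1 Q1 l"
  proof
    fix x assume x: "x \<in> eigenspace N (opgraph N) l"
    then have xN: "x \<in> carrier N" and Q: "(p1 x, l \<odot>\<^bsub>H1\<^esub> p1 x) \<in> Q1"
      "\<And>n. (p2 x n, l \<odot>\<^bsub>H2\<^esub> p2 x n) \<in> Q2"
      by (auto simp: eigenspace_def opgraph_N)
    have "x = i1 (p1 x)" using xN zero[OF Q(2)] by (intro N_eqI) auto
    then show "x \<in> i1 ` eigenspace H1 Q1 l" using Q(1) xN by (auto simp: eigenspace_def)
  qed
qed

end

section \<open>Cardinalities\<close>

lemma ordLeq_realI: "inj_on f A \<Longrightarrow> |A| \<le>o |UNIV :: real set|" for f :: "'a \<Rightarrow> real"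
  using card_of_ordLeq[of A "UNIV :: real set"] by blast

lemma ordLeq_realE:
  assumes "|A| \<le>o |UNIV :: real set|"
  obtains f :: "'a \<Rightarrow> real" where "inj_on f A"
  using assms card_of_ordLeq[of A "UNIV :: real set"] by blast

lemma infinite_real: "infinite (UNIV :: real set)"
  by (rule infinite_UNIV_char_0)

text \<open>The continuum equals its countable power: each term is coded by a set of naturals, and
  the sequence of these sets by one set of encoded pairs.\<close>

lemma sequences_ordLeq_real:
  assumes "|X| \<le>o |UNIV :: real set|"
  shows "|{f :: nat \<Rightarrow> 'a. \<forall>n. f n \<in> X}| \<le>o |UNIV :: real set|"
proof -
  obtain g :: "'a \<Rightarrow> real" where g: "inj_on g X" using ordLeq_realE[OF assms] .
  obtain h :: "nat set \<Rightarrow> real" where h: "bij h"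
    using nat_sets_eqpoll_reals by (auto simp: eqpoll_def)
  define s where "s f = h {n. case prod_decode n of (i, k) \<Rightarrow> k \<in> inv_into UNIV h (g (f i))}" for f :: "nat \<Rightarrow> 'a"
  have "inj_on s {f. \<forall>n. f n \<in> X}"
  proof (rule inj_onI)
    fix f f' assume f: "f \<in> {f. \<forall>n. f n \<in> X}" "f' \<in> {f. \<forall>n. f n \<in> X}" and eq: "s f = s f'"
    have E: "{n. case prod_decode n of (i, k) \<Rightarrow> k \<in> inv_into UNIV h (g (f i))}
        = {n. case prod_decode n of (i, k) \<Rightarrow> k \<in> inv_into UNIV h (g (f' i))}"
      using eq bij_is_inj[OF h] by (simp add: s_def inj_eq)
    have "k \<in> inv_into UNIV h (g (f i)) \<longleftrightarrow> k \<in> inv_into UNIV h (g (f' i))" for i k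
      using arg_cong[OF E, of "\<lambda>A. prod_encode (i, k) \<in> A"] by simp
    then have "inv_into UNIV h (g (f i)) = inv_into UNIV h (g (f' i))" for i by blast
    then have "g (f i) = g (f' i)" for i
      using bij_is_surj[OF h] by (metis surj_f_inv_f)
    then show "f = f'" using g f by (auto simp: inj_on_def fun_eq_iff)
  qed
  then show ?thesis by (rule ordLeq_realI)
qed

lemma Un_ordLeq_real:
  assumes "|A| \<le>o |UNIV :: real set|" "|B| \<le>o |UNIV :: real set|"
  shows "|A \<union> B| \<le>o |UNIV :: real set|"
  by (rule card_of_Un_ordLeq_infinite_Field[OF _ assms card_of_Card_order])
    (simp add: Field_card_of infinite_real)

lemma complex_ordLeq_real: "|UNIV :: complex set| \<le>o |UNIV :: real set|"
proof -
  have "inj (\<lambda>z. (Re z, Im z))" by (auto simp: inj_def complex_eq_iff)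
  then have "|UNIV :: complex set| \<le>o |(UNIV :: real set) \<times> (UNIV :: real set)|"
    using card_of_ordLeq[of "UNIV :: complex set" "(UNIV :: real set) \<times> (UNIV :: real set)"] by auto
  also have "|(UNIV :: real set) \<times> (UNIV :: real set)| \<le>o |UNIV :: real set|"
    by (rule card_of_Sigma_ordLeq_infinite[OF infinite_real]) (simp_all add: card_of_mono1)
  finally show ?thesis .
qed

text \<open>The real line through \<open>v\<close> embeds into the carrier; applied to
  \<open>M0\<close>, this places the continuum below \<open>\<kappa>\<close>.\<close>

lemma (in complex_hilbert_space) real_ordLeq_carrier:
  assumes "v \<in> carrier H" "v \<noteq> \<zero>"
  shows "|UNIV :: real set| \<le>o |carrier H|"
proof -
  have "inj (\<lambda>r. of_real r \<odot> v)"
  proof (rule injI)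
    fix r s :: real assume "of_real r \<odot> v = of_real s \<odot> v"
    moreover have "of_real r \<odot> v \<ominus> of_real s \<odot> v = of_real (r - s) \<odot> v"
      using assms by (intro vec_eqI) (auto simp: algebra_simps)
    ultimately have "of_real (r - s) \<odot> v = \<zero>" using assms by simp
    then have "hnorm H (of_real (r - s) \<odot> v) = 0" by simp
    then have "\<bar>r - s\<bar> * hnorm H v = 0" using assms by (simp del: of_real_diff)
    then show "r = s" using assms by (simp add: hnorm_eq_0_iff)
  qed
  then show ?thesis
    using card_of_ordLeq[of "UNIV :: real set" "carrier H"] assms by blast
qed

section \<open>Cardinality of a singly generated reducing subspace\<close>

context selfadjoint_space
begin

primrec stage :: "'a \<Rightarrow> nat \<Rightarrow> 'a set" where
  "stage m 0 = {m}"
| "stage m (Suc n) = (\<lambda>(x, c, y). x \<oplus> c \<odot> y) ` (stage m n \<times> UNIV \<times> stage m n)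
    \<union> res H Q \<i> ` stage m n \<union> res H Q (-\<i>) ` stage m n"

lemma stage_in:
  assumes "m \<in> carrier H"
  shows "stage m n \<subseteq> carrier H"
  using assms by (induction n) auto

lemma stage_mono:
  assumes m: "m \<in> carrier H" and "n \<le> k"
  shows "stage m n \<subseteq> stage m k"
  using assms(2)
proof (induction rule: dec_induct)
  case (step k)
  have "x \<in> stage m (Suc k)" if x: "x \<in> stage m k" for x
  proof -
    have xH: "x \<in> carrier H" using x stage_in[OF m] by blast
    have "x = x \<oplus> 0 \<odot> x" using xH by (intro vec_eqI) auto
    then have "x \<in> (\<lambda>(x, c, y). x \<oplus> c \<odot> y) ` (stage m k \<times> UNIV \<times> stage m k)"
      using x by (intro image_eqI[of _ _ "(x, 0, x)"]) auto
    then show ?thesis by simp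
  qed
  then show ?case using step by blast
qed simp

lemma stage_card: "|stage m n| \<le>o |UNIV :: real set|"
proof (induction n)
  case 0
  show ?case by (rule ordLeq_realI[of "\<lambda>x. 0"]) simp
next
  case (Suc n)
  let ?R = "UNIV :: real set"
  have "|stage m n \<times> (UNIV :: complex set) \<times> stage m n| \<le>o |?R|"
    by (intro card_of_Sigma_ordLeq_infinite[OF infinite_real] ballI Suc complex_ordLeq_real)
  then have 1: "|(\<lambda>(x, c, y). x \<oplus> c \<odot> y) ` (stage m n \<times> UNIV \<times> stage m n)| \<le>o |?R|"
    by (rule ordLeq_transitive[OF card_of_image])
  have 2: "|f ` stage m n| \<le>o |?R|" for f :: "'a \<Rightarrow> 'a"
    by (rule ordLeq_transitive[OF card_of_image Suc])
  show ?case
    unfolding stage.simps by (intro Un_ordLeq_real 1 2)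
qed

text \<open>The closure of the union of the stages is reducing because resolvents are continuous.
  Every point of it is the limit of a sequence from the union, and limits are unique, so the number
  of sequences bounds the number of points.\<close>

lemma red_span_singleton_card:
  assumes m: "m \<in> carrier H"
  shows "|red_span {m}| \<le>o |UNIV :: real set|"
proof -
  define D where "D = (\<Union>n. stage m n)"
  have DH: "D \<subseteq> carrier H" using stage_in[OF m] by (auto simp: D_def)
  have lin: "x \<oplus> c \<odot> y \<in> D" if xy: "x \<in> D" "y \<in> D" for x y c
  proof -
    obtain n k where "x \<in> stage m n" "y \<in> stage m k" using xy by (auto simp: D_def)
    then have "x \<in> stage m (max n k)" "y \<in> stage m (max n k)"
      using stage_mono[OF m max.cobounded1[of n k]] stage_mono[OF m max.cobounded2[of k n]] by auto
    then have "x \<oplus> c \<odot> y \<in> stage m (Suc (max n k))" by force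
    then show ?thesis unfolding D_def by blast
  qed
  have mD: "m \<in> D" unfolding D_def using stage.simps(1) by blast
  have D0: "\<zero> \<in> D"
  proof -
    have "m \<oplus> (-1) \<odot> m = \<zero>" using m by (intro vec_eqI) auto
    then show ?thesis using lin[OF mD mD, of "-1"] by simp
  qed
  have add: "x \<oplus> y \<in> D" if "x \<in> D" "y \<in> D" for x y
    using lin[OF that, of 1] that DH by auto
  have smult: "c \<odot> x \<in> D" if "x \<in> D" for c x
  proof -
    have "\<zero> \<oplus> c \<odot> x = c \<odot> x" using that DH by (intro vec_eqI) auto
    then show ?thesis using lin[OF D0 that, of c] by simp
  qed
  have R: "res H Q \<i> x \<in> D" "res H Q (-\<i>) x \<in> D" if x: "x \<in> D" for x
  proof -
    obtain n where "x \<in> stage m n" using x by (auto simp: D_def)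
    then have "res H Q \<i> x \<in> stage m (Suc n)" "res H Q (-\<i>) x \<in> stage m (Suc n)" by auto
    then show "res H Q \<i> x \<in> D" "res H Q (-\<i>) x \<in> D" unfolding D_def by blast+
  qed
  let ?C = "htopology H closure_of D"
  note eq = closure_of_eq_seq[OF DH]
  have Rcl: "res H Q l x \<in> ?C" if x: "x \<in> ?C" and l: "l = \<i> \<or> l = -\<i>" for x l
  proof -
    obtain f where f: "\<forall>n. f n \<in> D" "hlim H f x" using x unfolding eq by blast
    have "hlim H (\<lambda>n. res H Q l (f n)) (res H Q l x)" by (rule res_lim[OF _ f(2)]) (use l in auto)
    moreover have "\<forall>n. res H Q l (f n) \<in> D" using f(1) R l by auto
    ultimately show ?thesis
      unfolding eq by (intro CollectI exI[of _ "\<lambda>n. res H Q l (f n)"] conjI)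
  qed
  have "reducing ?C"
    unfolding reducing_def
    using closed_subspace_closure_of[OF DH D0 add smult] Rcl by blast
  moreover have "{m} \<subseteq> ?C" using mD closure_of_subset[of D "htopology H"] DH by auto
  ultimately have sub: "red_span {m} \<subseteq> ?C" by (rule red_span_minimal)
  define s where "s x = (SOME f. (\<forall>n. f n \<in> D) \<and> hlim H f x)" for x
  have s: "(\<forall>n. s x n \<in> D) \<and> hlim H (s x) x" if "x \<in> ?C" for x
  proof -
    have "\<exists>f. (\<forall>n. f n \<in> D) \<and> hlim H f x" using that unfolding eq by (rule CollectD)
    then show ?thesis unfolding s_def by (rule someI_ex)
  qed
  have "inj_on s ?C"
  proof (rule inj_onI)
    fix x y assume "x \<in> ?C" "y \<in> ?C" "s x = s y"
    then show "x = y" using s[of x] s[of y] hlim_unique[of "s x" x y] by simp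
  qed
  then have "inj_on s (red_span {m})" by (rule inj_on_subset[OF _ sub])
  moreover have "s ` red_span {m} \<subseteq> {f. \<forall>n. f n \<in> D}" using s sub by blast
  ultimately have "|red_span {m}| \<le>o |{f :: nat \<Rightarrow> 'a. \<forall>n. f n \<in> D}|"
    using card_of_ordLeq[of "red_span {m}"] by blast
  moreover have "|D| \<le>o |UNIV :: real set|"
    unfolding D_def
    by (rule card_of_UNION_ordLeq_infinite[OF infinite_real])
      (auto intro: stage_card ordLeq_realI[of real] simp: inj_on_def)
  ultimately show ?thesis using sequences_ordLeq_real ordLeq_transitive by blast
qed

end

section \<open>Embeddings of structures\<close>

text \<open>The linear structure of a metric embedding is given only through addition, the scalar
  \<open>\<i>\<close> and rational scalars. Polarisation of the norm recovers the inner product, and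
  inner products recover all complex scalars.\<close>

lemma K_embedding_intertwiner:
  assumes N: "op_space N" and M: "op_space M" and f: "K_embedding N M f"
  shows "intertwiner N (opgraph N) M (opgraph M) f"
proof -
  interpret N: op_space N by (rule N)
  interpret M: op_space M by (rule M)
  have f_in: "f x \<in> carrier M" if "x \<in> carrier N" for x
    using f that by (auto simp: K_embedding_def metric_embedding_def)
  have f_add: "f (x \<oplus>\<^bsub>N\<^esub> y) = f x \<oplus>\<^bsub>M\<^esub> f y" if "x \<in> carrier N" "y \<in> carrier N" for x y
    using f that by (auto simp: K_embedding_def metric_embedding_def)
  have f_i: "f (\<i> \<odot>\<^bsub>N\<^esub> x) = \<i> \<odot>\<^bsub>M\<^esub> f x" if "x \<in> carrier N" for x
    using f that by (auto simp: K_embedding_def metric_embedding_def)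
  have f_norm: "hnorm M (f x) = hnorm N x" if "x \<in> carrier N" for x
    using f that by (auto simp: K_embedding_def metric_embedding_def)
  have Re: "Re (cinner M (f x) (f y)) = Re (cinner N x y)" if "x \<in> carrier N" "y \<in> carrier N" for x y
    using N.hnorm_add_sq[OF that] M.hnorm_add_sq[OF f_in f_in, OF that] f_norm[of "x \<oplus>\<^bsub>N\<^esub> y"] that
    by (simp add: f_add f_norm)
  have ip: "cinner M (f x) (f y) = cinner N x y" if xy: "x \<in> carrier N" "y \<in> carrier N" for x y
    using Re[OF xy] Re[of x "\<i> \<odot>\<^bsub>N\<^esub> y"] xy by (simp add: f_i f_in complex_eq_iff)
  have f_smult: "f (c \<odot>\<^bsub>N\<^esub> x) = c \<odot>\<^bsub>M\<^esub> f x" if x: "x \<in> carrier N" for c x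
  proof -
    let ?a = "f (c \<odot>\<^bsub>N\<^esub> x)" and ?b = "c \<odot>\<^bsub>M\<^esub> f x"
    have H: "?a \<in> carrier M" "?b \<in> carrier M" using x by (auto simp: f_in)
    have 1: "cinner M ?a (f x) = c * cinner N x x" "cinner M ?a ?a = c * cnj c * cinner N x x"
      "cinner M (f x) ?a = cnj c * cinner N x x"
      using x by (simp_all add: ip)
    \<comment> \<open>By \<open>ip\<close> the four terms in the squared norm of the difference are
      all \<open>c * cnj c\<close> times the same inner product, and they cancel.\<close>
    have "cinner M (?a \<ominus>\<^bsub>M\<^esub> ?b) (?a \<ominus>\<^bsub>M\<^esub> ?b) = 0"
      using x H by (simp add: 1 f_in) (simp add: ip)
    then have "?a \<ominus>\<^bsub>M\<^esub> ?b = \<zero>\<^bsub>M\<^esub>" using M.cinner_eq_zero_iff[OF M.diff_in[OF H]] by blast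
    then show ?thesis using H by (simp add: M.diff_eq_zero_iff)
  qed
  show ?thesis
  proof
    show "(f x, f y) \<in> opgraph M" if "(x, y) \<in> opgraph N" for x y
      using f that by (force simp: K_embedding_def prec_def image_structure_def)
  qed (use f_in f_add f_smult ip in auto)
qed

lemma intertwiner_comp:
  assumes "intertwiner A QA B QB j" "intertwiner B QB C QC k"
  shows "intertwiner A QA C QC (\<lambda>x. k (j x))"
proof -
  interpret J: intertwiner A QA B QB j by (rule assms)
  interpret K: intertwiner B QB C QC k by (rule assms)
  show ?thesis
    by unfold_locales (auto simp: J.j_add K.j_add J.j_smult K.j_smult J.j_Q K.j_Q)
qed

lemma unbounded_sa_structure_op_space: "unbounded_sa_structure M \<Longrightarrow> op_space M"
  by (simp add: unbounded_sa_structure_def op_space_def selfadjoint_space_def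
      selfadjoint_space_axioms_def)

lemma nonzero_of_unbounded:
  assumes "op_space M" "unbounded_operator M (opgraph M)"
  obtains v where "v \<in> carrier M" "v \<noteq> \<zero>\<^bsub>M\<^esub>"
proof -
  interpret op_space M by (rule assms)
  have "\<not> (\<forall>(x, y)\<in>opgraph M. hnorm M y \<le> 0 * hnorm M x)"
    using assms(2) unfolding unbounded_operator_def by blast
  then obtain x y where xy: "(x, y) \<in> opgraph M" "\<not> hnorm M y \<le> 0" by auto
  then have "y \<noteq> \<zero>\<^bsub>M\<^esub>" by auto
  then show ?thesis using that Q_in[OF xy(1)] by blast
qed

section \<open>Orthogonal copies of a reducing subspace\<close>

context op_space
begin

abbreviation sub_space :: "'a set \<Rightarrow> 'a op_structure" where
  "sub_space X \<equiv> M\<lparr>carrier := X\<rparr>"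

abbreviation sub_graph :: "'a set \<Rightarrow> ('a \<times> 'a) set" where
  "sub_graph X \<equiv> opgraph M \<inter> X \<times> X"

abbreviation emb :: "'a set \<Rightarrow> ('a \<Rightarrow> 'a) \<Rightarrow> bool" where
  "emb X j \<equiv> intertwiner (sub_space X) (sub_graph X) M (opgraph M) j"

lemma emb_id:
  assumes X: "reducing X"
  shows "emb X (\<lambda>x. x)"
proof -
  interpret S: selfadjoint_space "sub_space X" "sub_graph X" by (rule selfadjoint_subspace[OF X])
  show ?thesis by unfold_locales (use reducing_sub[OF X] in auto)
qed

text \<open>If \<open>X\<close> avoids the eigenspaces outside the essential spectrum, adding infinitely many
  copies of \<open>X\<close> to \<open>M0\<close> changes none of the spectral data, so universality provides
  infinitely many orthogonal copies of \<open>X\<close> in \<open>M\<close>.\<close>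

lemma orthogonal_copies:
  fixes M0 :: "'h op_structure" and \<kappa> :: "'k rel"
  assumes M0: "unbounded_sa_structure M0" and card: "|carrier M0| <o \<kappa>" "\<kappa> \<le>o |UNIV :: 'a set|"
    and MK: "M \<in> K_class M0" and univ: "K_universal M0 \<kappa> M"
    and X: "reducing X" "|X| \<le>o |UNIV :: real set|"
    and spec: "spectrum (sub_space X) (sub_graph X) \<subseteq> ess_spectrum M (opgraph M)"
  obtains k where "\<And>n::nat. emb X (k n)"
    "\<And>n n' a b. n \<noteq> n' \<Longrightarrow> a \<in> X \<Longrightarrow> b \<in> X \<Longrightarrow> cinner M (k n a) (k n' b) = 0"
proof -
  interpret S: selfadjoint_space "sub_space X" "sub_graph X" by (rule selfadjoint_subspace[OF X(1)])
  interpret Z: op_space M0 by (rule unbounded_sa_structure_op_space[OF M0])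
  have sim: "spectrum M (opgraph M) = spectrum M0 (opgraph M0)"
    "ess_spectrum M (opgraph M) = ess_spectrum M0 (opgraph M0)"
    "\<And>l. l \<in> spectrum M (opgraph M) - ess_spectrum M (opgraph M) \<Longrightarrow>
      same_dim M (eigenspace M (opgraph M) l) M0 (eigenspace M0 (opgraph M0) l)"
    using MK by (auto simp: K_class_def sim_sigma_def)
  obtain v where "v \<in> carrier M0" "v \<noteq> \<zero>\<^bsub>M0\<^esub>"
    by (rule nonzero_of_unbounded[OF Z.op_space_axioms])
      (use M0 in \<open>auto simp: unbounded_sa_structure_def\<close>)
  then have ctm: "|UNIV :: real set| \<le>o |carrier M0|" by (rule Z.real_ordLeq_carrier)
  have inf: "infinite (carrier M0)"
    using card_of_ordLeq_finite[OF ctm] infinite_real by blast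
  \<comment> \<open>The carrier of \<open>M0\<close> is infinite and at least as large as the
    continuum, so a factor of continuum size is absorbed.\<close>
  have "|carrier M0 \<times> {f :: nat \<Rightarrow> 'a. \<forall>n. f n \<in> X}| \<le>o |carrier M0|"
    by (intro card_of_Sigma_ordLeq_infinite[OF inf] ballI
        ordLeq_transitive[OF sequences_ordLeq_real[OF X(2)] ctm] card_of_mono1 subset_refl)
  moreover have "sum_carrier M0 (sub_space X) \<subseteq> carrier M0 \<times> {f. \<forall>n. f n \<in> X}"
    by (auto simp: sum_carrier_def)
  ultimately have cle: "|sum_carrier M0 (sub_space X)| \<le>o |carrier M0|"
    using ordLeq_transitive[OF card_of_mono1] by blast
  have "|sum_carrier M0 (sub_space X)| \<le>o |UNIV :: 'a set|"
    using ordLeq_transitive[OF cle ordLeq_transitive[OF ordLess_imp_ordLeq[OF card(1)] card(2)]] .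
  then obtain \<phi> :: "'h \<times> (nat \<Rightarrow> 'a) \<Rightarrow> 'a" where \<phi>: "inj_on \<phi> (sum_carrier M0 (sub_space X))"
    using card_of_ordLeq[of "sum_carrier M0 (sub_space X)" "UNIV :: 'a set"] by blast
  interpret D: direct_sum M0 "opgraph M0" "sub_space X" "sub_graph X" \<phi>
    by unfold_locales (rule \<phi>)
  interpret I: intertwiner M0 "opgraph M0" D.N "opgraph D.N" D.i1 by (rule D.intertwiner_i1)
  have sub: "spectrum (sub_space X) (sub_graph X) \<subseteq> ess_spectrum M0 (opgraph M0)"
    using spec sim(2) by simp
  have "sim_sigma D.N M0"
    unfolding sim_sigma_def
  proof (intro conjI ballI)
    show s: "spectrum D.N (opgraph D.N) = spectrum M0 (opgraph M0)" by (rule D.spectrum_N[OF sub])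
    show e: "ess_spectrum D.N (opgraph D.N) = ess_spectrum M0 (opgraph M0)"
      by (rule D.ess_spectrum_N[OF sub])
    fix l assume l: "l \<in> spectrum D.N (opgraph D.N) - ess_spectrum D.N (opgraph D.N)"
    then have "same_dim M (eigenspace M (opgraph M) l) M0 (eigenspace M0 (opgraph M0) l)"
      by (intro sim(3)) (simp add: s e sim)
    \<comment> \<open>Equal dimension of an eigenspace with itself still needs an orthonormal basis;
      the one witnessing that \<open>M\<close> is in the class is reused.\<close>
    then obtain B where "orthonormal_basis M0 (eigenspace M0 (opgraph M0) l) B"
      by (auto simp: same_dim_def)
    then have "same_dim M0 (eigenspace M0 (opgraph M0) l) M0 (eigenspace M0 (opgraph M0) l)"
      unfolding same_dim_def using card_of_refl by blast
    then have "same_dim D.N (D.i1 ` eigenspace M0 (opgraph M0) l) M0 (eigenspace M0 (opgraph M0) l)"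
      by (intro I.same_dim_image) (auto simp: eigenspace_def)
    moreover have "l \<notin> spectrum (sub_space X) (sub_graph X)" using l sub e by blast
    ultimately show "same_dim D.N (eigenspace D.N (opgraph D.N) l) M0 (eigenspace M0 (opgraph M0) l)"
      by (simp add: D.eigenspace_N)
  qed
  moreover have "unbounded_operator D.N (opgraph D.N)"
    unfolding unbounded_operator_def
  proof
    assume "\<exists>C. \<forall>(x, y)\<in>opgraph D.N. hnorm D.N y \<le> C * hnorm D.N x"
    then obtain C where C: "\<And>x y. (x, y) \<in> opgraph D.N \<Longrightarrow> hnorm D.N y \<le> C * hnorm D.N x" by auto
    have "hnorm M0 y \<le> C * hnorm M0 x" if xy: "(x, y) \<in> opgraph M0" for x y
      using C[OF D.i1_Q[OF xy]] Z.Q_in[OF xy] by simp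
    then have "\<exists>C. \<forall>(x, y)\<in>opgraph M0. hnorm M0 y \<le> C * hnorm M0 x" by auto
    then show False using M0 by (simp add: unbounded_sa_structure_def unbounded_operator_def)
  qed
  ultimately have NK: "D.N \<in> K_class M0"
    by (simp add: K_class_def unbounded_sa_structure_def D.hilbert_N D.N.sa D.N.closed_operator)
  have "|carrier D.N| \<le>o |sum_carrier M0 (sub_space X)|"
    by (simp add: D.N_def card_of_image)
  then have "|carrier D.N| <o \<kappa>"
    using cle card(1) ordLeq_transitive ordLeq_ordLess_trans by blast
  then obtain f where f: "K_embedding D.N M f"
    using univ NK unfolding K_universal_def by blast
  have "op_space D.N" by (simp add: op_space_def D.N.selfadjoint_space_axioms)
  then interpret F: intertwiner D.N "opgraph D.N" M "opgraph M" f
    using K_embedding_intertwiner f op_space_axioms by blast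
  show ?thesis
  proof (rule that[of "\<lambda>n x. f (D.i2 n x)"])
    show "emb X (\<lambda>x. f (D.i2 n x))" for n
      by (rule intertwiner_comp[OF D.intertwiner_i2 F.intertwiner_axioms])
    show "cinner M (f (D.i2 n a)) (f (D.i2 n' b)) = 0" if "n \<noteq> n'" "a \<in> X" "b \<in> X" for n n' a b
      using that D.i2_orth by simp
  qed
qed

text \<open>Copies are recorded as maps, not as ranges, so that each carries its identification with
  \<open>X\<close> and automorphisms can be asked to match vectors pointwise. For nonzero
  \<open>X\<close>, distinct members differ already on \<open>X\<close>, as agreement there would
  make a copy orthogonal to itself.\<close>

definition orth_family :: "'a set \<Rightarrow> ('a \<Rightarrow> 'a) set \<Rightarrow> bool" where
  "orth_family X Y \<longleftrightarrow> (\<forall>j\<in>Y. emb X j) \<and>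
    (\<forall>j\<in>Y. \<forall>k\<in>Y. j \<noteq> k \<longrightarrow> (\<forall>a\<in>X. \<forall>b\<in>X. cinner M (j a) (k b) = 0))"

lemma emb_facts:
  assumes "emb X j"
  shows "a \<in> X \<Longrightarrow> j a \<in> carrier M" "a \<in> X \<Longrightarrow> b \<in> X \<Longrightarrow> cinner M (j a) (j b) = cinner M a b"
  using intertwiner.j_in[OF assms, of a] intertwiner.j_cinner[OF assms, of a b] by auto

text \<open>Built one member at a time by composing with the exchange of \<open>\<pi> j\<close> and
  \<open>\<psi> j\<close>. The map \<open>\<pi>\<close> records where the automorphism sends every
  member of the family, also outside \<open>F\<close>, because later exchanges act on those
  too.\<close>

lemma orth_family_permutation:
  assumes Y: "orth_family X Y"
    and F: "finite F" "F \<subseteq> Y" "inj_on \<psi> F" "\<psi> ` F \<subseteq> Y"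
  shows "\<exists>U \<pi>. automorphism M U \<and> inj_on \<pi> Y \<and> \<pi> ` Y \<subseteq> Y \<and>
    (\<forall>j\<in>Y. \<forall>x\<in>X. U (j x) = \<pi> j x) \<and> (\<forall>j\<in>F. \<pi> j = \<psi> j)"
  using F
proof (induction F rule: finite_induct)
  case empty
  show ?case
    by (rule exI[of _ "\<lambda>x. x"], rule exI[of _ "\<lambda>j. j"]) (auto simp: automorphism_id)
next
  case (insert j F)
  obtain U \<pi> where U: "automorphism M U" and \<pi>: "inj_on \<pi> Y" "\<pi> ` Y \<subseteq> Y"
    and U\<pi>: "\<And>j x. j \<in> Y \<Longrightarrow> x \<in> X \<Longrightarrow> U (j x) = \<pi> j x" and \<pi>F: "\<And>j. j \<in> F \<Longrightarrow> \<pi> j = \<psi> j"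
    using insert by auto
  have jY: "j \<in> Y" "\<psi> j \<in> Y" "\<pi> j \<in> Y" using insert.prems \<pi> by auto
  define b where "b = \<pi> j"
  define c where "c = \<psi> j"
  have embs: "emb X k" if "k \<in> Y" for k using Y that by (auto simp: orth_family_def)
  show ?case
  proof (cases "b = c")
    case True
    then show ?thesis
      using U \<pi> U\<pi> \<pi>F by (intro exI[of _ U] exI[of _ \<pi>]) (auto simp: b_def c_def)
  next
    case False
    have bY: "b \<in> Y" "c \<in> Y" using jY by (auto simp: b_def c_def)
    have orth: "cinner M (b x) (c y) = 0"
      if "x \<in> carrier (sub_space X)" "y \<in> carrier (sub_space X)" for x y
      using Y bY False that by (simp add: orth_family_def)
    obtain S where S: "automorphism M S" "\<forall>a\<in>carrier (sub_space X). S (b a) = c a"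
      "\<forall>a\<in>carrier (sub_space X). S (c a) = b a"
      "\<forall>z\<in>carrier M. (\<forall>a\<in>carrier (sub_space X). cinner M z (b a) = 0) \<longrightarrow>
       (\<forall>a\<in>carrier (sub_space X). cinner M z (c a) = 0) \<longrightarrow> S z = z"
      using swap_automorphism[OF embs[OF bY(1)] embs[OF bY(2)] orth] .
    \<comment> \<open>Members other than \<open>b\<close> and \<open>c\<close> have ranges
      orthogonal to both, so the exchange fixes them.\<close>
    have Sk: "S (k x) = k x" if "k \<in> Y" "k \<noteq> b" "k \<noteq> c" "x \<in> X" for k x
      using S(4) that Y bY emb_facts(1)[OF embs[OF that(1)] that(4)] by (simp add: orth_family_def)
    define t where "t k = (if k = b then c else if k = c then b else k)" for k
    have St: "S (k x) = t k x" if "k \<in> Y" "x \<in> X" for k x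
      using that S(2,3) Sk by (auto simp: t_def)
    have t: "t k \<in> Y" if "k \<in> Y" for k using that bY by (auto simp: t_def)
    have t_inj: "inj t" by (auto simp: inj_def t_def split: if_splits)
    \<comment> \<open>The exchange leaves the values on \<open>F\<close> alone:
      \<open>\<pi> k\<close> differs from \<open>b\<close> by injectivity of \<open>\<pi>\<close>,
      and \<open>\<psi> k\<close> from \<open>c\<close> by injectivity of
      \<open>\<psi>\<close>.\<close>
    have "t (\<pi> k) = \<psi> k" if "k \<in> insert j F" for k
    proof (cases "k = j")
      case True
      then show ?thesis by (simp add: t_def b_def c_def)
    next
      case False
      then have k: "k \<in> F" "k \<in> Y" using that insert.prems by auto
      have "\<pi> k \<noteq> b" using \<pi>(1) k jY False by (auto simp: b_def inj_on_def)
      moreover have "\<psi> k \<noteq> c" using insert.prems(2) k False by (auto simp: c_def inj_on_def)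
      ultimately show ?thesis using \<pi>F[OF k(1)] by (simp add: t_def)
    qed
    moreover have "S (U (k x)) = t (\<pi> k) x" if "k \<in> Y" "x \<in> X" for k x
      using U\<pi>[OF that] St[of "\<pi> k" x] that \<pi>(2) by auto
    moreover have "inj_on (\<lambda>k. t (\<pi> k)) Y" using \<pi>(1) t_inj by (auto simp: inj_on_def inj_def)
    moreover have "(\<lambda>k. t (\<pi> k)) ` Y \<subseteq> Y" using \<pi>(2) t by auto
    ultimately show ?thesis
      using automorphism_comp[OF S(1) U]
      by (intro exI[of _ "\<lambda>x. S (U x)"] exI[of _ "\<lambda>k. t (\<pi> k)"]) auto
  qed
qed

text \<open>A maximal orthogonal family of copies of \<open>X\<close> cannot be small: homogeneity would
  extend an injection of the family onto a proper part of itself to an automorphism, whose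
  inverse produces one more orthogonal copy.\<close>

lemma large_orth_family:
  fixes M0 :: "'h op_structure" and \<kappa> :: "'k rel"
  assumes \<kappa>: "Card_order \<kappa>" "|UNIV :: real set| <o \<kappa>"
    and MK: "M \<in> K_class M0" and hom: "K_homogeneous M0 \<kappa> M"
    and X: "reducing X" "|X| \<le>o |UNIV :: real set|" and m: "m \<in> X" "m \<noteq> \<zero>"
    and k: "\<And>n::nat. emb X (k n)"
      "\<And>n n' a b. n \<noteq> n' \<Longrightarrow> a \<in> X \<Longrightarrow> b \<in> X \<Longrightarrow> cinner M (k n a) (k n' b) = 0"
  obtains Y where "orth_family X Y" "\<not> |Y| <o \<kappa>"
proof -
  have mH: "m \<in> carrier M" using reducing_sub[OF X(1)] m by auto
  have mm: "cinner M m m \<noteq> 0" using mH m cinner_eq_zero_iff by blast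
  have Y0: "orth_family X (range k)"
    unfolding orth_family_def using k by (auto simp: image_iff) metis
  have "inj k"
  proof (rule injI, rule ccontr)
    fix n n' assume "k n = k n'" "n \<noteq> n'"
    then have "cinner M (k n m) (k n m) = 0" using k(2)[of n n' m m] m by simp
    then show False using emb_facts(2)[OF k(1) m(1) m(1)] mm by simp
  qed
  then have Y0inf: "infinite (range k)" using finite_imageD infinite_UNIV_nat by blast
  \<comment> \<open>Requiring \<open>range k\<close> makes the maximal family infinite, which the
    bijection with a proper part needs.\<close>
  let ?A = "{Y. orth_family X Y \<and> range k \<subseteq> Y}"
  have "\<exists>Y\<in>?A. \<forall>Y'\<in>?A. Y \<subseteq> Y' \<longrightarrow> Y' = Y"
  proof (rule subset_Zorn_nonempty)
    show "?A \<noteq> {}" using Y0 by blast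
    fix C assume C: "C \<noteq> {}" "subset.chain ?A C"
    have fam: "orth_family X Y" "range k \<subseteq> Y" if "Y \<in> C" for Y
      using C(2) that by (auto simp: subset_chain_def)
    have "orth_family X (\<Union>C)"
      unfolding orth_family_def
    proof (intro conjI ballI impI)
      show "emb X j" if "j \<in> \<Union>C" for j using that fam(1) by (auto simp: orth_family_def)
      fix j l a b assume j: "j \<in> \<Union>C" and l: "l \<in> \<Union>C" and ne: "j \<noteq> l" and ab: "a \<in> X" "b \<in> X"
      obtain Y1 Y2 where Y12: "j \<in> Y1" "Y1 \<in> C" "l \<in> Y2" "Y2 \<in> C" using j l by blast
      then have "Y1 \<subseteq> Y2 \<or> Y2 \<subseteq> Y1" using C(2) by (auto simp: subset_chain_def)
      then obtain Y where "j \<in> Y" "l \<in> Y" "Y \<in> C" using Y12 by blast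
      then show "cinner M (j a) (l b) = 0" using fam(1)[of Y] ne ab by (simp add: orth_family_def)
    qed
    moreover have "range k \<subseteq> \<Union>C" using C(1) fam(2) by blast
    ultimately show "\<Union>C \<in> ?A" by blast
  qed
  then obtain Y where YA: "Y \<in> ?A" and Ymax: "\<forall>Y'\<in>?A. Y \<subseteq> Y' \<longrightarrow> Y' = Y" by (rule bexE)
  have Y: "orth_family X Y" "range k \<subseteq> Y" using YA by auto
  have max: "Y' = Y" if "orth_family X Y'" "Y \<subseteq> Y'" for Y'
    using Ymax that Y(2) by simp
  have Yinf: "infinite Y" using Y0inf Y(2) finite_subset by blast
  have "\<not> |Y| <o \<kappa>"
  proof
    assume small: "|Y| <o \<kappa>"
    have infF: "infinite (Field \<kappa>)"
    proof
      assume "finite (Field \<kappa>)"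
      moreover have "|UNIV :: real set| \<le>o |Field \<kappa>|"
        using ordLess_imp_ordLeq[OF \<kappa>(2)] card_of_Field_ordIso[OF \<kappa>(1)] ordIso_symmetric ordLeq_ordIso_trans
        by blast
      ultimately show False using card_of_ordLeq_finite infinite_real by blast
    qed
    \<comment> \<open>The tuple to be moved consists of all vectors of all copies, so its length is
      \<open>|Y \<times> X|\<close>; it must be below \<open>\<kappa>\<close> for homogeneity to
      apply.\<close>
    have "|Y \<times> X| \<le>o |Y <+> (UNIV :: real set)|"
      by (rule card_of_Sigma_ordLeq_infinite)
        (auto simp: Yinf card_of_Plus1 intro: ordLeq_transitive[OF X(2) card_of_Plus2])
    moreover have "|Y <+> (UNIV :: real set)| <o \<kappa>"
      by (rule card_of_Plus_ordLess_infinite_Field[OF infF \<kappa>(1) small \<kappa>(2)])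
    ultimately have "|Y \<times> X| <o \<kappa>" by (rule ordLeq_ordLess_trans)
    then obtain i where i: "i \<in> Field \<kappa>" "|Y \<times> X| =o Restr \<kappa> (underS \<kappa> i)"
      using ordLess_iff_ordIso_Restr[of \<kappa> "|Y \<times> X|"] \<kappa>(1) card_of_Well_order
      by (auto simp: card_order_on_def)
    have "Field (Restr \<kappa> (underS \<kappa> i)) = underS \<kappa> i"
    proof (rule Refl_Field_Restr2)
      show "Refl \<kappa>" using \<kappa>(1) by (simp add: card_order_on_def order_on_defs)
      show "underS \<kappa> i \<subseteq> Field \<kappa>" by (auto simp: underS_def Field_def)
    qed
    then have "|Y \<times> X| =o |underS \<kappa> i|"
      using card_of_cong[OF i(2)] by (simp add: Field_card_of)
    then obtain h where h: "bij_betw h (underS \<kappa> i) (Y \<times> X)"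
      using card_of_ordIso[of "underS \<kappa> i" "Y \<times> X"] ordIso_symmetric by blast
    \<comment> \<open>An infinite family is in bijection with itself minus one member;
      \<open>y0\<close> is the member left out.\<close>
    obtain y0 where y0: "y0 \<in> Y" using Yinf by fastforce
    obtain \<psi> where \<psi>: "bij_betw \<psi> Y (Y - {y0})"
      using infinite_imp_bij_betw[OF Yinf] by blast
    define a where "a s = fst (h s) (snd (h s))" for s
    define b where "b s = \<psi> (fst (h s)) (snd (h s))" for s
    have hs: "fst (h s) \<in> Y" "snd (h s) \<in> X" if "s \<in> underS \<kappa> i" for s
      using bij_betwE[OF h] that by (auto simp: mem_Times_iff)
    have \<psi>Y: "\<psi> j \<in> Y" "\<psi> j \<noteq> y0" if "j \<in> Y" for j using bij_betwE[OF \<psi>] that by auto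
    have embs: "emb X j" if "j \<in> Y" for j using Y that by (auto simp: orth_family_def)
    \<comment> \<open>A finite subtuple meets finitely many copies, so an automorphism of
      \<open>M\<close> realising a finite part of \<open>\<psi>\<close> gives equality of Galois
      types, with \<open>M\<close> as amalgam.\<close>
    have fin: "same_gatp M0 M a M b F {}" if F: "finite F" "F \<subseteq> underS \<kappa> i" for F
    proof -
      let ?F = "(\<lambda>s. fst (h s)) ` F"
      have F': "finite ?F" "?F \<subseteq> Y" "\<psi> ` ?F \<subseteq> Y" using F hs \<psi>Y by auto
      have "inj_on \<psi> ?F" using \<psi> inj_on_subset[OF _ F'(2)] by (auto simp: bij_betw_def)
      from orth_family_permutation[OF Y(1) F'(1,2) this F'(3)]
      obtain U \<pi> where U: "automorphism M U" "\<forall>j\<in>Y. \<forall>x\<in>X. U (j x) = \<pi> j x"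
        "\<forall>j\<in>?F. \<pi> j = \<psi> j"
        by (elim exE conjE) (rule that)
      have "U (a s) = b s" if "s \<in> F" for s
        using that F hs[of s] U(2,3) by (auto simp: a_def b_def)
      then show ?thesis
        unfolding same_gatp_def
        using MK K_embedding_automorphism[OF U(1)] K_embedding_automorphism[OF automorphism_id]
        by (intro bexI[of _ M] exI[of _ U] exI[of _ "\<lambda>x. x"]) auto
    qed
    have "a ` underS \<kappa> i \<subseteq> carrier M" "b ` underS \<kappa> i \<subseteq> carrier M"
      using hs \<psi>Y emb_facts(1)[OF embs] by (auto simp: a_def b_def)
    then have "\<exists>U. automorphism M U \<and> (\<forall>s\<in>underS \<kappa> i. U (a s) = b s)"
      by (intro mp[OF spec[OF spec[OF bspec[OF hom[unfolded K_homogeneous_def] i(1)]]]])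
        (auto intro: fin)
    then obtain U where U: "automorphism M U" "\<forall>s\<in>underS \<kappa> i. U (a s) = b s" by blast
    have U\<psi>: "U (j x) = \<psi> j x" if jx: "j \<in> Y" "x \<in> X" for j x
    proof -
      obtain s where "s \<in> underS \<kappa> i" "h s = (j, x)"
        using h jx by (metis bij_betw_iff_bijections mem_Sigma_iff)
      then show ?thesis using U(2) by (force simp: a_def b_def)
    qed
    \<comment> \<open>\<open>U\<close> carries the copies in \<open>Y\<close> to those in
      \<open>Y\<close> without \<open>y0\<close>, and \<open>y0\<close> is orthogonal to these;
      pulled back by \<open>U\<close> it is orthogonal to all of \<open>Y\<close>.\<close>
    define j0 where "j0 = (\<lambda>x. ainv U (y0 x))"
    have j0: "emb X j0"
      unfolding j0_def
      by (rule intertwiner_comp[OF embs[OF y0] automorphism_intertwiner[OF automorphism_ainv[OF U(1)]]])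
    have j0_orth: "cinner M (j0 x) (j y) = 0" if "j \<in> Y" "x \<in> X" "y \<in> X" for j x y
    proof -
      have "cinner M (j0 x) (j y) = cinner M (y0 x) (\<psi> j y)"
        unfolding j0_def using cinner_ainv[OF U(1)] emb_facts(1)[OF embs] y0 that U\<psi> by simp
      also have "\<dots> = 0" using Y(1) y0 \<psi>Y[OF that(1)] that by (auto simp: orth_family_def)
      finally show ?thesis .
    qed
    have j0_orth': "cinner M (j y) (j0 x) = 0" if "j \<in> Y" "x \<in> X" "y \<in> X" for j x y
      using j0_orth[OF that] cinner_commute[of "j y" "j0 x"] emb_facts(1)[OF embs] emb_facts(1)[OF j0] that
      by simp
    have "orth_family X (insert j0 Y)"
      unfolding orth_family_def
    proof (intro conjI ballI impI)
      show "emb X j" if "j \<in> insert j0 Y" for j using that j0 embs by blast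
      fix j l x y assume jl: "j \<in> insert j0 Y" "l \<in> insert j0 Y" "j \<noteq> l" and xy: "x \<in> X" "y \<in> X"
      have "cinner M (j x) (l y) = 0" if "j \<in> Y" "l \<in> Y"
        using Y(1) that jl(3) xy by (simp add: orth_family_def)
      then show "cinner M (j x) (l y) = 0" using jl xy j0_orth j0_orth' by auto
    qed
    then have "insert j0 Y = Y" by (intro max) auto
    then have "j0 \<in> Y" by blast
    \<comment> \<open>\<open>j0_orth\<close> has no distinctness condition, so membership in
      \<open>Y\<close> makes \<open>j0\<close> orthogonal to itself.\<close>
    then have "cinner M (j0 m) (j0 m) = 0" using j0_orth m by blast
    then show False using emb_facts(2)[OF j0 m(1) m(1)] mm by simp
  qed
  then show ?thesis using that Y(1) by blast
qed

text \<open>By Bessel's inequality only finitely many of the projections of \<open>g\<close> have norm above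
  \<open>1 / (n + 1)\<close>.\<close>

lemma orth_family_countable:
  assumes Y: "orth_family X Y" and X: "reducing X" and g: "g \<in> carrier M"
  shows "countable {j \<in> Y. \<exists>x\<in>X. cinner M g (j x) \<noteq> 0}"
proof -
  have embs: "emb X j" if "j \<in> Y" for j using Y that by (auto simp: orth_family_def)
  define P where "P j = proj M (j ` X) g" for j
  have red: "reducing (j ` X)" if "j \<in> Y" for j
    using intertwiner.reducing_range[OF embs[OF that]] by simp
  note C = reducing_closed_subspace[OF red]
  have PX: "P j \<in> j ` X" "P j \<in> carrier M" if "j \<in> Y" for j
    unfolding P_def using proj_mem[OF C[OF that] g] proj_in[OF C[OF that] g] by auto
  have Porth: "cinner M (P j) (P l) = 0" if "j \<in> Y" "l \<in> Y" "j \<noteq> l" for j l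
    using PX(1)[OF that(1)] PX(1)[OF that(2)] Y that by (auto simp: orth_family_def)
  have Pg: "cinner M g (P j) = of_real ((hnorm M (P j))\<^sup>2)" if "j \<in> Y" for j
    using cinner_proj[OF C[OF that] g PX(1)[OF that]] cinner_self[OF PX(2)[OF that]]
    by (simp add: P_def)
  \<comment> \<open>\<open>w\<close> is \<open>g\<close> minus its projections to the copies in
    \<open>F\<close>; inner products with the remaining projections are unchanged, which carries the
    induction. That the squared norm of \<open>w\<close> is nonnegative is Bessel's
    inequality.\<close>
  have bessel: "\<exists>w\<in>carrier M. (\<forall>j\<in>Y - F. cinner M w (P j) = cinner M g (P j)) \<and>
      (hnorm M w)\<^sup>2 = (hnorm M g)\<^sup>2 - (\<Sum>j\<in>F. (hnorm M (P j))\<^sup>2)"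
    if "finite F" "F \<subseteq> Y" for F
    using that
  proof (induction F rule: finite_induct)
    case empty
    show ?case by (rule bexI[of _ g]) (use g in auto)
  next
    case (insert j F)
    then obtain w where w: "w \<in> carrier M" "\<And>l. l \<in> Y - F \<Longrightarrow> cinner M w (P l) = cinner M g (P l)"
      "(hnorm M w)\<^sup>2 = (hnorm M g)\<^sup>2 - (\<Sum>j\<in>F. (hnorm M (P j))\<^sup>2)" by auto
    have jY: "j \<in> Y" using insert.prems by auto
    have wj: "cinner M w (P j) = of_real ((hnorm M (P j))\<^sup>2)"
      using w(2)[of j] Pg[OF jY] jY insert.hyps by auto
    have "(hnorm M (w \<ominus> P j))\<^sup>2 = (hnorm M w)\<^sup>2 - (hnorm M (P j))\<^sup>2"
      using w(1) PX(2)[OF jY] by (simp add: hnorm_diff_sq wj del: of_real_power)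
    moreover have "cinner M (w \<ominus> P j) (P l) = cinner M g (P l)" if "l \<in> Y - insert j F" for l
      using that w(1) w(2)[of l] PX(2)[OF jY] PX(2)[of l] Porth[OF jY, of l] by auto
    ultimately show ?case
      using w(1,3) PX(2)[OF jY] insert.hyps by (intro bexI[of _ "w \<ominus> P j"]) auto
  qed
  have "finite {j \<in> Y. hnorm M (P j) > 1 / (real n + 1)}" for n
  proof (rule ccontr)
    let ?S = "{j \<in> Y. hnorm M (P j) > 1 / (real n + 1)}"
    define e where "e = (1 / (real n + 1))\<^sup>2"
    have e: "e > 0" by (simp add: e_def)
    \<comment> \<open>\<open>N\<close> squared norms of at least \<open>e\<close> already exceed the
      squared norm of \<open>g\<close>.\<close>
    obtain N :: nat where N: "(hnorm M g)\<^sup>2 < real N * e" using reals_Archimedean3[OF e] by blast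
    assume "infinite ?S"
    then obtain F where F: "finite F" "card F = N" "F \<subseteq> ?S" using infinite_arbitrarily_large by blast
    have "F \<subseteq> Y" using F(3) by auto
    then obtain w where w: "w \<in> carrier M" "(hnorm M w)\<^sup>2 = (hnorm M g)\<^sup>2 - (\<Sum>j\<in>F. (hnorm M (P j))\<^sup>2)"
      using bessel[OF F(1)] by blast
    have "real N * e = (\<Sum>j\<in>F. e)" using F by simp
    also have "\<dots> \<le> (\<Sum>j\<in>F. (hnorm M (P j))\<^sup>2)"
      unfolding e_def by (intro sum_mono power_mono) (use F(3) in auto)
    finally show False using w N zero_le_power2[of "hnorm M w"] by linarith
  qed
  moreover have "{j \<in> Y. \<exists>x\<in>X. cinner M g (j x) \<noteq> 0} \<subseteq> (\<Union>n. {j \<in> Y. hnorm M (P j) > 1 / (real n + 1)})"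
  proof
    fix j assume "j \<in> {j \<in> Y. \<exists>x\<in>X. cinner M g (j x) \<noteq> 0}"
    then obtain x where j: "j \<in> Y" and x: "x \<in> X" "cinner M g (j x) \<noteq> 0" by blast
    have "cinner M (P j) (j x) = cinner M g (j x)"
      unfolding P_def by (rule cinner_proj[OF C[OF j] g]) (use x in blast)
    then have "P j \<noteq> \<zero>" using x emb_facts(1)[OF embs[OF j] x(1)] by auto
    then have "hnorm M (P j) > 0"
      using PX(2)[OF j] hnorm_eq_0_iff[OF PX(2)[OF j]] hnorm_ge_0[OF PX(2)[OF j]] by linarith
    then obtain n where "inverse (real (Suc n)) < hnorm M (P j)" using reals_Archimedean by blast
    then have "hnorm M (P j) > 1 / (real n + 1)" by (simp add: inverse_eq_divide add.commute)
    then show "j \<in> (\<Union>n. {j \<in> Y. hnorm M (P j) > 1 / (real n + 1)})" using j by blast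
  qed
  ultimately show ?thesis
    by (meson countable_UN countable_finite countable_subset countableI_type)
qed

text \<open>The two orthogonality hypotheses act separately. The one to \<open>precompact {}\<close>
  frees \<open>X\<close> from eigenvectors that cannot be multiplied; the one to
  \<open>dcl M G\<close>, which contains \<open>G\<close>, makes the exchange of \<open>X\<close>
  with another copy fix \<open>G\<close>.\<close>

lemma precompact_orth_zero:
  fixes M0 :: "'h op_structure" and \<kappa> :: "'k rel"
  assumes M0: "unbounded_sa_structure M0" and \<kappa>: "Card_order \<kappa>"
    and card: "|carrier M0| <o \<kappa>" "\<kappa> \<le>o |UNIV :: 'a set|"
    and mon: "monster_model M0 \<kappa> M"
    and G: "G \<subseteq> carrier M" "|G| <o \<kappa>"
    and m: "m \<in> precompact G" "m \<in> orth M (dcl M G)" "m \<in> orth M (precompact {})"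
  shows "m = \<zero>"
proof (rule ccontr)
  assume m0: "m \<noteq> \<zero>"
  have mH: "m \<in> carrier M" by (rule precompact_in[OF m(1)])
  have MK: "M \<in> K_class M0" and univ: "K_universal M0 \<kappa> M" and hom: "K_homogeneous M0 \<kappa> M"
    using mon by (auto simp: monster_model_def)
  interpret Z: op_space M0 by (rule unbounded_sa_structure_op_space[OF M0])
  obtain v where "v \<in> carrier M0" "v \<noteq> \<zero>\<^bsub>M0\<^esub>"
    by (rule nonzero_of_unbounded[OF Z.op_space_axioms])
      (use M0 in \<open>auto simp: unbounded_sa_structure_def\<close>)
  then have ctm: "|UNIV :: real set| <o \<kappa>"
    using Z.real_ordLeq_carrier card(1) ordLeq_ordLess_trans by blast
  define X where "X = red_span {m}"
  have X: "reducing X" unfolding X_def by (rule reducing_red_span) (use mH in simp)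
  have mX: "m \<in> X" unfolding X_def using red_span_superset[of "{m}"] by blast
  have Xcard: "|X| \<le>o |UNIV :: real set|" unfolding X_def by (rule red_span_singleton_card[OF mH])
  have dclH: "dcl M G \<subseteq> carrier M" by (auto simp: dcl_def)
  \<comment> \<open>Complements of resolvent-invariant sets are reducing, so the orthogonality of
    \<open>m\<close> spreads to all of \<open>X\<close>.\<close>
  have "reducing (orth M (dcl M G))"
    by (rule reducing_orth[OF dclH]) (auto intro: res_dcl)
  then have Xdcl: "X \<subseteq> orth M (dcl M G)" unfolding X_def by (rule red_span_minimal) (use m in simp)
  have "reducing (orth M (precompact {}))"
    using reducing_precompact[of "{}"]
    by (intro reducing_orth) (auto simp: precompact_in reducing_res)
  then have Xpre: "X \<subseteq> orth M (precompact {})" unfolding X_def by (rule red_span_minimal) (use m in simp)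
  have XH: "x \<in> carrier M" if "x \<in> X" for x using reducing_sub[OF X] that by auto
  have spec: "spectrum (sub_space X) (sub_graph X) \<subseteq> ess_spectrum M (opgraph M)"
  proof -
    have "l \<notin> spectrum (sub_space X) (sub_graph X)" if l: "l \<notin> ess_spectrum M (opgraph M)" for l
    proof (rule reducing_not_in_spectrum[OF l X])
      fix x assume "Im l = 0" "x \<in> X" "(x, l \<odot> x) \<in> opgraph M"
      then have "x \<in> precompact {}" "x \<in> orth M (precompact {})"
        using eigenvector_precompact[OF _ l] Xpre by auto
      then have "cinner M x x = 0" by (intro orthD)
      then show "x = \<zero>" using XH[OF \<open>x \<in> X\<close>] cinner_eq_zero_iff by blast
    qed
    then show ?thesis by blast
  qed
  obtain k where k: "\<And>n::nat. emb X (k n)"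
    "\<And>n n' a b. n \<noteq> n' \<Longrightarrow> a \<in> X \<Longrightarrow> b \<in> X \<Longrightarrow> cinner M (k n a) (k n' b) = 0"
    using orthogonal_copies[OF M0 card MK univ X Xcard spec] by blast
  obtain Y where Y: "orth_family X Y" and large: "\<not> |Y| <o \<kappa>"
    using large_orth_family[OF \<kappa> ctm MK hom X Xcard mX m0 k] .
  have embs: "emb X j" if "j \<in> Y" for j using Y that by (auto simp: orth_family_def)
  \<comment> \<open>The copies that are not orthogonal to \<open>m\<close> or to some element of
    \<open>G\<close>; each vector contributes countably many.\<close>
  define B where "B = (\<Union>g\<in>insert m G. {j \<in> Y. \<exists>x\<in>X. cinner M g (j x) \<noteq> 0})"
  have infF: "infinite (Field \<kappa>)"
  proof
    assume "finite (Field \<kappa>)"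
    moreover have "|UNIV :: real set| \<le>o |Field \<kappa>|"
      using ordLess_imp_ordLeq[OF ctm] card_of_Field_ordIso[OF \<kappa>] ordIso_symmetric ordLeq_ordIso_trans
      by blast
    ultimately show False using card_of_ordLeq_finite infinite_real by blast
  qed
  \<comment> \<open>Polymorphic, as it is applied both to sets of vectors and to sets of
    maps.\<close>
  have finite_small: "|A| <o \<kappa>" if "finite A" for A :: "'z set"
    using finite_ordLess_infinite[OF card_of_Well_order, of \<kappa> A] that infF \<kappa>
    by (simp add: Field_card_of card_order_on_def)
  have "|B| \<le>o |insert m G <+> (UNIV :: real set)|"
    unfolding B_def
  proof (rule card_of_UNION_ordLeq_infinite)
    show "infinite (insert m G <+> (UNIV :: real set))" by (simp add: infinite_real)
    show "|insert m G| \<le>o |insert m G <+> (UNIV :: real set)|" by (rule card_of_Plus1)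
    show "\<forall>g\<in>insert m G. |{j \<in> Y. \<exists>x\<in>X. cinner M g (j x) \<noteq> 0}| \<le>o |insert m G <+> (UNIV :: real set)|"
    proof
      fix g assume "g \<in> insert m G"
      then have "countable {j \<in> Y. \<exists>x\<in>X. cinner M g (j x) \<noteq> 0}"
        using orth_family_countable[OF Y X] G(1) mH by blast
      then obtain f :: "('a \<Rightarrow> 'a) \<Rightarrow> nat" where "inj_on f {j \<in> Y. \<exists>x\<in>X. cinner M g (j x) \<noteq> 0}"
        unfolding countable_def by blast
      then have "inj_on (\<lambda>j. real (f j)) {j \<in> Y. \<exists>x\<in>X. cinner M g (j x) \<noteq> 0}"
        by (auto simp: inj_on_def)
      then show "|{j \<in> Y. \<exists>x\<in>X. cinner M g (j x) \<noteq> 0}| \<le>o |insert m G <+> (UNIV :: real set)|"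
        using ordLeq_realI card_of_Plus2 ordLeq_transitive by blast
    qed
  qed
  moreover have "|insert m G| <o \<kappa>"
    using card_of_Un_ordLess_infinite_Field[OF infF \<kappa> finite_small[of "{m}"] G(2)] by simp
  then have "|insert m G <+> (UNIV :: real set)| <o \<kappa>"
    by (rule card_of_Plus_ordLess_infinite_Field[OF infF \<kappa> _ ctm])
  ultimately have Bsmall: "|B| <o \<kappa>" by (rule ordLeq_ordLess_trans)
  have inf: "infinite (Y - B)"
  proof
    assume "finite (Y - B)"
    then have "|B \<union> (Y - B)| <o \<kappa>"
      by (intro card_of_Un_ordLess_infinite_Field[OF infF \<kappa> Bsmall] finite_small)
    moreover have "|Y| \<le>o |B \<union> (Y - B)|" by (rule card_of_mono1) blast
    ultimately show False using large ordLeq_ordLess_trans by blast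
  qed
  have conj: "\<exists>U\<in>Aut_over M G. U m = j m" if j: "j \<in> Y - B" for j
  proof -
    have jY: "j \<in> Y" using j by blast
    have gj: "cinner M g (j x) = 0" if "g \<in> insert m G" "x \<in> X" for g x
      using j that by (auto simp: B_def)
    note jH = emb_facts(1)[OF embs[OF jY]]
    have red: "reducing (orth M (j ` X))"
    proof (rule reducing_orth)
      have "reducing (j ` X)" using intertwiner.reducing_range[OF embs[OF jY]] by simp
      then show "res M (opgraph M) \<i> v \<in> j ` X" "res M (opgraph M) (-\<i>) v \<in> j ` X" if "v \<in> j ` X" for v
        using reducing_res that by blast+
    qed (use jH in auto)
    \<comment> \<open>Orthogonality of \<open>m\<close> alone to the copy spreads to
      \<open>X\<close>, since the complement of the copy is reducing.\<close>
    have "X \<subseteq> orth M (j ` X)"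
      unfolding X_def by (rule red_span_minimal) (use red gj mH in \<open>auto simp: orth_def X_def\<close>)
    then have orth: "cinner M x (j y) = 0"
      if "x \<in> carrier (sub_space X)" "y \<in> carrier (sub_space X)" for x y
      using that by (auto simp: orth_def)
    obtain U where U: "automorphism M U" "\<forall>a\<in>carrier (sub_space X). U a = j a"
      "\<forall>z\<in>carrier M. (\<forall>a\<in>carrier (sub_space X). cinner M z a = 0) \<longrightarrow>
       (\<forall>a\<in>carrier (sub_space X). cinner M z (j a) = 0) \<longrightarrow> U z = z"
      by (rule swap_automorphism[OF emb_id[OF X] embs[OF jY] orth])
    have "U g = g" if g: "g \<in> G" for g
    proof (rule U(3)[rule_format])
      show gH: "g \<in> carrier M" using g G(1) by auto
      have "g \<in> dcl M G" using g gH by (auto simp: dcl_def Aut_over_def)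
      then have "cinner M x g = 0" if "x \<in> X" for x using orthD Xdcl that by blast
      then show "cinner M g a = 0" if "a \<in> carrier (sub_space X)" for a
        using that cinner_commute[OF gH XH] by simp
      show "cinner M g (j a) = 0" if "a \<in> carrier (sub_space X)" for a using gj that g by simp
    qed
    then have "U \<in> Aut_over M G" using U(1) by (simp add: Aut_over_def)
    then show ?thesis using U(2) mX by auto
  qed
  have nm: "hnorm M m > 0"
    using hnorm_eq_0_iff[OF mH] hnorm_ge_0[OF mH] m0 by linarith
  then have e: "hnorm M m / 2 > 0" by simp
  obtain F where F: "finite F" "F \<subseteq> carrier M"
    "\<And>U. U \<in> Aut_over M G \<Longrightarrow> \<exists>y\<in>F. hnorm M (U m \<ominus> y) < hnorm M m / 2"
    using precompactD[OF m(1) e] by blast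
  have "\<exists>y. y \<in> F \<and> hnorm M (j m \<ominus> y) < hnorm M m / 2" if j: "j \<in> Y - B" for j
  proof -
    obtain U where "U \<in> Aut_over M G" "U m = j m" using conj[OF j] by blast
    then show ?thesis using F(3)[of U] by auto
  qed
  then have "\<forall>j\<in>Y - B. \<exists>y. y \<in> F \<and> hnorm M (j m \<ominus> y) < hnorm M m / 2" by blast
  from bchoice[OF this] obtain y where y: "\<forall>j\<in>Y - B. y j \<in> F \<and> hnorm M (j m \<ominus> y j) < hnorm M m / 2" ..
  \<comment> \<open>The images of \<open>m\<close> under distinct copies are orthogonal of equal
    norm, hence at distance at least that norm, and cannot both lie within half of it from one
    centre.\<close>
  have "inj_on y (Y - B)"
  proof (rule inj_onI, rule ccontr)
    fix j l assume j: "j \<in> Y - B" and l: "l \<in> Y - B" and eq: "y j = y l" and ne: "j \<noteq> l"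
    have H: "j m \<in> carrier M" "l m \<in> carrier M" "y j \<in> carrier M"
      using emb_facts(1)[OF embs mX] j l y F(2) by auto
    have "cinner M (j m) (l m) = 0" using Y j l ne mX by (auto simp: orth_family_def)
    moreover have "hnorm M (j m) = hnorm M m" "hnorm M (l m) = hnorm M m"
      using emb_facts(2)[OF embs mX mX] j l by (auto simp: hnorm_def)
    ultimately have "(hnorm M (j m \<ominus> l m))\<^sup>2 = 2 * (hnorm M m)\<^sup>2"
      using H by (simp add: hnorm_diff_sq)
    then have "(hnorm M m)\<^sup>2 \<le> (hnorm M (j m \<ominus> l m))\<^sup>2" by simp
    then have ge: "hnorm M m \<le> hnorm M (j m \<ominus> l m)"
      by (rule power2_le_imp_le) (use H in simp)
    have "hnorm M (j m \<ominus> l m) \<le> hnorm M (j m \<ominus> y j) + hnorm M (y j \<ominus> l m)"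
      by (rule hnorm_diff_triangle) (use H in auto)
    also have "hnorm M (y j \<ominus> l m) = hnorm M (l m \<ominus> y l)"
      using H eq by (simp add: hnorm_diff_commute)
    also have "hnorm M (j m \<ominus> y j) + hnorm M (l m \<ominus> y l) < hnorm M m"
      using y[rule_format, OF j] y[rule_format, OF l] by linarith
    finally show False using ge by simp
  qed
  moreover have "y ` (Y - B) \<subseteq> F" using y by blast
  ultimately have "finite (Y - B)" using F(1) finite_imageD finite_subset by blast
  then show False using inf by blast
qed

end

theorem theorem4p6:
  fixes M0 :: "'h op_structure"
    and M :: "'a op_structure"
    and \<kappa> :: "'k rel"
    and G :: "'a set"
  assumes "unbounded_sa_structure M0"
    and "Card_order \<kappa>"
    and "|carrier M0| <o \<kappa>"
    and "\<kappa> \<le>o |UNIV :: 'a set|"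
    and "monster_model M0 \<kappa> M"
    and "G \<subseteq> carrier M"
    and "|G| <o \<kappa>"
  shows "acl M G = closed_span M (dcl M G \<union> acl M {})"
proof -
  have "unbounded_sa_structure M" using assms(5) by (simp add: monster_model_def K_class_def)
  then interpret op_space M by (rule unbounded_sa_structure_op_space)
  have acl: "acl M G = precompact G" "acl M {} = precompact {}"
    by (rule acl_eq_precompact, use assms(6) in simp)+
  note C = reducing_closed_subspace[OF reducing_precompact[of G]]
  define L where "L = closed_span M (dcl M G \<union> precompact {})"
  have gen: "dcl M G \<union> precompact {} \<subseteq> precompact G"
    using dcl_subset_acl[of G] acl precompact_mono[of "{}" G] by auto
  have LC: "closed_subspace M L"
    unfolding L_def using gen closed_subspaceD(1)[OF C] by (intro closed_subspace_closed_span) blast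
  have sub: "L \<subseteq> precompact G" unfolding L_def by (rule closed_span_minimal[OF C gen])
  have genL: "dcl M G \<union> precompact {} \<subseteq> L" unfolding L_def by (rule closed_span_superset)
  have "precompact G \<subseteq> L"
  proof
    fix x assume x: "x \<in> precompact G"
    have xH: "x \<in> carrier M" by (rule precompact_in[OF x])
    \<comment> \<open>\<open>L\<close> lies inside the subspace \<open>precompact G\<close>, so the
      remainder stays there; it is orthogonal to the generators of \<open>L\<close>, hence
      vanishes.\<close>
    let ?m = "x \<ominus>\<^bsub>M\<^esub> proj M L x"
    have "?m \<in> precompact G" using closed_subspaceD(5)[OF C x] proj_mem[OF LC xH] sub by blast
    moreover have "?m \<in> orth M L" by (rule diff_proj_orth[OF LC xH])
    then have "?m \<in> orth M (dcl M G)" "?m \<in> orth M (precompact {})"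
      using genL by (auto simp: orth_def)
    ultimately have "?m = \<zero>\<^bsub>M\<^esub>" by (rule precompact_orth_zero[OF assms])
    then have "x = proj M L x" using xH proj_in[OF LC xH] by (simp add: diff_eq_zero_iff)
    then show "x \<in> L" using proj_mem[OF LC xH] by simp
  qed
  then show ?thesis using sub unfolding acl L_def by blast
qed

end
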